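(* (a) Let $1\le q<p<+\infty$ and let $D\in\mathcal H^r$ with $r=pq/(p-q)$. Let $M_D:\mathcal H^p\to\mathcal H^q$, $f\mapsto Df$. Then $\|M_D\|_{e,p\to q}=\|D\|_r$. (b) Let $D\in\mathcal H^\infty$ and let $M_D:\mathcal H^1\to\mathcal H^1$, $f\mapsto Df$. Then $\|M_D\|_{e,1\to1}=\|D\|_\infty$.
   Context: For $1\le p<+\infty$, $\mathcal H^p$ is the Hardy space of Dirichlet series: the completion of the space of Dirichlet polynomials $\sum_{n=1}^N a_nn^{-s}$ ($a_n\in\mathbb C$, $N\in\mathbb N$) under the norm $$\Big\|\sum_{n=1}^N a_nn^{-s}\Big\|_p^p=\lim_{T\to+\infty}\frac1{2T}\int_{-T}^T\Big|\sum_{n=1}^N a_nn^{it}\Big|^p\,dt.$$ Elements of $\mathcal H^p$ are Dirichlet series which converge and are holomorphic in the half-plane $\mathbb C_{1/2}$, where $\mathbb C_a=\{s\in\mathbb C:\ \mathrm{Re}(s)>a\}$. $\mathcal H^\infty$ is the space of Dirichlet series that define a bounded holomorphic function on $\mathbb C_0$, with norm $\|D\|_\infty=\sup_{\mathrm{Re}(s)>0}|D(s)|$. For $1\le q<p<\infty$ and $D\in\mathcal H^r$, $r=pq/(p-q)$, multiplication by $D$ is bounded from $\mathcal H^p$ to $\mathcal H^q$; for $D\in\mathcal H^\infty$ it is bounded on $\mathcal H^p$. $\|T\|_{e,p\to q}=\inf\{\|T-K\|:\ K:\mathcal H^p\to\mathcal H^q\text{ compact}\}$ is the essential norm of $T:\mathcal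 H^p\to\mathcal H^q$. *)

theory Defs
  imports "HOL-Analysis.Analysis"
begin

text \<open>
  A Dirichlet series \<open>\<Sum>n\<ge>1. a\<^sub>n n\<^sup>-\<^sup>s\<close> is represented by its coefficient sequence
  \<open>a :: nat \<Rightarrow> complex\<close>, normalised by \<open>a 0 = 0\<close>.
\<close>

definition dirichlet_eval :: "(nat \<Rightarrow> complex) \<Rightarrow> complex \<Rightarrow> complex" where
  "dirichlet_eval a s = (\<Sum>n. a n * of_nat n powr (- s))"

text \<open>
  The product of two Dirichlet series is the Dirichlet convolution of the coefficients;
  \<open>dirichlet_eval_mult\<close> below confirms that it is the pointwise product of the two functions
  wherever both series converge absolutely.
\<close>

definition dirichlet_mult :: "(nat \<Rightarrow> complex) \<Rightarrow> (nat \<Rightarrow> complex) \<Rightarrow> nat \<Rightarrow> complex" where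
  "dirichlet_mult a b n = (if n = 0 then 0 else \<Sum>d | d dvd n. a d * b (n div d))"

lemma dirichlet_eval_mult:
  assumes a0: "a 0 = 0" and b0: "b 0 = 0"
    and A: "summable (\<lambda>n. norm (a n * of_nat n powr (- s)))"
    and B: "summable (\<lambda>n. norm (b n * of_nat n powr (- s)))"
  shows "dirichlet_eval (dirichlet_mult a b) s = dirichlet_eval a s * dirichlet_eval b s"
proof -
  define f g where "f = (\<lambda>n. a n * of_nat n powr (- s))" and "g = (\<lambda>n. b n * of_nat n powr (- s))"
  have fs: "(\<lambda>n. norm (f n)) summable_on UNIV" and gs: "(\<lambda>n. norm (g n)) summable_on UNIV"
    unfolding f_def g_def using A B by (simp_all add: summable_on_UNIV_nonneg_real_iff)
  let ?N = "{1..} :: nat set"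
  have f0: "f 0 = 0" and g0: "g 0 = 0"
    by (simp_all add: f_def g_def a0 b0)
  have sums: "dirichlet_eval a s = infsum f UNIV" "dirichlet_eval b s = infsum g UNIV"
    using has_sum_imp_sums[OF has_sum_infsum[OF abs_summable_summable[OF fs]]]
      has_sum_imp_sums[OF has_sum_infsum[OF abs_summable_summable[OF gs]]]
    by (simp_all add: dirichlet_eval_def f_def g_def sums_iff)
  have prod: "((\<lambda>(m, n). f m * g n) has_sum (infsum f UNIV * infsum g UNIV)) (UNIV \<times> UNIV)"
  proof -
    have "(\<lambda>x. norm ((\<lambda>(m, n). f m * g n) x)) summable_on (UNIV \<times> UNIV)"
      by (rule summable_on_SigmaI[where g = "\<lambda>m. norm (f m) * (\<Sum>\<^sub>\<infinity>n. norm (g n))"])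
        (auto simp: norm_mult intro!: has_sum_cmult_right has_sum_infsum gs
          summable_on_cmult_left fs)
    then have S: "(\<lambda>(m, n). f m * g n) summable_on (UNIV \<times> UNIV)"
      by (rule abs_summable_summable)
    have "infsum (\<lambda>(m, n). f m * g n) (UNIV \<times> UNIV) = infsum f UNIV * infsum g UNIV"
      using infsum_Sigma_banach[OF S]
      by (simp add: infsum_cmult_right' infsum_cmult_left')
    with S show ?thesis by (metis has_sum_infsum)
  qed
  have prod1: "((\<lambda>(m, n). f m * g n) has_sum (infsum f UNIV * infsum g UNIV)) (?N \<times> ?N)"
    by (rule iffD1[OF has_sum_cong_neutral prod])
      (auto simp: f0 g0 Suc_le_eq intro: ccontr)
  have "((\<lambda>(k, d). f d * g (k div d)) has_sum (infsum f UNIV * infsum g UNIV))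
          (SIGMA k:?N. {d. d dvd k})"
    by (rule iffD1[OF has_sum_reindex_bij_witness[of _ "\<lambda>(k, d). (d, k div d)"
          "\<lambda>(m, n). (m * n, m)"] prod1])
      (auto simp: Suc_le_eq dvd_div_eq_0_iff intro: Nat.gr0I)
  then have "((\<lambda>k. \<Sum>d | d dvd k. f d * g (k div d)) has_sum (infsum f UNIV * infsum g UNIV)) ?N"
    by (rule has_sum_SigmaD) (auto intro!: has_sum_finiteI)
  also have "?this \<longleftrightarrow> ((\<lambda>k. dirichlet_mult a b k * of_nat k powr (- s)) has_sum
      (infsum f UNIV * infsum g UNIV)) UNIV"
  proof (rule has_sum_cong_neutral)
    fix k assume "k \<in> ?N \<inter> UNIV"
    then have k: "k > 0" by auto
    have "f d * g (k div d) = a d * b (k div d) * of_nat k powr (- s)" if "d dvd k" for d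
    proof -
      from that obtain e where e: "k = d * e" by auto
      with k have "d > 0" by auto
      with e show ?thesis
        by (simp add: f_def g_def powr_times_real of_nat_mult)
    qed
    then show "(\<Sum>d | d dvd k. f d * g (k div d)) = dirichlet_mult a b k * of_nat k powr (- s)"
      using k by (simp add: dirichlet_mult_def sum_distrib_right)
  qed (auto simp: dirichlet_mult_def not_le)
  finally show ?thesis
    by (simp add: dirichlet_eval_def[of "dirichlet_mult a b"] sums sums_unique[symmetric] has_sum_imp_sums)
qed

definition dirichlet_poly :: "(nat \<Rightarrow> complex) \<Rightarrow> bool" where
  "dirichlet_poly a \<longleftrightarrow> a 0 = 0 \<and> finite {n. a n \<noteq> 0}"

definition poly_norm :: "real \<Rightarrow> (nat \<Rightarrow> complex) \<Rightarrow> real" where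
  "poly_norm p a =
     (Lim at_top (\<lambda>T. 1 / (2 * T) *
        integral {-T..T}
          (\<lambda>t. norm (\<Sum>n | a n \<noteq> 0. a n * of_nat n powr (\<i> * of_real t)) powr p))) powr (1 / p)"

text \<open>
  The completion of the Dirichlet polynomials is realised inside the space of Dirichlet series:
  since \<open>norm (a n) \<le> poly_norm p a\<close>, a Cauchy sequence of Dirichlet polynomials converges
  coefficientwise; its limit in the completion is identified with the resulting Dirichlet series
  (a Cauchy sequence whose coefficients all tend to 0 has norms tending to 0, so nothing is
  identified that the completion separates), and the norm of the limit is the limit of the norms.
\<close>

definition hardy_approx :: "real \<Rightarrow> (nat \<Rightarrow> nat \<Rightarrow> complex) \<Rightarrow> (nat \<Rightarrow> complex) \<Rightarrow> bool" where
  "hardy_approx p P a \<longleftrightarrow>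
     (\<forall>k. dirichlet_poly (P k)) \<and>
     (\<forall>e>0. \<exists>N. \<forall>j\<ge>N. \<forall>k\<ge>N. poly_norm p (\<lambda>n. P j n - P k n) < e) \<and>
     (\<forall>n. (\<lambda>k. P k n) \<longlonglongrightarrow> a n)"

definition hardy :: "real \<Rightarrow> (nat \<Rightarrow> complex) set" where
  "hardy p = {a. \<exists>P. hardy_approx p P a}"

definition hardy_norm :: "real \<Rightarrow> (nat \<Rightarrow> complex) \<Rightarrow> real" where
  "hardy_norm p a = (THE l. \<exists>P. hardy_approx p P a \<and> (\<lambda>k. poly_norm p (P k)) \<longlonglongrightarrow> l)"

definition hardy_inf :: "(nat \<Rightarrow> complex) set" where
  "hardy_inf = {a. a 0 = 0 \<and>
     (\<forall>s. Re s > 0 \<longrightarrow> summable (\<lambda>n. a n * of_nat n powr (- s))) \<and>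
     dirichlet_eval a holomorphic_on {s. Re s > 0} \<and>
     bounded (dirichlet_eval a ` {s. Re s > 0})}"

definition hardy_inf_norm :: "(nat \<Rightarrow> complex) \<Rightarrow> real" where
  "hardy_inf_norm a = (SUP s\<in>{s. Re s > 0}. norm (dirichlet_eval a s))"

text \<open>
  Operators between Hardy spaces are functions on coefficient sequences of which only the values
  on the domain space matter. The operator norm is extended-real valued, so that it is \<open>\<infinity>\<close>
  for an unbounded operator.
\<close>

definition op_norm ::
    "real \<Rightarrow> real \<Rightarrow> ((nat \<Rightarrow> complex) \<Rightarrow> nat \<Rightarrow> complex) \<Rightarrow> ereal" where
  "op_norm p q T = (SUP f\<in>{f \<in> hardy p. hardy_norm p f \<le> 1}. ereal (hardy_norm q (T f)))"

definition compact_operator ::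
    "real \<Rightarrow> real \<Rightarrow> ((nat \<Rightarrow> complex) \<Rightarrow> nat \<Rightarrow> complex) \<Rightarrow> bool" where
  "compact_operator p q K \<longleftrightarrow>
     K \<in> hardy p \<rightarrow> hardy q \<and>
     (\<forall>f\<in>hardy p. \<forall>g\<in>hardy p. K (\<lambda>n. f n + g n) = (\<lambda>n. K f n + K g n)) \<and>
     (\<forall>c. \<forall>f\<in>hardy p. K (\<lambda>n. c * f n) = (\<lambda>n. c * K f n)) \<and>
     (\<forall>F. range F \<subseteq> hardy p \<and> bounded (range (\<lambda>k. hardy_norm p (F k))) \<longrightarrow>
        (\<exists>g\<in>hardy q. \<exists>\<phi>::nat \<Rightarrow> nat. strict_mono \<phi> \<and>
           (\<lambda>k. hardy_norm q (\<lambda>n. K (F (\<phi> k)) n - g n)) \<longlonglongrightarrow> 0))"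

definition essential_norm ::
    "real \<Rightarrow> real \<Rightarrow> ((nat \<Rightarrow> complex) \<Rightarrow> nat \<Rightarrow> complex) \<Rightarrow> ereal" where
  "essential_norm p q T = (INF K\<in>{K. compact_operator p q K}. op_norm p q (\<lambda>f n. T f n - K f n))"

end

(* Upper bounds: Hoelder's inequality for (a). For (b), shifting vertical lines of integration shows that
   the coefficients of D represent a functional of norm at most sup |D| on trigonometric polynomials
   with the Besicovitch 1-norm; duality turns this into the bound for the multiplication operator.

   Lower bounds: multiplication by m^(-s) is isometric and commutes with multiplication by D. If K is compact,
   then along a subsequence K (m^(-s) f) converges in norm, and the limit is 0 because averages of the
   functions m^(-s) f tend to 0 in H^p, quantitatively as a power of the number of summands. Hence the
   distance from M_D to the compact operators is the norm of M_D on Dirichlet polynomials. For (a) this norm is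
   attained asymptotically at approximations of |D|^(r/p), which become analytic after clearing the
   denominators of their frequencies. For (b), the H^1-norms of the powers D^k give the bound by taking
   k-th roots of point evaluations on series over smooth numbers, followed by a normal family argument. *)

theory Submission
  imports Defs "HOL-Complex_Analysis.Complex_Analysis"
begin

subsection \<open>Bohr means\<close>

text \<open>No measure space is built. All norms are Bohr means, taken on the uniform closure of
  trigonometric polynomials with frequencies \<open>ln m - ln n\<close>. This class is an algebra
  closed under conjugation and under continuous functions of the modulus, so it supports Hoelder,
  Minkowski and duality; with arbitrary real frequencies the denominators could not be cleared. An
  element of the completion is known only by its coefficients. Its norm is well defined because the
  norms are lower semicontinuous under convergence of coefficients; this has to hold at p = 1 as
  well, where reflexivity gives nothing. Continuity of a compact operator is not written into its
  definition. A second use of compactness, on suitably normalised sums of shifts, supplies the bound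
  that is needed. In (b) the truncations of D need not be uniformly bounded, so D acts through
  limits of means against its truncations. The bound for this functional also puts D into H^2, where
  truncations do converge. Point evaluations are unbounded on H^1 for Re s <= 1/2; on series over
  smooth numbers a finite Euler product bounds them for every Re s > 0.\<close>

definition avg :: "real \<Rightarrow> (real \<Rightarrow> 'a::banach) \<Rightarrow> 'a" where
  "avg T f = (1 / (2 * T)) *\<^sub>R integral {-T..T} f"

text \<open>\<open>Lim\<close> is a choice operator, so the value means something only once
  convergence is known; \<open>avg_tendsto_mean\<close> provides this for almost periodic
  functions.\<close>

definition mean :: "(real \<Rightarrow> 'a::banach) \<Rightarrow> 'a" where
  "mean f = Lim at_top (\<lambda>T. avg T f)"

lemma integrable_on_Icc:
  fixes f :: "real \<Rightarrow> 'a::banach"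
  shows "continuous_on UNIV f \<Longrightarrow> f integrable_on {a..b}"
  by (rule integrable_continuous_interval) (rule continuous_on_subset, auto)

lemma avg_norm_le:
  fixes f :: "real \<Rightarrow> 'a::banach"
  assumes "continuous_on UNIV f" "\<And>t. norm (f t) \<le> B" "T > 0"
  shows "norm (avg T f) \<le> B"
proof -
  have B: "B \<ge> 0" using assms(2)[of 0] norm_ge_zero[of "f 0"] by linarith
  have "norm (integral {-T..T} f) \<le> B * (2 * T)"
    using has_integral_bound_real[OF B finite.emptyI integrable_integral[OF integrable_on_Icc[OF assms(1)]], of "-T" T]
      assms(2,3) by simp
  then show ?thesis using assms(3) by (simp add: avg_def field_simps)
qed

lemma avg_add:
  fixes f g :: "real \<Rightarrow> 'a::banach"
  assumes "continuous_on UNIV f" "continuous_on UNIV g"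
  shows "avg T (\<lambda>t. f t + g t) = avg T f + avg T g"
  by (simp add: avg_def integral_add integrable_on_Icc assms scaleR_add_right)

lemma avg_diff:
  fixes f g :: "real \<Rightarrow> 'a::banach"
  assumes "continuous_on UNIV f" "continuous_on UNIV g"
  shows "avg T (\<lambda>t. f t - g t) = avg T f - avg T g"
  by (simp add: avg_def integral_diff integrable_on_Icc assms scaleR_diff_right)

lemma avg_bounded_linear:
  fixes f :: "real \<Rightarrow> 'a::banach"
  assumes "bounded_linear h" "continuous_on UNIV f"
  shows "avg T (\<lambda>t. h (f t)) = h (avg T f)"
  using integral_linear[OF integrable_on_Icc[OF assms(2)] assms(1), of "-T" T]
  by (simp add: avg_def o_def linear_scale[OF bounded_linear.linear[OF assms(1)]])

lemma avg_cmult: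
  fixes f :: "real \<Rightarrow> 'a::{banach, real_normed_algebra}"
  assumes "continuous_on UNIV f"
  shows "avg T (\<lambda>t. c * f t) = c * avg T f"
  by (rule avg_bounded_linear[OF bounded_linear_mult_right assms])

lemma avg_mono:
  fixes f g :: "real \<Rightarrow> real"
  assumes "continuous_on UNIV f" "continuous_on UNIV g" "\<And>t. f t \<le> g t" "T > 0"
  shows "avg T f \<le> avg T g"
  using integral_le[OF integrable_on_Icc[OF assms(1)] integrable_on_Icc[OF assms(2)], of "-T" T] assms(3,4)
  by (simp add: avg_def divide_right_mono)

text \<open>Averaging is a contraction for the sup norm, uniformly in \<open>T > 0\<close>. Uniform
  convergence of the integrands therefore allows the limits in \<open>n\<close> and in
  \<open>T\<close> to be exchanged.\<close>

lemma avg_tendsto_uniform_limit: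
  fixes f :: "'b \<Rightarrow> real \<Rightarrow> 'a::banach"
  assumes "\<forall>\<^sub>F n in F. ((\<lambda>T. avg T (f n)) \<longlongrightarrow> m n) at_top" "(m \<longlongrightarrow> l) F"
    and u: "uniform_limit UNIV f h F" and c: "\<forall>\<^sub>F n in F. continuous_on UNIV (f n)"
    and F: "F \<noteq> bot"
  shows "((\<lambda>T. avg T h) \<longlongrightarrow> l) at_top"
proof (rule swap_uniform_limit'[OF assms(1,2)])
  have ch: "continuous_on UNIV h"
    using uniform_limit_theorem[OF c u] F by (simp add: trivial_limit_def)
  show "uniform_limit {0<..} (\<lambda>n T. avg T (f n)) (\<lambda>T. avg T h) F"
  proof (rule uniform_limitI)
    fix e :: real assume e: "e > 0"
    have "\<forall>\<^sub>F n in F. \<forall>x. dist (f n x) (h x) < e / 2"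
      using uniform_limitD[OF u, of "e/2"] e by simp
    with c show "\<forall>\<^sub>F n in F. \<forall>T\<in>{0<..}. dist (avg T (f n)) (avg T h) < e"
    proof eventually_elim
      case (elim n)
      have "norm (avg T (\<lambda>t. f n t - h t)) \<le> e / 2" if "T > 0" for T
        by (rule avg_norm_le) (use elim ch that in \<open>auto simp: dist_norm less_imp_le intro!: continuous_intros\<close>)
      then show ?case using e by (auto simp: dist_norm avg_diff elim ch intro: le_less_trans[of _ "e/2"])
    qed
  qed
qed (use F in \<open>auto simp: eventually_gt_at_top trivial_limit_def\<close>)

text \<open>For \<open>w \<noteq> 0\<close> the primitive is bounded, so the average is O(1/T). All
  orthogonality relations below rest on this.\<close>

lemma avg_cis: "((\<lambda>T. avg T (\<lambda>t. cis (t * w))) \<longlongrightarrow> (if w = 0 then 1 else 0)) at_top"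
proof (cases "w = 0")
  case True
  have "\<forall>\<^sub>F T::real in at_top. avg T (\<lambda>t. cis (t * w)) = 1"
    using eventually_gt_at_top[of 0] by eventually_elim (simp add: avg_def True scaleR_conv_of_real)
  then show ?thesis using True by (simp add: tendsto_eventually)
next
  case False
  have I: "integral {-T..T} (\<lambda>t. cis (t * w)) = (cis (T * w) - cis (- T * w)) / (\<i> * w)" if "T > 0" for T
  proof (rule integral_unique)
    have "((\<lambda>t. cis (t * w)) has_integral cis (T * w) / (\<i> * w) - cis (- T * w) / (\<i> * w)) {-T..T}"
    proof (rule fundamental_theorem_of_calculus)
      show "-T \<le> T" using that by simp
      fix t
      have "((\<lambda>t. exp (\<i> * (complex_of_real t * w)) / (\<i> * w)) has_vector_derivative exp (\<i> * (complex_of_real t * w))) (at t within {- T..T})"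
        by (rule has_vector_derivative_real_field derivative_eq_intros refl | simp add: False algebra_simps)+
      then show "((\<lambda>t. cis (t * w) / (\<i> * w)) has_vector_derivative cis (t * w)) (at t within {- T..T})"
        by (simp add: cis_conv_exp)
    qed
    then show "((\<lambda>t. cis (t * w)) has_integral (cis (T * w) - cis (- T * w)) / (\<i> * w)) {-T..T}"
      by (simp add: diff_divide_distrib)
  qed
  have "((\<lambda>T. avg T (\<lambda>t. cis (t * w))) \<longlongrightarrow> 0) at_top"
  proof (rule Lim_null_comparison)
    show "\<forall>\<^sub>F T in at_top. norm (avg T (\<lambda>t. cis (t * w))) \<le> (1 / \<bar>w\<bar>) * inverse T"
      using eventually_gt_at_top[of 0]
    proof eventually_elim
      case (elim T)
      have "norm (cis (T * w) - cis (- T * w)) \<le> 2"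
        using norm_triangle_ineq4[of "cis (T * w)" "cis (- T * w)"] by simp
      then show ?case using elim False by (simp add: avg_def I norm_divide norm_mult field_simps)
    qed
    show "((\<lambda>T::real. (1 / \<bar>w\<bar>) * inverse T) \<longlongrightarrow> 0) at_top"
      by (rule tendsto_mult_right_zero, rule tendsto_inverse_0_at_top, rule filterlim_ident)
  qed
  then show ?thesis using False by simp
qed

subsection \<open>Almost periodic functions\<close>

text \<open>Trigonometric polynomials whose frequencies are logarithms of positive rationals: what
  products of Dirichlet polynomials with conjugates of such look like on the imaginary axis.\<close>

inductive rat_trig :: "(real \<Rightarrow> complex) \<Rightarrow> bool" where
  monomial: "m > 0 \<Longrightarrow> n > 0 \<Longrightarrow> rat_trig (\<lambda>t. c * cis (t * (ln (real m) - ln (real n))))"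
| add: "rat_trig f \<Longrightarrow> rat_trig g \<Longrightarrow> rat_trig (\<lambda>t. f t + g t)"

text \<open>Bohr almost periodic functions with spectrum in the logarithms of the positive
  rationals.\<close>

definition almost_per :: "(real \<Rightarrow> complex) \<Rightarrow> bool" where
  "almost_per f \<longleftrightarrow> (\<forall>e>0. \<exists>g. rat_trig g \<and> (\<forall>t. norm (f t - g t) \<le> e))"

lemma rat_trig_const: "rat_trig (\<lambda>t. c)"
  using rat_trig.monomial[of 1 1 c] by simp

lemma rat_trig_cis: "n > 0 \<Longrightarrow> rat_trig (\<lambda>t. cis (t * ln (real n)))"
  using rat_trig.monomial[of n 1 1] by simp

lemma rat_trig_sum: "finite A \<Longrightarrow> (\<And>x. x \<in> A \<Longrightarrow> rat_trig (f x)) \<Longrightarrow> rat_trig (\<lambda>t. \<Sum>x\<in>A. f x t)"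
  by (induction A rule: finite_induct) (auto intro: rat_trig_const rat_trig.add)

lemma rat_trig_mult:
  assumes "rat_trig f" "rat_trig g"
  shows "rat_trig (\<lambda>t. f t * g t)"
  using assms(1)
proof induction
  case mn: (monomial m n c)
  from assms(2) show ?case
  proof induction
    case (monomial k l d)
    have "rat_trig (\<lambda>t. c * d * cis (t * (ln (real (m * k)) - ln (real (n * l)))))"
      by (rule rat_trig.monomial) (use mn monomial in auto)
    also have "(\<lambda>t. c * d * cis (t * (ln (real (m * k)) - ln (real (n * l))))) =
      (\<lambda>t. c * cis (t * (ln (real m) - ln (real n))) * (d * cis (t * (ln (real k) - ln (real l)))))"
    proof
      fix t
      have "cis (t * (ln (real m) - ln (real n))) * cis (t * (ln (real k) - ln (real l)))
         = cis (t * (ln (real (m * k)) - ln (real (n * l))))"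
        using mn monomial by (simp add: cis_mult ln_mult algebra_simps)
      then show "c * d * cis (t * (ln (real (m * k)) - ln (real (n * l)))) =
        c * cis (t * (ln (real m) - ln (real n))) * (d * cis (t * (ln (real k) - ln (real l))))"
        by (metis mult.assoc mult.left_commute)
    qed
    finally show ?case .
  next
    case (add f g)
    then show ?case using rat_trig.add by (simp add: distrib_left)
  qed
next
  case (add f g)
  then show ?case using rat_trig.add by (simp add: distrib_right)
qed

lemma rat_trig_cnj: "rat_trig f \<Longrightarrow> rat_trig (\<lambda>t. cnj (f t))"
proof (induction rule: rat_trig.induct)
  case (monomial m n c)
  have "(\<lambda>t. cnj (c * cis (t * (ln (real m) - ln (real n))))) = (\<lambda>t. cnj c * cis (t * (ln (real n) - ln (real m))))"
    by (auto simp: fun_eq_iff cis_cnj algebra_simps)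
  then show ?case using rat_trig.monomial monomial by simp
qed (auto intro: rat_trig.add)

lemma rat_trig_bounded: "rat_trig f \<Longrightarrow> \<exists>B>0. \<forall>t. norm (f t) \<le> B"
proof (induction rule: rat_trig.induct)
  case (monomial m n c)
  show ?case by (rule exI[of _ "norm c + 1"]) (auto simp: norm_mult add_nonneg_pos)
next
  case (add f g)
  then obtain B C where "B > 0" "C > 0" "\<forall>t. norm (f t) \<le> B" "\<forall>t. norm (g t) \<le> C" by blast
  then show ?case
    by (intro exI[of _ "B + C"]) (auto intro: norm_triangle_le add_mono)
qed

lemma rat_trig_continuous: "rat_trig f \<Longrightarrow> continuous_on UNIV f"
  by (induction rule: rat_trig.induct) (auto intro!: continuous_intros simp: cis_conv_exp)

lemma rat_trig_avg: "rat_trig f \<Longrightarrow> \<exists>m. ((\<lambda>T. avg T f) \<longlongrightarrow> m) at_top"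
proof (induction rule: rat_trig.induct)
  case (monomial m n c)
  have "((\<lambda>T. c * avg T (\<lambda>t. cis (t * (ln (real m) - ln (real n))))) \<longlongrightarrow>
     c * (if ln (real m) - ln (real n) = 0 then 1 else 0)) at_top"
    by (intro tendsto_intros avg_cis)
  moreover have "continuous_on UNIV (\<lambda>t. cis (t * (ln (real m) - ln (real n))))"
    by (auto intro!: continuous_intros simp: cis_conv_exp)
  ultimately show ?case by (auto simp: avg_cmult)
next
  case (add f g)
  then obtain m1 m2 where "((\<lambda>T. avg T f) \<longlongrightarrow> m1) at_top" "((\<lambda>T. avg T g) \<longlongrightarrow> m2) at_top" by blast
  then have "((\<lambda>T. avg T f + avg T g) \<longlongrightarrow> m1 + m2) at_top" by (rule tendsto_add)
  then show ?case by (auto simp: avg_add rat_trig_continuous add.hyps)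
qed

lemma almost_per_rat_trig: "rat_trig f \<Longrightarrow> almost_per f"
  unfolding almost_per_def by (auto intro!: exI[of _ f])

lemma almost_per_closed:
  assumes "\<And>e. e > 0 \<Longrightarrow> \<exists>g. almost_per g \<and> (\<forall>t. norm (f t - g t) \<le> e)"
  shows "almost_per f"
  unfolding almost_per_def
proof (intro allI impI)
  fix e :: real assume "e > 0"
  then have e2: "e / 2 > 0" by simp
  obtain g where g: "almost_per g" "\<forall>t. norm (f t - g t) \<le> e / 2" using assms[OF e2] by blast
  obtain h where h: "rat_trig h" "\<forall>t. norm (g t - h t) \<le> e / 2" using g(1) e2 unfolding almost_per_def by blast
  have "norm (f t - h t) \<le> e" for t
    using g(2)[rule_format, of t] h(2)[rule_format, of t] norm_triangle_ineq[of "f t - g t" "g t - h t"] by simp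
  with h(1) show "\<exists>g. rat_trig g \<and> (\<forall>t. norm (f t - g t) \<le> e)" by blast
qed

lemma almost_per_seq:
  assumes "almost_per f"
  shows "\<exists>g :: nat \<Rightarrow> real \<Rightarrow> complex. (\<forall>n. rat_trig (g n)) \<and> uniform_limit UNIV g f sequentially"
proof -
  have "\<forall>n::nat. \<exists>g. rat_trig g \<and> (\<forall>t. norm (f t - g t) \<le> inverse (real (Suc n)))"
    using assms by (auto simp: almost_per_def)
  then obtain g where g: "\<And>n. rat_trig (g n)" "\<And>n t. norm (f t - g n t) \<le> inverse (real (Suc n))" by metis
  have "uniform_limit UNIV g f sequentially"
  proof (rule uniform_limitI)
    fix e :: real assume "e > 0"
    then have "\<forall>\<^sub>F n in sequentially. inverse (real (Suc n)) < e"
      using order_tendstoD(2)[OF LIMSEQ_inverse_real_of_nat] by blast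
    then show "\<forall>\<^sub>F n in sequentially. \<forall>x\<in>UNIV. dist (g n x) (f x) < e"
    proof eventually_elim
      case (elim n)
      then show ?case using le_less_trans[OF g(2)[of _ n] elim] by (simp add: dist_norm norm_minus_commute)
    qed
  qed
  with g(1) show ?thesis by blast
qed

lemma almost_per_uniform_limit:
  fixes g :: "nat \<Rightarrow> real \<Rightarrow> complex"
  assumes "\<And>n. almost_per (g n)" "uniform_limit UNIV g f sequentially"
  shows "almost_per f"
proof (rule almost_per_closed)
  fix e :: real assume "e > 0"
  then have "\<forall>\<^sub>F n in sequentially. \<forall>x. dist (g n x) (f x) < e"
    using uniform_limitD[OF assms(2)] by simp
  then obtain n where n: "\<forall>x. dist (g n x) (f x) < e" unfolding eventually_sequentially by blast
  then show "\<exists>g. almost_per g \<and> (\<forall>t. norm (f t - g t) \<le> e)"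
    using assms(1) by (intro exI[of _ "g n"]) (auto simp: dist_norm norm_minus_commute less_imp_le)
qed

lemma almost_per_bounded:
  assumes "almost_per f"
  obtains B where "B > 0" "\<And>t. norm (f t) \<le> B"
proof -
  obtain g where g: "rat_trig g" "\<forall>t. norm (f t - g t) \<le> 1"
    using assms zero_less_one unfolding almost_per_def by blast
  obtain B where "B > 0" "\<forall>t. norm (g t) \<le> B" using rat_trig_bounded[OF g(1)] by blast
  then have "norm (f t) \<le> B + 1" for t
    using g(2)[rule_format, of t] norm_triangle_ineq[of "f t - g t" "g t"] by (smt (verit) diff_add_cancel)
  with \<open>B > 0\<close> show ?thesis by (intro that[of "B + 1"]) auto
qed

lemma almost_per_continuous: "almost_per f \<Longrightarrow> continuous_on UNIV f"
proof -
  assume "almost_per f"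
  then obtain g :: "nat \<Rightarrow> real \<Rightarrow> complex" where "\<And>n. rat_trig (g n)" "uniform_limit UNIV g f sequentially"
    using almost_per_seq by blast
  then show ?thesis by (intro uniform_limit_theorem[where F=sequentially]) (auto intro!: always_eventually rat_trig_continuous)
qed

lemma almost_per_const: "almost_per (\<lambda>t. c)"
  by (intro almost_per_rat_trig rat_trig_const)

lemma almost_per_add: "almost_per f \<Longrightarrow> almost_per g \<Longrightarrow> almost_per (\<lambda>t. f t + g t)"
proof -
  assume fg: "almost_per f" "almost_per g"
  obtain a :: "nat \<Rightarrow> real \<Rightarrow> complex" where a: "\<And>n. rat_trig (a n)" "uniform_limit UNIV a f sequentially"
    using almost_per_seq[OF fg(1)] by blast
  obtain b :: "nat \<Rightarrow> real \<Rightarrow> complex" where b: "\<And>n. rat_trig (b n)" "uniform_limit UNIV b g sequentially"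
    using almost_per_seq[OF fg(2)] by blast
  from a b show ?thesis
    by (intro almost_per_uniform_limit[OF almost_per_rat_trig[OF rat_trig.add] uniform_limit_add])
qed

lemma almost_per_mult: "almost_per f \<Longrightarrow> almost_per g \<Longrightarrow> almost_per (\<lambda>t. f t * g t)"
proof -
  assume fg: "almost_per f" "almost_per g"
  obtain a :: "nat \<Rightarrow> real \<Rightarrow> complex" where a: "\<And>n. rat_trig (a n)" "uniform_limit UNIV a f sequentially"
    using almost_per_seq[OF fg(1)] by blast
  obtain b :: "nat \<Rightarrow> real \<Rightarrow> complex" where b: "\<And>n. rat_trig (b n)" "uniform_limit UNIV b g sequentially"
    using almost_per_seq[OF fg(2)] by blast
  obtain B C where "\<And>t. norm (f t) \<le> B" "\<And>t. norm (g t) \<le> C"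
    using almost_per_bounded[OF fg(1)] almost_per_bounded[OF fg(2)] by metis
  then have "bounded (range f)" "bounded (range g)"
    unfolding bounded_iff by blast+
  with a b show ?thesis
    by (intro almost_per_uniform_limit[OF almost_per_rat_trig[OF rat_trig_mult] uniform_lim_mult])
qed

lemma almost_per_cmult: "almost_per f \<Longrightarrow> almost_per (\<lambda>t. c * f t)"
  by (intro almost_per_mult almost_per_const)

lemma almost_per_diff: "almost_per f \<Longrightarrow> almost_per g \<Longrightarrow> almost_per (\<lambda>t. f t - g t)"
  using almost_per_add[of f "\<lambda>t. -1 * g t"] almost_per_cmult[of g "-1"] by simp

lemma almost_per_cnj: "almost_per f \<Longrightarrow> almost_per (\<lambda>t. cnj (f t))"
  unfolding almost_per_def by (metis rat_trig_cnj complex_cnj_diff complex_mod_cnj)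

section \<open>Continuous functions of the modulus\<close>

lemma rat_trig_poly_norm_sq:
  assumes "real_polynomial_function \<psi>" "rat_trig f"
  shows "rat_trig (\<lambda>t. of_real (\<psi> ((norm (f t))\<^sup>2)))"
  using assms(1)
proof (induction \<psi>)
  case (linear \<psi>)
  \<comment> \<open>A linear map of the real line is multiplication by its value at 1, so this case
    reduces to \<open>f * cnj f\<close>.\<close>
  have "\<psi> x = x * \<psi> 1" for x
    using linear_scale[OF bounded_linear.linear[OF linear], of x 1] by simp
  then have "complex_of_real (\<psi> ((norm (f t))\<^sup>2)) = f t * cnj (f t) * of_real (\<psi> 1)" for t
    by (metis of_real_mult complex_norm_square)
  then show ?case by (simp add: rat_trig_mult rat_trig_cnj assms rat_trig_const)
qed (auto intro: rat_trig_const rat_trig.add rat_trig_mult)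

text \<open>Weierstrass approximation is applied in the variable
  \<open>(norm (f t))\<^sup>2\<close>, because \<open>f * cnj f\<close> is a trigonometric
  polynomial while the modulus itself is not. The approximants are real-valued trigonometric
  polynomials.\<close>

lemma rat_trig_approx_norm_sq:
  assumes "rat_trig f" "continuous_on {0..} \<phi>" "e > 0"
  obtains g where "rat_trig (\<lambda>t. of_real (g t))" "\<And>t. \<bar>\<phi> ((norm (f t))\<^sup>2) - g t\<bar> < e"
proof -
  obtain B where B: "\<forall>t. norm (f t) \<le> B" using rat_trig_bounded[OF assms(1)] by blast
  obtain \<psi> where \<psi>: "real_polynomial_function \<psi>" "\<And>x. x \<in> {0..B\<^sup>2} \<Longrightarrow> \<bar>\<phi> x - \<psi> x\<bar> < e"
    using Stone_Weierstrass_real_polynomial_function[of "{0..B\<^sup>2}" \<phi> e] assms continuous_on_subset[OF assms(2)]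
    by auto
  have "(norm (f t))\<^sup>2 \<in> {0..B\<^sup>2}" for t using B by (auto intro: power_mono)
  with \<psi> show ?thesis by (intro that[of "\<lambda>t. \<psi> ((norm (f t))\<^sup>2)"] rat_trig_poly_norm_sq assms) auto
qed

abbreviation real_ap :: "(real \<Rightarrow> real) \<Rightarrow> bool" where
  "real_ap u \<equiv> almost_per (\<lambda>t. complex_of_real (u t))"

lemma real_ap_const: "real_ap (\<lambda>t. c)" by (rule almost_per_const)
lemma real_ap_add: "real_ap u \<Longrightarrow> real_ap v \<Longrightarrow> real_ap (\<lambda>t. u t + v t)"
  using almost_per_add by fastforce
lemma real_ap_mult: "real_ap u \<Longrightarrow> real_ap v \<Longrightarrow> real_ap (\<lambda>t. u t * v t)"
  using almost_per_mult by fastforce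
lemma real_ap_cmult: "real_ap u \<Longrightarrow> real_ap (\<lambda>t. c * u t)"
  by (intro real_ap_mult real_ap_const)

lemma real_ap_polynomial:
  assumes "real_polynomial_function \<psi>" "real_ap u"
  shows "real_ap (\<lambda>t. \<psi> (u t))"
  using assms(1)
proof (induction \<psi>)
  case (linear \<psi>)
  have "\<psi> x = x * \<psi> 1" for x
    using linear_scale[OF bounded_linear.linear[OF linear], of x 1] by simp
  then have "(\<lambda>t. complex_of_real (\<psi> (u t))) = (\<lambda>t. of_real (u t * \<psi> 1))" by metis
  then show ?case using real_ap_mult[OF assms(2) real_ap_const] by metis
qed (auto intro: real_ap_const[simplified] real_ap_add[simplified] real_ap_mult[simplified])

lemma real_ap_compose:
  assumes "real_ap u" "\<And>t. u t \<ge> 0" "continuous_on {0..} \<phi>"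
  shows "real_ap (\<lambda>t. \<phi> (u t))"
proof (rule almost_per_closed)
  fix e :: real assume "e > 0"
  obtain B where B: "\<And>t. norm (complex_of_real (u t)) \<le> B" using almost_per_bounded[OF assms(1)] by blast
  obtain \<psi> where \<psi>: "real_polynomial_function \<psi>" "\<And>x. x \<in> {0..B} \<Longrightarrow> \<bar>\<phi> x - \<psi> x\<bar> < e"
    using Stone_Weierstrass_real_polynomial_function[of "{0..B}" \<phi> e] continuous_on_subset[OF assms(3)] \<open>e > 0\<close>
    by auto
  have "u t \<in> {0..B}" for t using B[of t] assms(2)[of t] by simp
  then have "norm (complex_of_real (\<phi> (u t)) - of_real (\<psi> (u t))) \<le> e" for t
    using \<psi>(2)[of "u t"] by (simp flip: of_real_diff add: less_imp_le)
  then show "\<exists>g. almost_per g \<and> (\<forall>t. norm (complex_of_real (\<phi> (u t)) - g t) \<le> e)"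
    using real_ap_polynomial[OF \<psi>(1) assms(1)] by blast
qed

lemma real_ap_norm_sq: "almost_per f \<Longrightarrow> real_ap (\<lambda>t. (norm (f t))\<^sup>2)"
  using almost_per_mult[OF _ almost_per_cnj, of f f] by (simp only: complex_norm_square)

lemma real_ap_norm_compose:
  assumes "almost_per f" "continuous_on {0..} \<phi>"
  shows "real_ap (\<lambda>t. \<phi> (norm (f t)))"
proof -
  \<comment> \<open>The root is absorbed into the function, since it is the squared modulus that is
    visibly almost periodic.\<close>
  have "continuous_on {0..} (\<lambda>x. \<phi> (sqrt x))"
    by (rule continuous_on_compose2[OF assms(2)]) (auto intro!: continuous_intros)
  from real_ap_compose[OF real_ap_norm_sq[OF assms(1)] _ this] show ?thesis by simp
qed

lemma real_ap_norm_powr: "almost_per f \<Longrightarrow> p > 0 \<Longrightarrow> real_ap (\<lambda>t. norm (f t) powr p)"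
  by (rule real_ap_norm_compose[where \<phi> = "\<lambda>x. x powr p"]) (auto intro!: continuous_on_powr')

lemma real_ap_norm: "almost_per f \<Longrightarrow> real_ap (\<lambda>t. norm (f t))"
  by (rule real_ap_norm_compose) auto

lemma real_ap_continuous: "real_ap u \<Longrightarrow> continuous_on UNIV u"
  using continuous_on_Re[OF almost_per_continuous] by fastforce

section \<open>Existence, linearity and monotonicity of the Bohr mean\<close>

lemma tendsto_mean: "((\<lambda>T. avg T f) \<longlongrightarrow> m) at_top \<Longrightarrow> mean f = m"
  unfolding mean_def by (rule tendsto_Lim) auto

text \<open>Trigonometric polynomials have means by \<open>avg_cis\<close>. Along a uniformly
  convergent sequence these means are Cauchy, because averaging is a contraction, and the two limits
  can be exchanged.\<close>

lemma avg_tendsto_mean: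
  assumes "almost_per f"
  shows "((\<lambda>T. avg T f) \<longlongrightarrow> mean f) at_top"
proof -
  obtain g :: "nat \<Rightarrow> real \<Rightarrow> complex" where g: "\<And>n. rat_trig (g n)" "uniform_limit UNIV g f sequentially"
    using almost_per_seq[OF assms] by blast
  have "\<forall>n. \<exists>m. ((\<lambda>T. avg T (g n)) \<longlongrightarrow> m) at_top" using rat_trig_avg g(1) by blast
  then obtain m where m: "\<And>n. ((\<lambda>T. avg T (g n)) \<longlongrightarrow> m n) at_top" by metis
  have cont: "continuous_on UNIV (g n)" for n using g(1) by (rule rat_trig_continuous)
  have "Cauchy m"
  proof (rule metric_CauchyI)
    fix e :: real assume e: "e > 0"
    then obtain N where N: "\<And>n t. n \<ge> N \<Longrightarrow> dist (g n t) (f t) < e / 4"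
      using uniform_limitD[OF g(2), of "e/4"] by (auto simp: eventually_sequentially)
    have "dist (m j) (m k) < e" if "j \<ge> N" "k \<ge> N" for j k
    proof -
      have "norm (g j t - g k t) \<le> e / 2" for t
        using N[OF that(1), of t] N[OF that(2), of t] dist_triangle_half_l[of "g j t" "f t" "e/2" "g k t"]
        by (simp add: dist_norm less_imp_le)
      then have "norm (avg T (\<lambda>t. g j t - g k t)) \<le> e / 2" if "T > 0" for T
        by (intro avg_norm_le) (use cont that in \<open>auto intro!: continuous_intros\<close>)
      then have "\<forall>\<^sub>F T in at_top. norm (avg T (g j) - avg T (g k)) \<le> e / 2"
        by (intro eventually_mono[OF eventually_gt_at_top[of 0]]) (simp add: avg_diff cont)
      then have "norm (m j - m k) \<le> e / 2"
        by (rule tendsto_upperbound[OF tendsto_norm[OF tendsto_diff[OF m m]]]) simp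
      then show ?thesis using e by (simp add: dist_norm)
    qed
    then show "\<exists>M. \<forall>j\<ge>M. \<forall>k\<ge>M. dist (m j) (m k) < e" by blast
  qed
  then obtain l where l: "m \<longlonglongrightarrow> l" by (auto simp: Cauchy_convergent_iff convergent_def)
  have "((\<lambda>T. avg T f) \<longlongrightarrow> l) at_top"
    by (rule avg_tendsto_uniform_limit[OF always_eventually l g(2)]) (auto simp: m cont)
  then show ?thesis using tendsto_mean by metis
qed

lemma avg_tendsto_mean_real:
  assumes "real_ap u"
  shows "((\<lambda>T. avg T u) \<longlongrightarrow> mean u) at_top"
proof -
  have "((\<lambda>T. Re (avg T (\<lambda>t. complex_of_real (u t)))) \<longlongrightarrow> Re (mean (\<lambda>t. complex_of_real (u t)))) at_top"
    by (intro tendsto_Re avg_tendsto_mean assms)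
  moreover have "avg T (\<lambda>t. complex_of_real (u t)) = of_real (avg T u)" for T
    by (rule avg_bounded_linear[OF bounded_linear_of_real real_ap_continuous[OF assms]])
  ultimately have "((\<lambda>T. avg T u) \<longlongrightarrow> Re (mean (\<lambda>t. complex_of_real (u t)))) at_top"
    by simp
  then show ?thesis using tendsto_mean by metis
qed

lemma mean_of_real: "real_ap u \<Longrightarrow> mean (\<lambda>t. complex_of_real (u t)) = of_real (mean u)"
  by (rule tendsto_mean, rule Lim_transform_eventually[OF tendsto_of_real[OF avg_tendsto_mean_real]])
    (auto simp: avg_bounded_linear[OF bounded_linear_of_real] real_ap_continuous)

lemma mean_add: "almost_per f \<Longrightarrow> almost_per g \<Longrightarrow> mean (\<lambda>t. f t + g t) = mean f + mean g"
  by (rule tendsto_mean) (auto simp: avg_add almost_per_continuous intro!: tendsto_add avg_tendsto_mean)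

lemma mean_diff: "almost_per f \<Longrightarrow> almost_per g \<Longrightarrow> mean (\<lambda>t. f t - g t) = mean f - mean g"
  by (rule tendsto_mean) (auto simp: avg_diff almost_per_continuous intro!: tendsto_diff avg_tendsto_mean)

lemma mean_cmult: "almost_per f \<Longrightarrow> mean (\<lambda>t. c * f t) = c * mean f"
  by (rule tendsto_mean) (auto simp: avg_cmult almost_per_continuous intro!: tendsto_intros avg_tendsto_mean)

lemma mean_const: "mean (\<lambda>t. c) = (c :: 'a :: banach)"
proof (rule tendsto_mean, rule tendsto_eventually)
  show "\<forall>\<^sub>F T in at_top. avg T (\<lambda>t. c) = c"
    using eventually_gt_at_top[of 0] by eventually_elim (simp add: avg_def)
qed

lemma mean_sum:
  assumes "finite A" "\<And>x. x \<in> A \<Longrightarrow> almost_per (f x)"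
  shows "mean (\<lambda>t. \<Sum>x\<in>A. f x t) = (\<Sum>x\<in>A. mean (f x)) \<and> almost_per (\<lambda>t. \<Sum>x\<in>A. f x t)"
  using assms
  by (induction A rule: finite_induct) (auto simp: mean_const mean_add almost_per_add almost_per_const)

lemma mean_add_real: "real_ap f \<Longrightarrow> real_ap g \<Longrightarrow> mean (\<lambda>t. f t + g t) = mean f + mean g"
  by (rule tendsto_mean) (auto simp: avg_add real_ap_continuous intro!: tendsto_add avg_tendsto_mean_real)

lemma mean_cmult_real: "real_ap f \<Longrightarrow> mean (\<lambda>t. c * f t) = c * mean f"
  by (rule tendsto_mean) (auto simp: avg_cmult real_ap_continuous intro!: tendsto_intros avg_tendsto_mean_real)

lemma mean_mono: "real_ap u \<Longrightarrow> real_ap v \<Longrightarrow> (\<And>t. u t \<le> v t) \<Longrightarrow> mean u \<le> mean v"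
proof (rule tendsto_le[OF _ avg_tendsto_mean_real avg_tendsto_mean_real])
  assume "real_ap u" "real_ap v" "\<And>t. u t \<le> v t"
  then show "\<forall>\<^sub>F T in at_top. avg T u \<le> avg T v"
    by (intro eventually_mono[OF eventually_gt_at_top[of 0]]) (auto intro!: avg_mono real_ap_continuous)
qed auto

lemma mean_nonneg: "real_ap u \<Longrightarrow> (\<And>t. u t \<ge> 0) \<Longrightarrow> mean u \<ge> 0"
  using mean_mono[OF real_ap_const[of 0], of u] by (simp add: mean_const)

lemma mean_Re: "almost_per f \<Longrightarrow> mean (\<lambda>t. Re (f t)) = Re (mean f)"
  by (rule tendsto_mean, rule Lim_transform_eventually[OF tendsto_Re[OF avg_tendsto_mean]])
    (auto simp: avg_bounded_linear[OF bounded_linear_Re] almost_per_continuous)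

lemma real_ap_Re: "almost_per f \<Longrightarrow> real_ap (\<lambda>t. Re (f t))"
proof -
  assume "almost_per f"
  then have "almost_per (\<lambda>t. (1/2) * (f t + cnj (f t)))"
    by (intro almost_per_cmult almost_per_add almost_per_cnj)
  then show ?thesis by (simp add: complex_add_cnj)
qed

lemma norm_mean_le: 
  assumes "almost_per f" 
  shows "norm (mean f) \<le> mean (\<lambda>t. norm (f t))"
proof -
  \<comment> \<open>A unimodular \<open>c\<close> rotates the mean onto the nonnegative axis, where
    it is the mean of a real part.\<close>
  obtain c where c: "norm c = 1" "of_real (norm (mean f)) = c * mean f"
  proof (cases "mean f = 0")
    case False
    then show ?thesis
      by (intro that[of "cnj (mean f) / of_real (norm (mean f))"])
        (auto simp: norm_divide complex_norm_square[symmetric] mult.commute power2_eq_square)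
  qed (use that[of 1] in auto)
  have "norm (mean f) = Re (mean (\<lambda>t. c * f t))" using c(2) by (metis Re_complex_of_real assms mean_cmult)
  also have "\<dots> = mean (\<lambda>t. Re (c * f t))" by (rule mean_Re[symmetric]) (intro almost_per_cmult assms)
  also have "\<dots> \<le> mean (\<lambda>t. norm (f t))"
  proof (rule mean_mono)
    show "Re (c * f t) \<le> norm (f t)" for t
      using complex_Re_le_cmod[of "c * f t"] c(1) by (simp add: norm_mult)
  qed (intro real_ap_Re real_ap_norm almost_per_cmult assms)+
  finally show ?thesis .
qed

lemma mean_cis: "mean (\<lambda>t. cis (t * w)) = (if w = 0 then 1 else 0)"
  by (rule tendsto_mean[OF avg_cis])

subsection \<open>Besicovitch norms\<close>

text \<open>The Besicovitch seminorm, that is, the L^p norm over the Bohr compactification.\<close>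

definition bes_norm :: "real \<Rightarrow> (real \<Rightarrow> complex) \<Rightarrow> real" where
  "bes_norm p f = mean (\<lambda>t. norm (f t) powr p) powr (1 / p)"

lemma bes_norm_nonneg [simp]: "bes_norm p f \<ge> 0"
  by (simp add: bes_norm_def)

lemma mean_powr_nonneg: "almost_per f \<Longrightarrow> p > 0 \<Longrightarrow> mean (\<lambda>t. norm (f t) powr p) \<ge> 0"
  by (intro mean_nonneg real_ap_norm_powr) auto

lemma bes_norm_powr: "almost_per f \<Longrightarrow> p > 0 \<Longrightarrow> bes_norm p f powr p = mean (\<lambda>t. norm (f t) powr p)"
  by (simp add: bes_norm_def powr_powr mean_powr_nonneg)

lemma bes_norm_leI:
  assumes "almost_per f" "p > 0" "mean (\<lambda>t. norm (f t) powr p) \<le> c powr p" "c \<ge> 0"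
  shows "bes_norm p f \<le> c"
  using powr_mono2[OF _ mean_powr_nonneg[OF assms(1,2)] assms(3), of "1/p"] assms
  by (simp add: bes_norm_def powr_powr)

lemma bes_norm_leD:
  assumes "almost_per f" "p > 0" "bes_norm p f \<le> c"
  shows "mean (\<lambda>t. norm (f t) powr p) \<le> c powr p"
  using powr_mono2[OF _ _ assms(3), of p] assms by (simp add: bes_norm_powr)

lemma bes_norm_cong: "(\<And>t. norm (f t) = norm (g t)) \<Longrightarrow> bes_norm p f = bes_norm p g"
  by (simp add: bes_norm_def)

lemma bes_norm_cmult:
  assumes "almost_per f" "p > 0"
  shows "bes_norm p (\<lambda>t. c * f t) = norm c * bes_norm p f"
proof -
  have "mean (\<lambda>t. norm (c * f t) powr p) = mean (\<lambda>t. norm c powr p * norm (f t) powr p)"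
    by (simp add: norm_mult powr_mult)
  also have "\<dots> = norm c powr p * mean (\<lambda>t. norm (f t) powr p)"
    by (rule mean_cmult_real) (intro real_ap_norm_powr assms)
  finally show ?thesis using assms by (simp add: bes_norm_def powr_mult powr_powr mean_powr_nonneg)
qed

lemma bes_norm_le_bound:
  assumes "almost_per f" "p > 0" "\<And>t. norm (f t) \<le> B"
  shows "bes_norm p f \<le> B"
proof (rule bes_norm_leI[OF assms(1,2)])
  show B: "B \<ge> 0" using assms(3)[of 0] norm_ge_zero[of "f 0"] by linarith
  have "mean (\<lambda>t. norm (f t) powr p) \<le> mean (\<lambda>t. B powr p)"
    by (intro mean_mono real_ap_norm_powr real_ap_const assms powr_mono2) (use assms in auto)
  then show "mean (\<lambda>t. norm (f t) powr p) \<le> B powr p" by (simp add: mean_const)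
qed

lemma bes_norm_mult_bound:
  assumes "almost_per f" "almost_per g" "p > 0" "\<And>t. norm (f t) \<le> B"
  shows "bes_norm p (\<lambda>t. f t * g t) \<le> B * bes_norm p g"
proof -
  have B: "B \<ge> 0" using assms(4)[of 0] norm_ge_zero[of "f 0"] by linarith
  have "norm (f t * g t) powr p \<le> B powr p * norm (g t) powr p" for t
    unfolding norm_mult powr_mult
    using assms(3,4) by (intro mult_right_mono powr_mono2) auto
  then have "mean (\<lambda>t. norm (f t * g t) powr p) \<le> mean (\<lambda>t. B powr p * norm (g t) powr p)"
    by (intro mean_mono real_ap_norm_powr real_ap_cmult almost_per_mult assms)
  also have "\<dots> = B powr p * mean (\<lambda>t. norm (g t) powr p)"
    by (intro mean_cmult_real real_ap_norm_powr assms)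
  also have "\<dots> = (B * bes_norm p g) powr p"
    using B by (simp add: powr_mult bes_norm_powr assms)
  finally show ?thesis using B by (intro bes_norm_leI almost_per_mult assms) auto
qed

lemma bes_norm_1: "almost_per f \<Longrightarrow> bes_norm 1 f = mean (\<lambda>t. norm (f t))"
proof -
  assume "almost_per f"
  then have "mean (\<lambda>t. norm (f t)) \<ge> 0" by (intro mean_nonneg real_ap_norm) auto
  then show ?thesis by (simp add: bes_norm_def)
qed

text \<open>Both sides are normalised by constants strictly above the norms, so that vanishing norms need
  no separate treatment.\<close>

lemma mean_scaled_le_1:
  assumes "almost_per f" "p > 0" "bes_norm p f < a"
  shows "mean (\<lambda>t. (norm (f t) / a) powr p) \<le> 1"
proof -
  have a: "a > 0" using assms(3) bes_norm_nonneg[of p f] by linarith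
  have "mean (\<lambda>t. (norm (f t) / a) powr p) = mean (\<lambda>t. (1 / a powr p) * norm (f t) powr p)"
    using a by (simp add: powr_divide)
  also have "\<dots> = (1 / a powr p) * mean (\<lambda>t. norm (f t) powr p)"
    by (intro mean_cmult_real real_ap_norm_powr assms)
  also have "\<dots> \<le> 1"
    using bes_norm_leD[OF assms(1,2), of a] assms(3) a by simp
  finally show ?thesis .
qed

lemma real_ap_scaled:
  assumes "almost_per f" "p > 0" "a > 0"
  shows "real_ap (\<lambda>t. (norm (f t) / a) powr p)"
proof -
  have "real_ap (\<lambda>t. (1 / a powr p) * norm (f t) powr p)"
    by (intro real_ap_cmult real_ap_norm_powr assms)
  then show ?thesis using assms by (simp add: powr_divide)
qed

section \<open>Hoelder and Minkowski inequalities for Bohr means\<close>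

lemma le_mult_if_all_greater:
  fixes x a b :: real
  assumes "\<And>c d. a < c \<Longrightarrow> b < d \<Longrightarrow> x \<le> c * d"
  shows "x \<le> a * b"
proof (rule tendsto_lowerbound)
  show "((\<lambda>e. (a + e) * (b + e)) \<longlongrightarrow> a * b) (at_right 0)"
    by (auto intro!: tendsto_eq_intros)
  show "\<forall>\<^sub>F e in at_right 0. x \<le> (a + e) * (b + e)"
    by (auto simp: eventually_at_filter intro!: always_eventually assms)
qed simp

text \<open>Young's inequality with weights \<open>q / r\<close> and \<open>q / p\<close>, applied
  pointwise to the normalised functions and then averaged.\<close>

lemma bes_norm_Holder:
  assumes ap: "almost_per f" "almost_per g" and pos: "p > 0" "q > 0" "r > 0" and eq: "1 / q = 1 / r + 1 / p"
  shows "bes_norm q (\<lambda>t. f t * g t) \<le> bes_norm r f * bes_norm p g"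
proof (rule le_mult_if_all_greater)
  fix a b assume a: "bes_norm r f < a" and b: "bes_norm p g < b"
  then have a0: "a > 0" and b0: "b > 0"
    using bes_norm_nonneg[of r f] bes_norm_nonneg[of p g] by linarith+
  let ?a = "\<lambda>t. (norm (f t) / a) powr r"
  let ?b = "\<lambda>t. (norm (g t) / b) powr p"
  let ?c = "\<lambda>t. norm (f t * g t)"
  have "q * (1 / q) = q * (1 / r + 1 / p)" by (simp only: eq)
  then have e: "q / r + q / p = 1" using pos by (simp add: distrib_left)
  have pt: "(?c t / (a * b)) powr q \<le> q / r * ?a t + q / p * ?b t" for t
  proof (cases "f t = 0 \<or> g t = 0")
    case False
    then show ?thesis
      using Youngs_inequality_0[of "q/r" "q/p" "?a t" "?b t"] e pos a0 b0
      by (simp add: powr_powr norm_mult powr_mult powr_divide)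
  qed (use pos in auto)
  have "mean (\<lambda>t. (?c t / (a * b)) powr q) \<le>
    mean (\<lambda>t. q / r * ?a t + q / p * ?b t)"
    by (intro mean_mono real_ap_scaled real_ap_add real_ap_cmult almost_per_mult ap pt)
      (use pos a0 b0 in auto)
  also have "\<dots> = q / r * mean (\<lambda>t. ?a t) + q / p * mean (\<lambda>t. ?b t)"
    using ap pos a0 b0 by (subst mean_add_real) (simp_all only: mean_cmult_real real_ap_cmult real_ap_scaled)
  also have "\<dots> \<le> q / r * 1 + q / p * 1"
    using ap pos a b by (intro add_mono mult_left_mono mean_scaled_le_1) auto
  also have "\<dots> = 1" using e by simp
  finally have "mean (\<lambda>t. (1 / (a * b) powr q) * ?c t powr q) \<le> 1"
    using a0 b0 by (simp add: powr_divide)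
  also have "mean (\<lambda>t. (1 / (a * b) powr q) * ?c t powr q) = (1 / (a * b) powr q) * mean (\<lambda>t. ?c t powr q)"
    by (intro mean_cmult_real real_ap_norm_powr almost_per_mult ap pos)
  finally show "bes_norm q (\<lambda>t. f t * g t) \<le> a * b"
    using a0 b0 by (intro bes_norm_leI almost_per_mult ap pos) (auto simp: field_simps)
qed

lemma convex_on_powr_nonneg:
  fixes p :: real
  assumes "p \<ge> 1" "x \<ge> 0" "y \<ge> 0" "u \<ge> 0" "v \<ge> 0" "u + v = 1"
  shows "(u * x + v * y) powr p \<le> u * x powr p + v * y powr p"
proof (cases "x = 0 \<or> y = 0 \<or> u = 0 \<or> v = 0")
  case False
  then show ?thesis
    using convex_onD[OF powr_convex[OF assms(1)], of v x y] assms
    by (simp add: eq_diff_eq[symmetric])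
next
  case True
  \<comment> \<open>If a point or a weight vanishes, one summand drops out, and only
    \<open>w powr p \<le> w\<close> for a weight in [0,1] is used.\<close>
  have le: "(w * z) powr p \<le> w * z powr p" if "0 \<le> w" "w \<le> 1" "z \<ge> 0" for w z :: real
  proof (cases "w = 0")
    case False
    then have "w powr p \<le> w powr 1" using that assms by (intro powr_mono') auto
    then show ?thesis using that by (simp add: powr_mult mult_right_mono)
  qed simp
  have "u \<le> 1" "v \<le> 1" using assms by auto
  with True show ?thesis using le[of u x] le[of v y] assms by auto
qed

text \<open>Convexity of the p-th power in place of duality: \<open>norm (f + g) / (a + b)\<close>
  lies below the convex combination of \<open>norm f / a\<close> and \<open>norm g / b\<close> with
  weights \<open>a / (a + b)\<close> and \<open>b / (a + b)\<close>. This includes p = 1.\<close>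

lemma bes_norm_triangle:
  assumes ap: "almost_per f" "almost_per g" and p: "p \<ge> 1"
  shows "bes_norm p (\<lambda>t. f t + g t) \<le> bes_norm p f + bes_norm p g"
proof (rule field_le_epsilon)
  fix e :: real assume e: "e > 0"
  define a where "a = bes_norm p f + e / 2"
  define b where "b = bes_norm p g + e / 2"
  have a: "bes_norm p f < a" "a > 0" and b: "bes_norm p g < b" "b > 0"
    using e bes_norm_nonneg[of p f] bes_norm_nonneg[of p g] unfolding a_def b_def by linarith+
  let ?a = "\<lambda>t. (norm (f t) / a) powr p"
  let ?b = "\<lambda>t. (norm (g t) / b) powr p"
  let ?c = "\<lambda>t. norm (f t + g t)"
  let ?x = "a / (a + b)"
  let ?y = "b / (a + b)"
  have c: "?x + ?y = 1" using a b by (simp flip: add_divide_distrib)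
  have pt: "(?c t / (a + b)) powr p \<le>
     ?x * ?a t + ?y * ?b t" for t
  proof -
    have "(?c t / (a + b)) powr p \<le> ((norm (f t) + norm (g t)) / (a + b)) powr p"
      using a b p by (intro powr_mono2 divide_right_mono norm_triangle_ineq) auto
    also have "(norm (f t) + norm (g t)) / (a + b) = ?x * (norm (f t) / a) + ?y * (norm (g t) / b)"
      using a b by (simp add: add_divide_distrib)
    also have "\<dots> powr p \<le> ?x * ?a t + ?y * ?b t"
      using a b c p by (intro convex_on_powr_nonneg) auto
    finally show ?thesis .
  qed
  have p0: "p > 0" using p by simp
  have ap': "almost_per (\<lambda>t. f t + g t)" by (intro almost_per_add ap)
  have "mean (\<lambda>t. (?c t / (a + b)) powr p) \<le>
    mean (\<lambda>t. ?x * ?a t + ?y * ?b t)"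
    by (intro mean_mono real_ap_scaled real_ap_add real_ap_cmult ap' ap pt) (use p a b in auto)
  also have "\<dots> = ?x * mean (\<lambda>t. ?a t) + ?y * mean (\<lambda>t. ?b t)"
    using ap p0 a b by (subst mean_add_real) (simp_all only: mean_cmult_real real_ap_cmult real_ap_scaled)
  also have "\<dots> \<le> ?x * 1 + ?y * 1"
    using ap p a b by (intro add_mono mult_left_mono mean_scaled_le_1) auto
  also have "\<dots> = 1" using c by simp
  finally have "mean (\<lambda>t. (1 / (a + b) powr p) * ?c t powr p) \<le> 1"
    using a b by (simp add: powr_divide)
  also have "mean (\<lambda>t. (1 / (a + b) powr p) * ?c t powr p) = (1 / (a + b) powr p) * mean (\<lambda>t. ?c t powr p)"
    by (intro mean_cmult_real real_ap_norm_powr ap') (use p in auto)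
  finally have "bes_norm p (\<lambda>t. f t + g t) \<le> a + b"
    using a b p by (intro bes_norm_leI ap') (auto simp: field_simps)
  then show "bes_norm p (\<lambda>t. f t + g t) \<le> bes_norm p f + bes_norm p g + e"
    by (simp add: a_def b_def)
qed

text \<open>The mean of 1 is 1, so Hoelder against the constant 1 with the conjugate exponent
  suffices; that exponent is infinite at \<open>p = 1\<close>, which is separate.\<close>

lemma bes_norm_mono_exponent:
  assumes "almost_per f" "1 \<le> p"
  shows "bes_norm 1 f \<le> bes_norm p f"
proof (cases "p = 1")
  case False
  have "bes_norm 1 (\<lambda>t. 1 * f t) \<le> bes_norm (p / (p - 1)) (\<lambda>t. 1) * bes_norm p f"
    using False assms by (intro bes_norm_Holder almost_per_const) (auto simp: field_simps)
  also have "bes_norm (p / (p - 1)) (\<lambda>t. 1) \<le> 1"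
    using False assms by (intro bes_norm_le_bound almost_per_const) auto
  finally show ?thesis by (simp add: mult_right_mono)
qed simp

lemma norm_mean_le_bes_norm: "almost_per f \<Longrightarrow> 1 \<le> p \<Longrightarrow> norm (mean f) \<le> bes_norm p f"
  using norm_mean_le[of f] bes_norm_mono_exponent[of f p] by (simp add: bes_norm_1)

text \<open>The right side is the tangent line of x^p at \<open>w\<close>. Being affine in
  \<open>x\<close>, it survives weak limits, which is how lower semicontinuity is obtained; here it
  comes from Young's inequality.\<close>

lemma powr_ge_tangent:
  fixes p :: real
  assumes "p \<ge> 1" "w > 0" "x \<ge> 0"
  shows "x powr p \<ge> p * (x * w powr (p - 1)) - (p - 1) * w powr p"
proof (cases "p = 1 \<or> x = 0")
  case True
  then show ?thesis using assms by auto
next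
  case False
  then have "x powr p > 0" "w powr p > 0" using assms by auto
  then have "(x powr p) powr (1/p) * (w powr p) powr ((p - 1)/p) \<le> 1 / p * x powr p + (p - 1) / p * w powr p"
    using assms False by (intro Youngs_inequality_0) (auto simp: diff_divide_distrib)
  then have "x * w powr (p - 1) \<le> 1 / p * x powr p + (p - 1) / p * w powr p"
    using assms False by (simp add: powr_powr)
  from mult_left_mono[OF this, of p] show ?thesis using assms by (simp add: distrib_left)
qed

lemma norm_diff_via:
  fixes a b c d :: "'a::real_normed_vector"
  shows "norm (a - b) \<le> norm (a - c) + norm (c - d) + norm (b - d)"
proof -
  have "a - b = (a - c) + (c - d) - (b - d)" by simp
  then show ?thesis
    using norm_triangle_ineq4[of "(a - c) + (c - d)" "b - d"] norm_triangle_ineq[of "a - c" "c - d"] by simp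
qed

text \<open>\<open>w = sqrt (|f|\<^sup>2 + \<delta>)\<close> is a smooth substitute for \<open>|f|\<close>, so that the argument also covers \<open>p = 1\<close>.\<close>

lemma bes_norm_lower_semicont:
  assumes f: "almost_per f" and h: "\<And>k. almost_per (h k)" and p: "p \<ge> 1"
    and B: "\<And>k. bes_norm 1 (h k) \<le> S"
    and weak: "\<And>g. rat_trig g \<Longrightarrow> (\<lambda>k. mean (\<lambda>t. h k t * g t)) \<longlonglongrightarrow> mean (\<lambda>t. f t * g t)"
    and C: "\<forall>\<^sub>F k in sequentially. bes_norm p (h k) \<le> C"
  shows "bes_norm p f \<le> C"
proof -
  let ?m = "\<lambda>k g. mean (\<lambda>t. h k t * g t)"
  let ?n = "\<lambda>g. mean (\<lambda>t. f t * g t)"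
  have S: "S \<ge> 0" using B[of 0] bes_norm_nonneg[of 1 "h 0"] by linarith
  have C0: "C \<ge> 0"
    using C bes_norm_nonneg order_trans by (metis (mono_tags, lifting) eventually_happens' sequentially_bot)
  obtain B0 where B0: "B0 > 0" "\<And>t. norm (f t) \<le> B0" using almost_per_bounded[OF f] by blast
  \<comment> \<open>The dual function used below is almost periodic but not a trigonometric
    polynomial, so the class of test functions is enlarged first. The uniform bound \<open>S\<close>
    on the 1-norms pays for replacing \<open>g\<close> by an approximant.\<close>
  have weak': "(\<lambda>k. ?m k g) \<longlonglongrightarrow> ?n g" if g: "almost_per g" for g
  proof (rule LIMSEQ_I)
    fix e :: real assume e: "e > 0"
    define d where "d = e / (2 * (S + B0 + 1))"
    have d: "d > 0" using e S B0 by (simp add: d_def)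
    obtain g' where g': "rat_trig g'" "\<And>t. norm (g t - g' t) \<le> d"
      using g d unfolding almost_per_def by blast
    have apg': "almost_per g'" by (rule almost_per_rat_trig[OF g'(1)])
    have dif: "norm (mean (\<lambda>t. u t * g t) - mean (\<lambda>t. u t * g' t)) \<le> d * bes_norm 1 u" if u: "almost_per u" for u
    proof -
      have "mean (\<lambda>t. u t * g t) - mean (\<lambda>t. u t * g' t) = mean (\<lambda>t. u t * g t - u t * g' t)"
        by (intro mean_diff[symmetric] almost_per_mult u g apg')
      also have "\<dots> = mean (\<lambda>t. (g t - g' t) * u t)" by (simp add: algebra_simps)
      also have "norm \<dots> \<le> bes_norm 1 (\<lambda>t. (g t - g' t) * u t)"
        by (intro norm_mean_le_bes_norm almost_per_mult almost_per_diff u g apg') auto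
      also have "\<dots> \<le> d * bes_norm 1 u"
        by (intro bes_norm_mult_bound almost_per_diff u g apg' g'(2)) auto
      finally show ?thesis .
    qed
    obtain K where K: "\<And>k. k \<ge> K \<Longrightarrow> norm (mean (\<lambda>t. h k t * g' t) - mean (\<lambda>t. f t * g' t)) < e / 2"
      using LIMSEQ_D[OF weak[OF g'(1)], of "e/2"] e by auto
    have "norm (?m k g - ?n g) < e" if "k \<ge> K" for k
    proof -
      have "norm (?m k g - mean (\<lambda>t. h k t * g' t)) \<le> d * S"
        using dif[OF h[of k]] mult_left_mono[OF B[of k], of d] d by linarith
      moreover have "norm (?n g - mean (\<lambda>t. f t * g' t)) \<le> d * B0"
        using dif[OF f] mult_left_mono[OF bes_norm_le_bound[OF f _ B0(2), of 1], of d] d by linarith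
      moreover have "d * S + d * B0 < e / 2"
      proof -
        have "d * S + d * B0 < d * (S + B0 + 1)" using d by (simp add: algebra_simps)
        also have "\<dots> = e / 2"
        proof -
          have "S + B0 + 1 \<noteq> 0" using S B0 by linarith
          then show ?thesis unfolding d_def by (simp add: divide_simps)
        qed
        finally show ?thesis .
      qed
      ultimately show ?thesis using K[OF that]
        norm_diff_via[of "?m k g" "?n g"
          "mean (\<lambda>t. h k t * g' t)" "mean (\<lambda>t. f t * g' t)"] by linarith
    qed
    then show "\<exists>no. \<forall>k\<ge>no. norm (?m k g - ?n g) < e" by blast
  qed
  define R where "R = (B0 + 1) powr (p - 1)"
  have main: "mean (\<lambda>t. norm (f t) powr p) \<le> C powr p + p * sqrt \<delta> * R" if \<delta>: "0 < \<delta>" "\<delta> < 1" for \<delta>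
  proof -
    define w where "w t = sqrt ((norm (f t))\<^sup>2 + \<delta>)" for t
    have w0: "w t > 0" for t using \<delta> by (simp add: w_def add_nonneg_pos)
    have wf: "norm (f t) \<le> w t" for t unfolding w_def by (rule real_le_rsqrt) (use \<delta> in simp)
    have wd: "sqrt \<delta> \<le> w t" for t by (simp add: w_def)
    have wB: "w t \<le> B0 + 1" for t
    proof -
      have "w t \<le> norm (f t) + sqrt \<delta>"
        using sqrt_sum_squares_le_sum[of "norm (f t)" "sqrt \<delta>"] \<delta> by (simp add: w_def)
      then show ?thesis using B0(2)[of t] \<delta> real_sqrt_lt_1_iff[of \<delta>] by linarith
    qed
    have apw: "real_ap (\<lambda>t. w t powr s)" for s
      unfolding w_def using \<delta>
      by (intro real_ap_norm_compose[OF f, where \<phi> = "\<lambda>x. sqrt (x\<^sup>2 + \<delta>) powr s"])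
        (auto intro!: continuous_intros simp: add_nonneg_eq_0_iff)
    have wp: "w t * w t powr (p - 2) = w t powr (p - 1)" for t
      using w0[of t] powr_mult_base[of "w t" "p - 2"] by (simp add: algebra_simps)
    \<comment> \<open>The regularised dual function of \<open>f\<close>: its modulus is at most
      \<open>w powr (p - 1)\<close>, and its product with \<open>f\<close> is close to
      \<open>w powr p\<close>. The exponent may be negative, but \<open>w\<close> stays above
      \<open>sqrt \<delta>\<close>.\<close>
    define g where "g t = cnj (f t) * of_real (w t powr (p - 2))" for t
    have g: "almost_per g" unfolding g_def by (intro almost_per_mult almost_per_cnj f apw)
    have gn: "norm (g t) \<le> w t powr (p - 1)" for t
    proof -
      have "norm (g t) \<le> w t * w t powr (p - 2)"
        unfolding g_def norm_mult by (intro mult_mono) (use wf w0[of t] in auto)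
      also have "\<dots> = w t powr (p - 1)" by (rule wp)
      finally show ?thesis .
    qed
    have fg: "Re (f t * g t) \<ge> w t powr p - sqrt \<delta> * R" for t
    proof -
      have "f t * g t = of_real ((norm (f t))\<^sup>2 * w t powr (p - 2))"
        unfolding g_def by (metis complex_norm_square mult.assoc of_real_mult)
      then have "Re (f t * g t) = (norm (f t))\<^sup>2 * w t powr (p - 2)" by (metis Re_complex_of_real)
      also have "(norm (f t))\<^sup>2 = (w t)\<^sup>2 - \<delta>" using \<delta> by (simp add: w_def)
      also have "((w t)\<^sup>2 - \<delta>) * w t powr (p - 2) = w t powr p - sqrt \<delta> * (sqrt \<delta> * w t powr (p - 2))"
      proof -
        have "(w t)\<^sup>2 * w t powr (p - 2) = w t powr p"
          using w0[of t] powr_mult_base[of "w t" "p - 1"] wp[of t] by (simp add: power2_eq_square mult.assoc)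
        moreover have "sqrt \<delta> * (sqrt \<delta> * w t powr (p - 2)) = \<delta> * w t powr (p - 2)"
          using \<delta> by (simp flip: mult.assoc)
        ultimately show ?thesis by (simp only: left_diff_distrib)
      qed
      finally have "Re (f t * g t) = w t powr p - sqrt \<delta> * (sqrt \<delta> * w t powr (p - 2))" .
      \<comment> \<open>For p < 2 the power alone blows up as \<open>\<delta>\<close> tends to 0.
        One factor \<open>sqrt \<delta> \<le> w\<close> compensates this, and the other remains as
        the small error.\<close>
      moreover have "sqrt \<delta> * w t powr (p - 2) \<le> R"
      proof -
        have "sqrt \<delta> * w t powr (p - 2) \<le> w t * w t powr (p - 2)"
          by (intro mult_right_mono wd) auto
        also have "\<dots> = w t powr (p - 1)" by (rule wp)
        also have "\<dots> \<le> R" unfolding R_def using wB[of t] w0[of t] p by (intro powr_mono2) auto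
        finally show ?thesis .
      qed
      then have "sqrt \<delta> * (sqrt \<delta> * w t powr (p - 2)) \<le> sqrt \<delta> * R"
        using \<delta> by (intro mult_left_mono) auto
      ultimately show ?thesis by linarith
    qed
    \<comment> \<open>The tangent inequality at \<open>w\<close>, with the modulus of
      \<open>h k\<close> replaced by a real part, is linear in \<open>h k\<close>; hence the limit
      in \<open>k\<close> may be taken.\<close>
    have k: "mean (\<lambda>t. norm (h k t) powr p) \<ge> p * Re (?m k g) - (p - 1) * mean (\<lambda>t. w t powr p)" for k
    proof -
      have ap1: "real_ap (\<lambda>t. p * Re (h k t * g t))" by (intro real_ap_cmult real_ap_Re almost_per_mult h g)
      have ap2: "real_ap (\<lambda>t. - (p - 1) * w t powr p)" by (intro real_ap_cmult apw)
      have "mean (\<lambda>t. p * Re (h k t * g t) + - (p - 1) * w t powr p) \<le> mean (\<lambda>t. norm (h k t) powr p)"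
      proof (intro mean_mono real_ap_norm_powr real_ap_add ap1 ap2 h)
        fix t
        have "Re (h k t * g t) \<le> norm (h k t) * w t powr (p - 1)"
          using complex_Re_le_cmod[of "h k t * g t"] mult_left_mono[OF gn[of t], of "norm (h k t)"]
          by (simp add: norm_mult)
        then have "p * Re (h k t * g t) \<le> p * (norm (h k t) * w t powr (p - 1))"
          using p by (intro mult_left_mono) auto
        then show "p * Re (h k t * g t) + - (p - 1) * w t powr p \<le> norm (h k t) powr p"
          using powr_ge_tangent[OF p w0[of t], of "norm (h k t)"] by (simp add: algebra_simps)
      qed (use p in auto)
      also have "mean (\<lambda>t. p * Re (h k t * g t) + - (p - 1) * w t powr p) =
          p * mean (\<lambda>t. Re (h k t * g t)) + - (p - 1) * mean (\<lambda>t. w t powr p)"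
        unfolding mean_add_real[OF ap1 ap2]
        by (intro arg_cong2[of _ _ _ _ "(+)"] mean_cmult_real real_ap_Re almost_per_mult h g apw)
      also have "mean (\<lambda>t. Re (h k t * g t)) = Re (?m k g)"
        by (intro mean_Re almost_per_mult h g)
      finally show ?thesis by (simp add: algebra_simps)
    qed
    have "\<forall>\<^sub>F k in sequentially. p * Re (?m k g) - (p - 1) * mean (\<lambda>t. w t powr p) \<le> C powr p"
      using C
    proof eventually_elim
      case (elim j)
      then show ?case using k[of j] bes_norm_leD[OF h[of j] _ elim] p by linarith
    qed
    then have "p * Re (?n g) - (p - 1) * mean (\<lambda>t. w t powr p) \<le> C powr p"
      by (intro tendsto_upperbound[OF tendsto_diff[OF tendsto_mult[OF tendsto_const tendsto_Re[OF weak'[OF g]]] tendsto_const]]) auto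
    moreover have "mean (\<lambda>t. w t powr p) - sqrt \<delta> * R \<le> Re (?n g)"
    proof -
      have "mean (\<lambda>t. w t powr p + - (sqrt \<delta> * R)) \<le> mean (\<lambda>t. Re (f t * g t))"
        by (intro mean_mono real_ap_add real_ap_const real_ap_Re almost_per_mult f g apw) (use fg in auto)
      also have "mean (\<lambda>t. w t powr p + - (sqrt \<delta> * R)) = mean (\<lambda>t. w t powr p) - sqrt \<delta> * R"
        by (subst mean_add_real[OF apw real_ap_const]) (simp add: mean_const)
      finally show ?thesis by (simp only: mean_Re[OF almost_per_mult[OF f g]])
    qed
    then have "p * (mean (\<lambda>t. w t powr p) - sqrt \<delta> * R) \<le> p * Re (?n g)"
      using p by (intro mult_left_mono) auto
    moreover have "mean (\<lambda>t. norm (f t) powr p) \<le> mean (\<lambda>t. w t powr p)"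
      using p by (intro mean_mono real_ap_norm_powr f apw powr_mono2 wf) auto
    ultimately show ?thesis by (simp add: algebra_simps)
  qed
  have "mean (\<lambda>t. norm (f t) powr p) \<le> C powr p"
  proof (rule tendsto_lowerbound)
    show "((\<lambda>\<delta>. C powr p + p * sqrt \<delta> * R) \<longlongrightarrow> C powr p) (at_right 0)"
      by (auto intro!: tendsto_eq_intros)
    show "\<forall>\<^sub>F \<delta> in at_right 0. mean (\<lambda>t. norm (f t) powr p) \<le> C powr p + p * sqrt \<delta> * R"
      unfolding eventually_at_right_field using main by (intro exI[of _ 1]) auto
  qed simp
  then show ?thesis using p C0 by (intro bes_norm_leI f) auto
qed

text \<open>The exact norming function \<open>cnj f / norm f\<close> is discontinuous at zeros of
  \<open>f\<close>. It is smoothed with \<open>\<delta>\<close> and then replaced by a trigonometric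
  polynomial, at the price of a sup norm slightly above 1.\<close>

lemma bes_norm_1_dual:
  assumes f: "rat_trig f" and e: "e > 0"
  obtains g where "rat_trig g" "\<And>t. norm (g t) \<le> 1 + e" "bes_norm 1 f \<le> norm (mean (\<lambda>t. f t * g t)) + e"
proof -
  obtain B where B: "B > 0" "\<And>t. norm (f t) \<le> B" using rat_trig_bounded[OF f] by blast
  have apf: "almost_per f" by (rule almost_per_rat_trig[OF f])
  define \<delta> where "\<delta> = (e / 2)\<^sup>2"
  have \<delta>: "\<delta> > 0" "sqrt \<delta> = e / 2" using e by (simp_all add: \<delta>_def)
  define w where "w t = sqrt ((norm (f t))\<^sup>2 + \<delta>)" for t
  have w0: "w t > 0" for t using \<delta> by (simp add: w_def add_nonneg_pos)
  have wf: "norm (f t) \<le> w t" for t unfolding w_def by (rule real_le_rsqrt) (use \<delta> in simp)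
  let ?u = "\<lambda>t. cnj (f t) * of_real (1 / w t)"
  \<comment> \<open>The two entries of the minimum serve \<open>c * B \<le> e\<close>, for the sup
    norm of \<open>g\<close>, and \<open>c * B * B \<le> e / 2\<close>, for its pairing with
    \<open>f\<close>. The smoothing uses the other \<open>e / 2 = sqrt \<delta>\<close>.\<close>
  define c where "c = min e (e / (2 * B)) / B"
  have c: "c > 0" "c * B \<le> e" "c * B * B \<le> e / 2"
  proof -
    show "c > 0" using e B by (simp add: c_def)
    show "c * B \<le> e" using B by (simp add: c_def)
    have "c * B * B \<le> e / (2 * B) * B" using B by (intro mult_right_mono) (auto simp: c_def)
    then show "c * B * B \<le> e / 2" using B by simp
  qed
  have "continuous_on {0..} (\<lambda>x. 1 / sqrt (x + \<delta>))" using \<delta> by (auto intro!: continuous_intros)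
  then obtain v where v: "rat_trig (\<lambda>t. of_real (v t))" "\<And>t. \<bar>1 / sqrt ((norm (f t))\<^sup>2 + \<delta>) - v t\<bar> < c"
    using rat_trig_approx_norm_sq[OF f _ c(1)] by metis
  define g where "g t = cnj (f t) * of_real (v t)" for t
  have g: "rat_trig g" unfolding g_def by (intro rat_trig_mult rat_trig_cnj f v)
  have near: "norm (g t - ?u t) \<le> c * B" for t
  proof -
    have "g t - ?u t = cnj (f t) * of_real (v t - 1 / w t)"
      by (simp add: g_def algebra_simps)
    then have "norm (g t - ?u t) = norm (f t) * \<bar>v t - 1 / w t\<bar>"
      by (simp only: norm_mult complex_mod_cnj norm_of_real)
    also have "\<dots> \<le> B * c" using B c v(2)[of t] by (intro mult_mono) (auto simp: w_def abs_minus_commute)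
    finally show ?thesis by (simp add: mult.commute)
  qed
  show thesis
  proof
    show "rat_trig g" by (rule g)
    show "norm (g t) \<le> 1 + e" for t
    proof -
      have "norm (?u t) \<le> 1" using wf[of t] w0[of t] by (simp add: norm_mult norm_divide)
      then show ?thesis using near[of t] c(2) norm_triangle_ineq2[of "g t" "?u t"] by linarith
    qed
    have pt: "norm (f t) \<le> Re (f t * g t) + e" for t
    proof -
      have "f t * (?u t) = of_real ((norm (f t))\<^sup>2 * (1 / w t))"
        by (metis complex_norm_square mult.assoc of_real_mult)
      then have "Re (f t * (?u t)) = (norm (f t))\<^sup>2 * (1 / w t)" by (metis Re_complex_of_real)
      also have "(norm (f t))\<^sup>2 = (w t)\<^sup>2 - \<delta>" using \<delta> by (simp add: w_def)
      also have "((w t)\<^sup>2 - \<delta>) * (1 / w t) = w t - sqrt \<delta> * (sqrt \<delta> / w t)"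
        using w0[of t] \<delta>(1) by (simp add: field_simps power2_eq_square)
      finally have "Re (f t * (?u t)) = w t - sqrt \<delta> * (sqrt \<delta> / w t)" .
      moreover have "sqrt \<delta> * (sqrt \<delta> / w t) \<le> sqrt \<delta> * 1"
        by (intro mult_left_mono) (use w0[of t] \<delta> in \<open>auto simp: w_def\<close>)
      ultimately have 1: "norm (f t) - e / 2 \<le> Re (f t * (?u t))"
        using wf[of t] \<delta> by linarith
      have "norm (f t * (?u t) - f t * g t) \<le> B * (c * B)"
        unfolding right_diff_distrib[symmetric] norm_mult[of "f t"] using near[of t] B c
        by (intro mult_mono) (auto simp: norm_minus_commute)
      then have "Re (f t * (?u t) - f t * g t) \<le> e / 2"
        using c(3) complex_Re_le_cmod[of "f t * (?u t) - f t * g t"]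
        by (simp only: mult.commute[of B] mult.left_commute[of B])
      with 1 show ?thesis unfolding minus_complex.sel by linarith
    qed
    have apfg: "almost_per (\<lambda>t. f t * g t)" by (intro almost_per_rat_trig rat_trig_mult f g)
    have "bes_norm 1 f \<le> mean (\<lambda>t. Re (f t * g t) + e)"
      unfolding bes_norm_1[OF apf]
      by (intro mean_mono real_ap_norm real_ap_add real_ap_const real_ap_Re apf apfg pt)
    also have "\<dots> = Re (mean (\<lambda>t. f t * g t)) + e"
      by (subst mean_add_real[OF real_ap_Re[OF apfg] real_ap_const]) (simp only: mean_Re[OF apfg] mean_const)
    also have "\<dots> \<le> norm (mean (\<lambda>t. f t * g t)) + e" using complex_Re_le_cmod by simp
    finally show "bes_norm 1 f \<le> norm (mean (\<lambda>t. f t * g t)) + e" .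
  qed
qed

subsection \<open>Dirichlet polynomials\<close>

text \<open>The values at \<open>s = - \<i> t\<close>, with the sign convention of
  \<open>poly_norm\<close>, so that the frequencies are \<open>+ ln n\<close>.\<close>

definition boundary :: "(nat \<Rightarrow> complex) \<Rightarrow> real \<Rightarrow> complex" where
  "boundary a t = (\<Sum>n | a n \<noteq> 0. a n * of_nat n powr (\<i> * of_real t))"

lemma dirichlet_polyD: "dirichlet_poly a \<Longrightarrow> a 0 = 0" "dirichlet_poly a \<Longrightarrow> finite {n. a n \<noteq> 0}"
  by (simp_all add: dirichlet_poly_def)

lemma dirichlet_polyI: "a 0 = 0 \<Longrightarrow> finite F \<Longrightarrow> (\<And>n. a n \<noteq> 0 \<Longrightarrow> n \<in> F) \<Longrightarrow> dirichlet_poly a"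
  unfolding dirichlet_poly_def by (auto intro: finite_subset)

lemma of_nat_powr_ii: "n > 0 \<Longrightarrow> of_nat n powr (\<i> * of_real t) = cis (t * ln (real n))"
  by (simp add: powr_def cis_conv_exp Ln_of_nat mult_ac)

lemma boundary_eq_sum:
  assumes "finite F" "\<And>n. a n \<noteq> 0 \<Longrightarrow> n \<in> F" "0 \<notin> F"
  shows "boundary a t = (\<Sum>n\<in>F. a n * cis (t * ln (real n)))"
proof -
  have "boundary a t = (\<Sum>n\<in>F. a n * of_nat n powr (\<i> * of_real t))"
    unfolding boundary_def by (rule sum.mono_neutral_left) (use assms in auto)
  also have "\<dots> = (\<Sum>n\<in>F. a n * cis (t * ln (real n)))"
  proof (rule sum.cong[OF refl])
    fix n assume "n \<in> F"
    with assms(3) have "n > 0" by (metis gr0I)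
    then show "a n * of_nat n powr (\<i> * of_real t) = a n * cis (t * ln (real n))" by (simp only: of_nat_powr_ii)
  qed
  finally show ?thesis .
qed

lemma boundary_eq_supp:
  "dirichlet_poly a \<Longrightarrow> boundary a t = (\<Sum>n | a n \<noteq> 0. a n * cis (t * ln (real n)))"
  by (rule boundary_eq_sum) (auto simp: dirichlet_poly_def)

lemma dirichlet_poly_bound:
  assumes "dirichlet_poly a" "dirichlet_poly b"
  obtains F where "finite F" "0 \<notin> F" "\<And>n. a n \<noteq> 0 \<Longrightarrow> n \<in> F" "\<And>n. b n \<noteq> 0 \<Longrightarrow> n \<in> F"
  by (rule that[of "{n. a n \<noteq> 0} \<union> {n. b n \<noteq> 0}"]) (use assms in \<open>auto simp: dirichlet_poly_def\<close>)

lemma rat_trig_boundary: "dirichlet_poly a \<Longrightarrow> rat_trig (boundary a)"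
proof -
  assume a: "dirichlet_poly a"
  have "rat_trig (\<lambda>t. \<Sum>n | a n \<noteq> 0. a n * cis (t * ln (real n)))"
  proof (intro rat_trig_sum rat_trig_mult rat_trig_const rat_trig_cis)
    show "n > 0" if "n \<in> {n. a n \<noteq> 0}" for n
      using that dirichlet_polyD(1)[OF a] by (cases n) auto
  qed (use a in \<open>auto simp: dirichlet_poly_def\<close>)
  then show ?thesis using boundary_eq_supp[OF a] by presburger
qed

lemma almost_per_boundary: "dirichlet_poly a \<Longrightarrow> almost_per (boundary a)"
  by (intro almost_per_rat_trig rat_trig_boundary)

lemma poly_norm_eq: "poly_norm p a = bes_norm p (boundary a)"
  by (simp add: poly_norm_def bes_norm_def mean_def avg_def boundary_def)

lemma dirichlet_poly_add: "dirichlet_poly a \<Longrightarrow> dirichlet_poly b \<Longrightarrow> dirichlet_poly (\<lambda>n. a n + b n)"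
  by (rule dirichlet_polyI[of _ "{n. a n \<noteq> 0} \<union> {n. b n \<noteq> 0}"]) (auto simp: dirichlet_poly_def)

lemma dirichlet_poly_cmult: "dirichlet_poly a \<Longrightarrow> dirichlet_poly (\<lambda>n. c * a n)"
  by (rule dirichlet_polyI[of _ "{n. a n \<noteq> 0}"]) (auto simp: dirichlet_poly_def)

lemma dirichlet_poly_diff: "dirichlet_poly a \<Longrightarrow> dirichlet_poly b \<Longrightarrow> dirichlet_poly (\<lambda>n. a n - b n)"
  by (rule dirichlet_polyI[of _ "{n. a n \<noteq> 0} \<union> {n. b n \<noteq> 0}"]) (auto simp: dirichlet_poly_def)

lemma boundary_add:
  assumes "dirichlet_poly a" "dirichlet_poly b"
  shows "boundary (\<lambda>n. a n + b n) = (\<lambda>t. boundary a t + boundary b t)"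
proof
  fix t
  obtain F where F: "finite F" "0 \<notin> F" "\<And>n. a n \<noteq> 0 \<Longrightarrow> n \<in> F" "\<And>n. b n \<noteq> 0 \<Longrightarrow> n \<in> F"
    using dirichlet_poly_bound[OF assms] by metis
  have "\<And>n. a n + b n \<noteq> 0 \<Longrightarrow> n \<in> F" using F(3,4) by (metis add_0)
  with F show "boundary (\<lambda>n. a n + b n) t = boundary a t + boundary b t"
    by (simp add: boundary_eq_sum[of F] distrib_right sum.distrib)
qed

lemma boundary_cmult:
  assumes "dirichlet_poly a"
  shows "boundary (\<lambda>n. c * a n) = (\<lambda>t. c * boundary a t)"
proof
  fix t
  have "boundary (\<lambda>n. c * a n) t = (\<Sum>n | a n \<noteq> 0. c * a n * cis (t * ln (real n)))"
    by (rule boundary_eq_sum) (use assms in \<open>auto simp: dirichlet_poly_def\<close>)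
  then show "boundary (\<lambda>n. c * a n) t = c * boundary a t"
    by (simp add: boundary_eq_supp[OF assms] sum_distrib_left mult.assoc)
qed

lemma boundary_diff:
  assumes "dirichlet_poly a" "dirichlet_poly b"
  shows "boundary (\<lambda>n. a n - b n) = (\<lambda>t. boundary a t - boundary b t)"
  using boundary_add[OF assms(1) dirichlet_poly_cmult[OF assms(2)], of "-1"] boundary_cmult[OF assms(2), of "-1"]
  by (simp only: mult_minus1 add_uminus_conv_diff)

lemma sums_boundary:
  assumes "dirichlet_poly a"
  shows "(\<lambda>n. a n * of_nat n powr (- (- (\<i> * of_real t)))) sums boundary a t"
  unfolding boundary_def minus_minus
  by (rule sums_finite) (use assms in \<open>auto simp: dirichlet_poly_def\<close>)

lemma dirichlet_poly_mult:
  assumes "dirichlet_poly a" "dirichlet_poly b"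
  shows "dirichlet_poly (dirichlet_mult a b)"
proof (rule dirichlet_polyI)
  let ?F = "(\<lambda>(m, n). m * n) ` ({n. a n \<noteq> 0} \<times> {n. b n \<noteq> 0})"
  show "finite ?F" using assms by (auto simp: dirichlet_poly_def)
  show "n \<in> ?F" if "dirichlet_mult a b n \<noteq> 0" for n
  proof -
    from that have "(\<Sum>d | d dvd n. a d * b (n div d)) \<noteq> 0"
      unfolding dirichlet_mult_def by (cases "n = 0") simp_all
    then obtain d where d: "d dvd n" "a d * b (n div d) \<noteq> 0"
      by (rule sum.not_neutral_contains_not_neutral) auto
    then show ?thesis by (intro image_eqI[of _ _ "(d, n div d)"]) auto
  qed
qed (simp add: dirichlet_mult_def)

lemma boundary_mult:
  assumes a: "dirichlet_poly a" and b: "dirichlet_poly b"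
  shows "boundary (dirichlet_mult a b) = (\<lambda>t. boundary a t * boundary b t)"
proof
  fix t
  have ev: "dirichlet_eval c (- (\<i> * of_real t)) = boundary c t" if "dirichlet_poly c" for c
    unfolding dirichlet_eval_def using sums_boundary[OF that] by (rule sums_unique[symmetric])
  have ab: "summable (\<lambda>n. norm (c n * of_nat n powr (- (- (\<i> * of_real t)))))" if "dirichlet_poly c" for c
    by (rule summable_finite[of "{n. c n \<noteq> 0}"]) (use that in \<open>auto simp: dirichlet_poly_def\<close>)
  show "boundary (dirichlet_mult a b) t = boundary a t * boundary b t"
    using dirichlet_eval_mult[OF dirichlet_polyD(1)[OF a] dirichlet_polyD(1)[OF b] ab[OF a] ab[OF b]]
    by (simp only: ev a b dirichlet_poly_mult)
qed

definition dirichlet_unit :: "nat \<Rightarrow> nat \<Rightarrow> complex" where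
  "dirichlet_unit m = (\<lambda>n. if n = m then 1 else 0)"

lemma dirichlet_poly_unit: "m > 0 \<Longrightarrow> dirichlet_poly (dirichlet_unit m)"
  by (rule dirichlet_polyI[of _ "{m}"]) (auto simp: dirichlet_unit_def split: if_splits)

lemma boundary_unit: "m > 0 \<Longrightarrow> boundary (dirichlet_unit m) t = cis (t * ln (real m))"
  by (subst boundary_eq_sum[of "{m}"]) (auto simp: dirichlet_unit_def split: if_splits)

lemma boundary_0: "boundary (\<lambda>n. 0) t = 0"
  by (simp add: boundary_def)

lemma dirichlet_poly_0: "dirichlet_poly (\<lambda>n. 0)"
  by (simp add: dirichlet_poly_def)

lemma dirichlet_poly_sum:
  "finite A \<Longrightarrow> (\<And>k. k \<in> A \<Longrightarrow> dirichlet_poly (f k)) \<Longrightarrow>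
    dirichlet_poly (\<lambda>n. \<Sum>k\<in>A. f k n) \<and> boundary (\<lambda>n. \<Sum>k\<in>A. f k n) = (\<lambda>t. \<Sum>k\<in>A. boundary (f k) t)"
  by (induction A rule: finite_induct)
    (auto simp: dirichlet_poly_0 dirichlet_poly_add boundary_add boundary_0)

section \<open>Fourier coefficients of Dirichlet polynomials\<close>

lemma mean_boundary_monomial:
  assumes a: "dirichlet_poly a" and mn: "m > 0" "n > 0"
  shows "mean (\<lambda>t. boundary a t * (c * cis (t * (ln (real m) - ln (real n))))) =
    c * (if m dvd n then a (n div m) else 0)"
proof -
  let ?w = "\<lambda>j. (ln (real j) + ln (real m) - ln (real n))"
  let ?v = "(ln (real m) - ln (real n))"
  have fin: "finite {j. a j \<noteq> 0}" using a by (simp add: dirichlet_poly_def)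
  have pos: "j > 0" if "a j \<noteq> 0" for j using that dirichlet_polyD(1)[OF a] by (cases j) auto
  have eq: "a j * cis (t * ln (real j)) * (c * cis (t * ?v)) =
      (c * a j) * cis (t * ?w j)" for j t
  proof -
    have "cis (t * ln (real j)) * cis (t * ?v) = cis (t * ?w j)"
      by (simp add: cis_mult algebra_simps)
    then show ?thesis by (metis mult.assoc mult.left_commute)
  qed
  have ap: "almost_per (\<lambda>t. cis (t * ?w j))" if "a j \<noteq> 0" for j
    using almost_per_rat_trig[OF rat_trig.monomial[of "j * m" n 1]] pos[OF that] mn by (simp add: ln_mult)
  \<comment> \<open>By injectivity of the logarithm at most one index \<open>j\<close> resonates
    with the frequency, and only if \<open>m\<close> divides \<open>n\<close>.\<close>
  have zero: "ln (real j) + ln (real m) - ln (real n) = 0 \<longleftrightarrow> j * m = n" if "j > 0" for j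
  proof -
    have "ln (real j) + ln (real m) - ln (real n) = 0 \<longleftrightarrow> ln (real (j * m)) = ln (real n)"
      using that mn by (simp add: ln_mult)
    also have "\<dots> \<longleftrightarrow> real (j * m) = real n" using that mn by (subst ln_inj_iff) auto
    finally show ?thesis by (simp only: of_nat_eq_iff)
  qed
  have "mean (\<lambda>t. boundary a t * (c * cis (t * ?v))) =
    mean (\<lambda>t. \<Sum>j | a j \<noteq> 0. (c * a j) * cis (t * ?w j))"
    by (simp only: boundary_eq_supp[OF a] sum_distrib_right eq)
  also have "\<dots> = (\<Sum>j | a j \<noteq> 0. mean (\<lambda>t. (c * a j) * cis (t * ?w j)))"
    by (intro mean_sum[OF fin, THEN conjunct1] almost_per_cmult) (use ap in auto)
  also have "\<dots> = (\<Sum>j | a j \<noteq> 0. c * a j * (if j * m = n then 1 else 0))"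
  proof (intro sum.cong refl)
    fix j assume "j \<in> {j. a j \<noteq> 0}"
    then have j: "a j \<noteq> 0" by simp
    show "mean (\<lambda>t. (c * a j) * cis (t * ?w j)) = c * a j * (if j * m = n then 1 else 0)"
      by (simp only: mean_cmult[OF ap[OF j]] mean_cis zero[OF pos[OF j]])
  qed
  also have "\<dots> = (\<Sum>j | a j \<noteq> 0. if j = n div m \<and> m dvd n then c * a j else 0)"
    using mn by (intro sum.cong refl) auto
  also have "\<dots> = c * (if m dvd n then a (n div m) else 0)"
    using fin by (cases "m dvd n") (auto simp: sum.delta)
  finally show ?thesis .
qed

lemma mean_boundary_coeff:
  assumes "dirichlet_poly a" "n > 0"
  shows "mean (\<lambda>t. boundary a t * cis (- t * ln (real n))) = a n"
  using mean_boundary_monomial[OF assms(1) zero_less_one assms(2), of 1]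
  by (simp only: mult_1 of_nat_1 ln_one diff_0 mult_minus_right mult_minus_left one_dvd if_True div_by_1)

lemma almost_per_cis_ln: "n > 0 \<Longrightarrow> almost_per (\<lambda>t. cis (- t * ln (real n)))"
  using almost_per_rat_trig[OF rat_trig.monomial[of 1 n 1]] by simp

lemma coeff_le_poly_norm:
  assumes "dirichlet_poly a" "p \<ge> 1"
  shows "norm (a n) \<le> poly_norm p a"
proof (cases "n = 0")
  case False
  have ap: "almost_per (\<lambda>t. boundary a t * cis (- t * ln (real n)))"
    using False by (intro almost_per_mult almost_per_boundary assms almost_per_cis_ln) auto
  have "norm (a n) = norm (mean (\<lambda>t. boundary a t * cis (- t * ln (real n))))"
    using mean_boundary_coeff[OF assms(1), of n] False by simp
  also have "\<dots> \<le> bes_norm p (\<lambda>t. boundary a t * cis (- t * ln (real n)))"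
    by (rule norm_mean_le_bes_norm[OF ap assms(2)])
  also have "\<dots> = bes_norm p (boundary a)" by (rule bes_norm_cong) (simp add: norm_mult)
  finally show ?thesis by (simp add: poly_norm_eq)
qed (use dirichlet_polyD(1)[OF assms(1)] in \<open>simp add: poly_norm_eq\<close>)

lemma mean_boundary_cnj:
  assumes a: "dirichlet_poly a" and b: "dirichlet_poly b"
  shows "mean (\<lambda>t. boundary b t * cnj (boundary a t)) = (\<Sum>n | a n \<noteq> 0. b n * cnj (a n))"
proof -
  let ?m = "\<lambda>n t. cnj (a n) * (boundary b t * cis (- t * ln (real n)))"
  have ap: "almost_per (boundary b)" by (rule almost_per_boundary[OF b])
  have pos: "j > 0" if "a j \<noteq> 0" for j using that dirichlet_polyD(1)[OF a] by (cases j) auto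
  have fin: "finite {j. a j \<noteq> 0}" using a by (simp add: dirichlet_poly_def)
  have "boundary b t * cnj (boundary a t) = (\<Sum>n | a n \<noteq> 0. ?m n t)" for t
    unfolding boundary_eq_supp[OF a] by (simp add: sum_distrib_left cis_cnj mult_ac)
  then have "mean (\<lambda>t. boundary b t * cnj (boundary a t)) =
      mean (\<lambda>t. \<Sum>n | a n \<noteq> 0. ?m n t)"
    by simp
  also have "\<dots> = (\<Sum>n | a n \<noteq> 0. mean (\<lambda>t. ?m n t))"
    by (intro mean_sum[OF fin, THEN conjunct1] almost_per_cmult almost_per_mult almost_per_cis_ln ap) (use pos in auto)
  also have "\<dots> = (\<Sum>n | a n \<noteq> 0. b n * cnj (a n))"
  proof (intro sum.cong refl)
    fix n assume "n \<in> {n. a n \<noteq> 0}"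
    then have "n > 0" using pos by auto
    then show "mean (\<lambda>t. ?m n t) = b n * cnj (a n)"
      by (subst mean_cmult)
        (intro almost_per_mult ap almost_per_cis_ln, simp_all only: mean_boundary_coeff[OF b] mult.commute)
  qed
  finally show ?thesis .
qed

lemma parseval:
  assumes a: "dirichlet_poly a"
  shows "(poly_norm 2 a)\<^sup>2 = (\<Sum>n | a n \<noteq> 0. (norm (a n))\<^sup>2)"
proof -
  have ap: "almost_per (boundary a)" by (rule almost_per_boundary[OF a])
  have "(poly_norm 2 a)\<^sup>2 = mean (\<lambda>t. (norm (boundary a t))\<^sup>2)"
    using bes_norm_powr[OF ap, of 2] by (simp add: poly_norm_eq)
  then have "complex_of_real ((poly_norm 2 a)\<^sup>2) = mean (\<lambda>t. of_real ((norm (boundary a t))\<^sup>2))"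
    by (simp only: mean_of_real[OF real_ap_norm_sq[OF ap]])
  also have "\<dots> = of_real (\<Sum>n | a n \<noteq> 0. (norm (a n))\<^sup>2)"
    by (simp only: complex_norm_square mean_boundary_cnj[OF a a] of_real_sum)
  finally show ?thesis by (simp only: of_real_eq_iff)
qed

text \<open>A monomial detects a single coefficient, so coefficientwise convergence is weak
  convergence against trigonometric polynomials. No bound on the norms enters at this stage.\<close>

lemma mean_boundary_tendsto_0:
  assumes P: "\<And>k. dirichlet_poly (P k)" and lim: "\<And>n. (\<lambda>k. P k n) \<longlonglongrightarrow> 0" and g: "rat_trig g"
  shows "(\<lambda>k. mean (\<lambda>t. boundary (P k) t * g t)) \<longlonglongrightarrow> 0"
  using g
proof induction
  case (monomial m n c)
  have "(\<lambda>k. if m dvd n then P k (n div m) else 0) \<longlonglongrightarrow> 0" by (cases "m dvd n") (simp_all add: lim)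
  then show ?case
    unfolding mean_boundary_monomial[OF P monomial] by (rule tendsto_mult_right_zero)
next
  case (add f g)
  have "mean (\<lambda>t. boundary (P k) t * (f t + g t)) = mean (\<lambda>t. boundary (P k) t * f t) + mean (\<lambda>t. boundary (P k) t * g t)" for k
    unfolding distrib_left
    by (intro mean_add almost_per_mult almost_per_boundary P almost_per_rat_trig add.hyps)
  then show ?case using tendsto_add[OF add.IH] by simp
qed

lemma poly_norm_nonneg [simp]: "poly_norm p a \<ge> 0"
  by (simp add: poly_norm_eq)

lemma poly_norm_triangle:
  "dirichlet_poly a \<Longrightarrow> dirichlet_poly b \<Longrightarrow> p \<ge> 1 \<Longrightarrow> poly_norm p (\<lambda>n. a n + b n) \<le> poly_norm p a + poly_norm p b"
  unfolding poly_norm_eq by (subst boundary_add) (auto intro!: bes_norm_triangle almost_per_boundary)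

lemma poly_norm_cmult:
  "dirichlet_poly a \<Longrightarrow> p \<ge> 1 \<Longrightarrow> poly_norm p (\<lambda>n. c * a n) = norm c * poly_norm p a"
  unfolding poly_norm_eq by (subst boundary_cmult) (auto intro!: bes_norm_cmult almost_per_boundary)

lemma poly_norm_minus_commute:
  assumes "dirichlet_poly a" "dirichlet_poly b" "p \<ge> 1"
  shows "poly_norm p (\<lambda>n. a n - b n) = poly_norm p (\<lambda>n. b n - a n)"
  using poly_norm_cmult[OF dirichlet_poly_diff[OF assms(1,2)] assms(3), of "-1"]
  by (simp only: mult_minus1 minus_diff_eq norm_minus_cancel norm_one mult_1)

lemma poly_norm_triangle3:
  assumes "dirichlet_poly a" "dirichlet_poly b" "p \<ge> 1"
  shows "\<bar>poly_norm p a - poly_norm p b\<bar> \<le> poly_norm p (\<lambda>n. a n - b n)"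
  using poly_norm_triangle[OF dirichlet_poly_diff[OF assms(1,2)] assms(2,3)]
    poly_norm_triangle[OF dirichlet_poly_diff[OF assms(2,1)] assms(1,3)]
    poly_norm_minus_commute[OF assms]
  by (simp only: diff_add_cancel abs_le_iff) linarith

lemma poly_norm_Holder:
  assumes "dirichlet_poly a" "dirichlet_poly b" "p > 0" "q > 0" "r > 0" "1 / q = 1 / r + 1 / p"
  shows "poly_norm q (dirichlet_mult a b) \<le> poly_norm r a * poly_norm p b"
  unfolding poly_norm_eq boundary_mult[OF assms(1,2)]
  by (intro bes_norm_Holder almost_per_boundary assms)

lemma poly_norm_unit_mult:
  assumes "m > 0" "dirichlet_poly a"
  shows "poly_norm p (dirichlet_mult (dirichlet_unit m) a) = poly_norm p a"
  unfolding poly_norm_eq boundary_mult[OF dirichlet_poly_unit[OF assms(1)] assms(2)]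
  by (rule bes_norm_cong) (simp add: norm_mult boundary_unit assms(1))

subsection \<open>Hardy spaces of Dirichlet series\<close>

text \<open>The completion embeds into coefficient sequences. For fixed \<open>j\<close> the
  differences \<open>P j - P k\<close> converge weakly to \<open>P j\<close> and are eventually
  small in norm; lower semicontinuity makes \<open>P j\<close> small as well.\<close>

lemma poly_norm_null_sequence:
  assumes P: "\<And>k. dirichlet_poly (P k)" and p: "p \<ge> 1"
    and C: "\<And>e. e > 0 \<Longrightarrow> \<exists>N. \<forall>j\<ge>N. \<forall>k\<ge>N. poly_norm p (\<lambda>n. P j n - P k n) < e"
    and lim: "\<And>n. (\<lambda>k. P k n) \<longlonglongrightarrow> 0"
  shows "(\<lambda>k. poly_norm p (P k)) \<longlonglongrightarrow> 0"
proof (rule LIMSEQ_I)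
  fix e :: real assume e: "e > 0"
  obtain N where N: "\<And>j k. j \<ge> N \<Longrightarrow> k \<ge> N \<Longrightarrow> poly_norm p (\<lambda>n. P j n - P k n) < e / 2"
    using C[of "e / 2"] e by auto
  have "poly_norm p (P j) \<le> e / 2" if j: "j \<ge> N" for j
  proof -
    have "bes_norm p (boundary (P j)) \<le> e / 2"
    proof (rule bes_norm_lower_semicont[OF _ _ p])
      let ?h = "\<lambda>k. boundary (\<lambda>n. P j n - P (N + k) n)"
      show "almost_per (boundary (P j))" "\<And>k. almost_per (?h k)"
        by (intro almost_per_boundary dirichlet_poly_diff P)+
      show "\<forall>\<^sub>F k in sequentially. bes_norm p (?h k) \<le> e / 2"
        using N[OF j] by (intro always_eventually allI) (simp add: poly_norm_eq less_imp_le)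
      show "bes_norm 1 (?h k) \<le> e / 2" for k
      proof (rule order_trans[OF bes_norm_mono_exponent[OF _ p]])
        show "bes_norm p (?h k) \<le> e / 2" using N[OF j, of "N + k"] by (simp add: poly_norm_eq less_imp_le)
      qed (intro almost_per_boundary dirichlet_poly_diff P)
      fix g assume g: "rat_trig g"
      have "mean (\<lambda>t. ?h k t * g t) = mean (\<lambda>t. boundary (P j) t * g t) - mean (\<lambda>t. boundary (P (N + k)) t * g t)" for k
        unfolding boundary_diff[OF P P] left_diff_distrib
        by (intro mean_diff almost_per_mult almost_per_boundary P almost_per_rat_trig g)
      moreover have "(\<lambda>k. mean (\<lambda>t. boundary (P (N + k)) t * g t)) \<longlonglongrightarrow> 0"
        by (rule mean_boundary_tendsto_0[OF P _ g]) (intro LIMSEQ_ignore_initial_segment[OF lim, of N, unfolded add.commute[of _ N]])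
      ultimately show "(\<lambda>k. mean (\<lambda>t. ?h k t * g t)) \<longlonglongrightarrow> mean (\<lambda>t. boundary (P j) t * g t)"
        using tendsto_diff[OF tendsto_const] by fastforce
    qed
    then show ?thesis by (simp add: poly_norm_eq)
  qed
  then show "\<exists>no. \<forall>k\<ge>no. norm (poly_norm p (P k) - 0) < e"
    using e by (intro exI[of _ N]) (auto intro: le_less_trans[of _ "e / 2"])
qed

lemma hardy_approxD:
  assumes "hardy_approx p P a"
  shows "dirichlet_poly (P k)" "(\<lambda>k. P k n) \<longlonglongrightarrow> a n"
    "e > 0 \<Longrightarrow> \<exists>N. \<forall>j\<ge>N. \<forall>k\<ge>N. poly_norm p (\<lambda>n. P j n - P k n) < e"
  using assms by (auto simp: hardy_approx_def)

lemma hardy_approx_add: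
  assumes P: "hardy_approx p P a" and Q: "hardy_approx p Q b" and p: "p \<ge> 1"
  shows "hardy_approx p (\<lambda>k n. P k n + Q k n) (\<lambda>n. a n + b n)"
  unfolding hardy_approx_def
proof (intro conjI allI impI)
  show "dirichlet_poly (\<lambda>n. P k n + Q k n)" for k by (intro dirichlet_poly_add hardy_approxD[OF P] hardy_approxD[OF Q])
  show "(\<lambda>k. P k n + Q k n) \<longlonglongrightarrow> a n + b n" for n by (intro tendsto_add hardy_approxD[OF P] hardy_approxD[OF Q])
  fix e :: real assume e: "e > 0"
  obtain N where N: "\<And>j k. j \<ge> N \<Longrightarrow> k \<ge> N \<Longrightarrow> poly_norm p (\<lambda>n. P j n - P k n) < e / 2"
    using hardy_approxD(3)[OF P, of "e / 2"] e by auto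
  obtain M where M: "\<And>j k. j \<ge> M \<Longrightarrow> k \<ge> M \<Longrightarrow> poly_norm p (\<lambda>n. Q j n - Q k n) < e / 2"
    using hardy_approxD(3)[OF Q, of "e / 2"] e by auto
  have "poly_norm p (\<lambda>n. P j n + Q j n - (P k n + Q k n)) < e" if "j \<ge> max M N" "k \<ge> max M N" for j k
  proof -
    have "poly_norm p (\<lambda>n. (P j n - P k n) + (Q j n - Q k n)) \<le> poly_norm p (\<lambda>n. P j n - P k n) + poly_norm p (\<lambda>n. Q j n - Q k n)"
      by (intro poly_norm_triangle dirichlet_poly_diff hardy_approxD[OF P] hardy_approxD[OF Q] p)
    moreover have "(\<lambda>n. P j n + Q j n - (P k n + Q k n)) = (\<lambda>n. (P j n - P k n) + (Q j n - Q k n))"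
      by (simp add: algebra_simps)
    ultimately show ?thesis using N[of j k] M[of j k] that by simp
  qed
  then show "\<exists>N. \<forall>j\<ge>N. \<forall>k\<ge>N. poly_norm p (\<lambda>n. P j n + Q j n - (P k n + Q k n)) < e" by blast
qed

lemma hardy_approx_cmult:
  assumes P: "hardy_approx p P a" and p: "p \<ge> 1"
  shows "hardy_approx p (\<lambda>k n. c * P k n) (\<lambda>n. c * a n)"
  unfolding hardy_approx_def
proof (intro conjI allI impI)
  show "dirichlet_poly (\<lambda>n. c * P k n)" for k by (intro dirichlet_poly_cmult hardy_approxD[OF P])
  show "(\<lambda>k. c * P k n) \<longlonglongrightarrow> c * a n" for n by (intro tendsto_mult tendsto_const hardy_approxD[OF P])
  fix e :: real assume e: "e > 0"
  define d where "d = e / (norm c + 1)"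
  have d: "d > 0" using e by (simp add: d_def add_nonneg_pos)
  obtain N where N: "\<And>j k. j \<ge> N \<Longrightarrow> k \<ge> N \<Longrightarrow> poly_norm p (\<lambda>n. P j n - P k n) < d"
    using hardy_approxD(3)[OF P d] by auto
  have "poly_norm p (\<lambda>n. c * P j n - c * P k n) < e" if "j \<ge> N" "k \<ge> N" for j k
  proof -
    have "poly_norm p (\<lambda>n. c * (P j n - P k n)) = norm c * poly_norm p (\<lambda>n. P j n - P k n)"
      by (intro poly_norm_cmult dirichlet_poly_diff hardy_approxD[OF P] p)
    also have "\<dots> \<le> norm c * d" using N[OF that] by (intro mult_left_mono) auto
    also have "\<dots> < (norm c + 1) * d" using d by simp
    also have "\<dots> = e"
    proof -
      have "norm c + 1 \<noteq> 0" using norm_ge_zero[of c] by linarith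
      then show ?thesis by (simp add: d_def)
    qed
    finally show ?thesis by (simp add: algebra_simps)
  qed
  then show "\<exists>N. \<forall>j\<ge>N. \<forall>k\<ge>N. poly_norm p (\<lambda>n. c * P j n - c * P k n) < e" by blast
qed

lemma hardy_approx_diff:
  assumes "hardy_approx p P a" "hardy_approx p Q b" "p \<ge> 1"
  shows "hardy_approx p (\<lambda>k n. P k n - Q k n) (\<lambda>n. a n - b n)"
  using hardy_approx_add[OF assms(1) hardy_approx_cmult[OF assms(2,3), of "-1"] assms(3)]
  by (simp only: mult_minus1 add_uminus_conv_diff)

lemma hardy_approx_convergent:
  assumes P: "hardy_approx p P a" and p: "p \<ge> 1"
  shows "convergent (\<lambda>k. poly_norm p (P k))"
proof -
  have "Cauchy (\<lambda>k. poly_norm p (P k))"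
  proof (rule metric_CauchyI)
    fix e :: real assume e: "e > 0"
    obtain N where N: "\<forall>j\<ge>N. \<forall>k\<ge>N. poly_norm p (\<lambda>n. P j n - P k n) < e"
      using hardy_approxD(3)[OF P e] by blast
    have "dist (poly_norm p (P j)) (poly_norm p (P k)) < e" if "j \<ge> N" "k \<ge> N" for j k
      unfolding dist_real_def
      by (rule le_less_trans[OF poly_norm_triangle3[OF hardy_approxD(1)[OF P] hardy_approxD(1)[OF P] p]])
        (use N that in blast)
    then show "\<exists>M. \<forall>m\<ge>M. \<forall>n\<ge>M. dist (poly_norm p (P m)) (poly_norm p (P n)) < e" by blast
  qed
  then show ?thesis by (simp add: Cauchy_convergent_iff)
qed

text \<open>Justifies the description operator in \<open>hardy_norm\<close>: two approximations of
  the same series differ by a Cauchy sequence with vanishing coefficients, which is a null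
  sequence.\<close>

lemma hardy_norm_tendsto:
  assumes P: "hardy_approx p P a" and p: "p \<ge> 1"
  shows "(\<lambda>k. poly_norm p (P k)) \<longlonglongrightarrow> hardy_norm p a"
proof -
  obtain l where l: "(\<lambda>k. poly_norm p (P k)) \<longlonglongrightarrow> l"
    using hardy_approx_convergent[OF assms] by (auto simp: convergent_def)
  have "l' = l" if Q: "hardy_approx p Q a" and l': "(\<lambda>k. poly_norm p (Q k)) \<longlonglongrightarrow> l'" for Q l'
  proof -
    have D: "hardy_approx p (\<lambda>k n. P k n - Q k n) (\<lambda>n. a n - a n)" by (intro hardy_approx_diff P Q p)
    have "(\<lambda>k. poly_norm p (\<lambda>n. P k n - Q k n)) \<longlonglongrightarrow> 0"
      by (rule poly_norm_null_sequence[OF hardy_approxD(1)[OF D] p hardy_approxD(3)[OF D]])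
        (use hardy_approxD(2)[OF D] in auto)
    then have "(\<lambda>k. poly_norm p (P k) - poly_norm p (Q k)) \<longlonglongrightarrow> 0"
      by (rule Lim_null_comparison[rotated])
        (intro always_eventually allI, unfold real_norm_def,
          rule poly_norm_triangle3[OF hardy_approxD(1)[OF P] hardy_approxD(1)[OF Q] p])
    then have "l - l' = 0" by (rule LIMSEQ_unique[OF tendsto_diff[OF l l']])
    then show ?thesis by simp
  qed
  with P l have "hardy_norm p a = l" unfolding hardy_norm_def by (intro the_equality) blast+
  with l show ?thesis by simp
qed

lemma hardyE:
  assumes "a \<in> hardy p"
  obtains P where "hardy_approx p P a"
  using assms by (auto simp: hardy_def)

lemma hardyI: "hardy_approx p P a \<Longrightarrow> a \<in> hardy p"
  by (auto simp: hardy_def)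

lemma hardy_norm_nonneg: "a \<in> hardy p \<Longrightarrow> p \<ge> 1 \<Longrightarrow> hardy_norm p a \<ge> 0"
proof (elim hardyE)
  fix P assume "p \<ge> 1" "hardy_approx p P a"
  then show ?thesis by (intro tendsto_lowerbound[OF hardy_norm_tendsto]) auto
qed

lemma hardy_add: "a \<in> hardy p \<Longrightarrow> b \<in> hardy p \<Longrightarrow> p \<ge> 1 \<Longrightarrow> (\<lambda>n. a n + b n) \<in> hardy p"
proof (elim hardyE)
  fix P Q assume "p \<ge> 1" "hardy_approx p P a" "hardy_approx p Q b"
  then show ?thesis by (intro hardyI[OF hardy_approx_add])
qed

lemma hardy_cmult: "a \<in> hardy p \<Longrightarrow> p \<ge> 1 \<Longrightarrow> (\<lambda>n. c * a n) \<in> hardy p"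
proof (elim hardyE)
  fix P assume "p \<ge> 1" "hardy_approx p P a"
  then show ?thesis by (intro hardyI[OF hardy_approx_cmult])
qed

lemma hardy_diff: "a \<in> hardy p \<Longrightarrow> b \<in> hardy p \<Longrightarrow> p \<ge> 1 \<Longrightarrow> (\<lambda>n. a n - b n) \<in> hardy p"
proof (elim hardyE)
  fix P Q assume "p \<ge> 1" "hardy_approx p P a" "hardy_approx p Q b"
  then show ?thesis by (intro hardyI[OF hardy_approx_diff])
qed

lemma hardy_norm_triangle:
  assumes a: "a \<in> hardy p" and b: "b \<in> hardy p" and p: "p \<ge> 1"
  shows "hardy_norm p (\<lambda>n. a n + b n) \<le> hardy_norm p a + hardy_norm p b"
proof -
  obtain P where P: "hardy_approx p P a" using a by (rule hardyE)
  obtain Q where Q: "hardy_approx p Q b" using b by (rule hardyE)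
  show ?thesis
    by (rule LIMSEQ_le[OF hardy_norm_tendsto[OF hardy_approx_add[OF P Q p] p] tendsto_add[OF hardy_norm_tendsto[OF P p] hardy_norm_tendsto[OF Q p]]])
      (use poly_norm_triangle[OF hardy_approxD(1)[OF P] hardy_approxD(1)[OF Q] p] in blast)
qed

lemma hardy_norm_cmult:
  assumes a: "a \<in> hardy p" and p: "p \<ge> 1"
  shows "hardy_norm p (\<lambda>n. c * a n) = norm c * hardy_norm p a"
proof -
  obtain P where P: "hardy_approx p P a" using a by (rule hardyE)
  have "(\<lambda>k. poly_norm p (\<lambda>n. c * P k n)) \<longlonglongrightarrow> norm c * hardy_norm p a"
    unfolding poly_norm_cmult[OF hardy_approxD(1)[OF P] p]
    by (intro tendsto_mult tendsto_const hardy_norm_tendsto P p)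
  with hardy_norm_tendsto[OF hardy_approx_cmult[OF P p] p] show ?thesis by (rule LIMSEQ_unique)
qed

lemma hardy_norm_minus_commute:
  assumes "a \<in> hardy p" "b \<in> hardy p" "p \<ge> 1"
  shows "hardy_norm p (\<lambda>n. a n - b n) = hardy_norm p (\<lambda>n. b n - a n)"
  using hardy_norm_cmult[OF hardy_diff[OF assms] assms(3), of "-1"]
  by (simp only: mult_minus1 minus_diff_eq norm_minus_cancel norm_one mult_1)

lemma hardy_norm_triangle_diff:
  assumes "a \<in> hardy p" "b \<in> hardy p" "p \<ge> 1"
  shows "hardy_norm p a \<le> hardy_norm p (\<lambda>n. a n - b n) + hardy_norm p b"
  using hardy_norm_triangle[OF hardy_diff[OF assms] assms(2,3)] by (simp only: diff_add_cancel)

lemma hardy_approx_const: "dirichlet_poly a \<Longrightarrow> hardy_approx p (\<lambda>k. a) a"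
  by (simp add: hardy_approx_def poly_norm_eq bes_norm_def boundary_0 mean_const)

lemma hardy_poly: "dirichlet_poly a \<Longrightarrow> a \<in> hardy p"
  by (rule hardyI[OF hardy_approx_const])

lemma hardy_norm_poly: "dirichlet_poly a \<Longrightarrow> p \<ge> 1 \<Longrightarrow> hardy_norm p a = poly_norm p a"
  using hardy_norm_tendsto[OF hardy_approx_const] by (simp add: LIMSEQ_const_iff)

lemma hardy_approx_norm_diff:
  assumes P: "hardy_approx p P a" and p: "p \<ge> 1"
  shows "(\<lambda>k. hardy_norm p (\<lambda>n. a n - P k n)) \<longlonglongrightarrow> 0"
proof (rule LIMSEQ_I)
  fix e :: real assume e: "e > 0"
  obtain N where N: "\<And>j k. j \<ge> N \<Longrightarrow> k \<ge> N \<Longrightarrow> poly_norm p (\<lambda>n. P j n - P k n) < e / 2"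
    using hardy_approxD(3)[OF P, of "e / 2"] e by auto
  have "norm (hardy_norm p (\<lambda>n. a n - P k n) - 0) < e" if k: "k \<ge> N" for k
  proof -
    have D: "hardy_approx p (\<lambda>j n. P j n - P k n) (\<lambda>n. a n - P k n)"
      by (intro hardy_approx_diff P p hardy_approx_const hardy_approxD(1)[OF P])
    have "hardy_norm p (\<lambda>n. a n - P k n) \<le> e / 2"
      by (rule tendsto_upperbound[OF hardy_norm_tendsto[OF D p]])
        (use N[OF _ k] in \<open>auto simp: eventually_sequentially intro!: exI[of _ N] less_imp_le\<close>)
    then show ?thesis using e hardy_norm_nonneg[OF hardyI[OF D] p] by simp
  qed
  then show "\<exists>no. \<forall>k\<ge>no. norm (hardy_norm p (\<lambda>n. a n - P k n) - 0) < e" by blast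
qed

lemma hardy_dense:
  assumes "a \<in> hardy p" "p \<ge> 1" "e > 0"
  obtains P where "dirichlet_poly P" "hardy_norm p (\<lambda>n. a n - P n) < e"
proof -
  obtain P where P: "hardy_approx p P a" using assms(1) by (rule hardyE)
  obtain k where "norm (hardy_norm p (\<lambda>n. a n - P k n) - 0) < e"
    using LIMSEQ_D[OF hardy_approx_norm_diff[OF P assms(2)] assms(3)] by blast
  then show thesis by (intro that[of "P k"] hardy_approxD[OF P]) auto
qed

lemma coeff_le_hardy_norm:
  assumes "a \<in> hardy p" "p \<ge> 1"
  shows "norm (a n) \<le> hardy_norm p a"
proof -
  obtain P where P: "hardy_approx p P a" using assms(1) by (rule hardyE)
  show ?thesis
    by (rule LIMSEQ_le[OF tendsto_norm[OF hardy_approxD(2)[OF P]] hardy_norm_tendsto[OF P assms(2)]])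
      (use coeff_le_poly_norm[OF hardy_approxD(1)[OF P] assms(2)] in blast)
qed

text \<open>Replacing \<open>A k\<close> by a polynomial at distance below 1/(k+1) gives an
  approximating sequence in the sense of \<open>hardy_approx\<close>; the prescribed coefficient
  limits identify what it approximates.\<close>

lemma hardy_complete:
  assumes A: "\<And>k. A k \<in> hardy p" and p: "p \<ge> 1"
    and C: "\<And>e. e > 0 \<Longrightarrow> \<exists>N. \<forall>j\<ge>N. \<forall>k\<ge>N. hardy_norm p (\<lambda>n. A j n - A k n) < e"
    and lim: "\<And>n. (\<lambda>k. A k n) \<longlonglongrightarrow> a n"
  shows "a \<in> hardy p" "(\<lambda>k. hardy_norm p (A k)) \<longlonglongrightarrow> hardy_norm p a"
proof -
  have "\<exists>P. dirichlet_poly P \<and> hardy_norm p (\<lambda>n. A k n - P n) < inverse (real (Suc k))" for k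
    using hardy_dense[OF A p, of "inverse (real (Suc k))" k] by (metis inverse_positive_iff_positive of_nat_0_less_iff zero_less_Suc)
  then obtain P where P: "\<And>k. dirichlet_poly (P k)" "\<And>k. hardy_norm p (\<lambda>n. A k n - P k n) < inverse (real (Suc k))"
    by metis
  have Ph: "P k \<in> hardy p" for k by (rule hardy_poly[OF P(1)])
  have null: "(\<lambda>k. hardy_norm p (\<lambda>n. A k n - P k n)) \<longlonglongrightarrow> 0"
    by (rule Lim_null_comparison[OF _ LIMSEQ_inverse_real_of_nat])
      (use P(2) hardy_norm_nonneg[OF hardy_diff[OF A Ph p] p] in \<open>auto intro!: always_eventually less_imp_le\<close>)
  have ap: "hardy_approx p P a"
    unfolding hardy_approx_def
  proof (intro conjI allI impI P(1))
    fix n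
    have "(\<lambda>k. A k n - P k n) \<longlonglongrightarrow> 0"
      by (rule Lim_null_comparison[OF _ null]) (intro always_eventually allI coeff_le_hardy_norm[OF hardy_diff[OF A Ph p] p])
    from tendsto_diff[OF lim[of n] this] show "(\<lambda>k. P k n) \<longlonglongrightarrow> a n" by simp
  next
    fix e :: real assume e: "e > 0"
    then have e3: "e / 3 > 0" by simp
    obtain N where N: "\<And>j k. j \<ge> N \<Longrightarrow> k \<ge> N \<Longrightarrow> hardy_norm p (\<lambda>n. A j n - A k n) < e / 3"
      using C[OF e3] by auto
    obtain M where M: "\<And>k. k \<ge> M \<Longrightarrow> hardy_norm p (\<lambda>n. A k n - P k n) < e / 3"
      using LIMSEQ_D[OF null e3] hardy_norm_nonneg[OF hardy_diff[OF A Ph p] p] by auto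
    have "poly_norm p (\<lambda>n. P j n - P k n) < e" if "j \<ge> max M N" "k \<ge> max M N" for j k
    proof -
      have "poly_norm p (\<lambda>n. P j n - P k n) = hardy_norm p (\<lambda>n. P j n - P k n)"
        by (intro hardy_norm_poly[symmetric] dirichlet_poly_diff P p)
      also have "(\<lambda>n. P j n - P k n) = (\<lambda>n. ((P j n - A j n) + (A j n - A k n)) + (A k n - P k n))" by simp
      also have "hardy_norm p \<dots> \<le> hardy_norm p (\<lambda>n. P j n - A j n) + hardy_norm p (\<lambda>n. A j n - A k n) + hardy_norm p (\<lambda>n. A k n - P k n)"
        by (intro order_trans[OF hardy_norm_triangle] add_right_mono hardy_norm_triangle hardy_add hardy_diff A Ph p)
      also have "hardy_norm p (\<lambda>n. P j n - A j n) = hardy_norm p (\<lambda>n. A j n - P j n)"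
        by (intro hardy_norm_minus_commute A Ph p)
      finally show ?thesis using M[of j] M[of k] N[of j k] that by simp
    qed
    then show "\<exists>N. \<forall>j\<ge>N. \<forall>k\<ge>N. poly_norm p (\<lambda>n. P j n - P k n) < e" by blast
  qed
  show "a \<in> hardy p" by (rule hardyI[OF ap])
  have "(\<lambda>k. hardy_norm p (A k) - poly_norm p (P k)) \<longlonglongrightarrow> 0"
  proof (rule Lim_null_comparison[OF _ null], intro always_eventually allI)
    fix k
    show "norm (hardy_norm p (A k) - poly_norm p (P k)) \<le> hardy_norm p (\<lambda>n. A k n - P k n)"
      using hardy_norm_triangle_diff[OF A[of k] Ph[of k] p] hardy_norm_triangle_diff[OF Ph[of k] A[of k] p]
        hardy_norm_minus_commute[OF A[of k] Ph[of k] p] hardy_norm_poly[OF P(1)[of k] p] by (simp add: abs_le_iff)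
  qed
  from tendsto_add[OF this hardy_norm_tendsto[OF ap p]]
  show "(\<lambda>k. hardy_norm p (A k)) \<longlonglongrightarrow> hardy_norm p a" by simp
qed

subsection \<open>Multiplication operators\<close>

lemma dirichlet_mult_cmult_right: "dirichlet_mult a (\<lambda>n. c * b n) = (\<lambda>n. c * dirichlet_mult a b n)"
  by (auto simp: dirichlet_mult_def sum_distrib_left mult_ac)

lemma dirichlet_mult_diff_right: "dirichlet_mult a (\<lambda>n. b n - c n) = (\<lambda>n. dirichlet_mult a b n - dirichlet_mult a c n)"
  by (auto simp: dirichlet_mult_def right_diff_distrib sum_subtractf)

lemma dirichlet_mult_diff_left: "dirichlet_mult (\<lambda>n. a n - b n) c = (\<lambda>n. dirichlet_mult a c n - dirichlet_mult b c n)"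
  by (auto simp: dirichlet_mult_def left_diff_distrib sum_subtractf)

lemma tendsto_dirichlet_mult:
  assumes "\<And>n. (\<lambda>k. P k n) \<longlonglongrightarrow> a n" "\<And>n. (\<lambda>k. Q k n) \<longlonglongrightarrow> b n"
  shows "(\<lambda>k. dirichlet_mult (P k) (Q k) n) \<longlonglongrightarrow> dirichlet_mult a b n"
  by (cases "n = 0") (auto simp: dirichlet_mult_def intro!: tendsto_sum tendsto_mult assms)

lemma hardy_approx_mult:
  assumes P: "hardy_approx r P D" and R: "hardy_approx p R f"
    and pqr: "p \<ge> 1" "q \<ge> 1" "r \<ge> 1" and eq: "1 / q = 1 / r + 1 / p"
  shows "hardy_approx q (\<lambda>k. dirichlet_mult (P k) (R k)) (dirichlet_mult D f)"
  unfolding hardy_approx_def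
proof (intro conjI allI impI)
  note dP = hardy_approxD(1)[OF P] and dR = hardy_approxD(1)[OF R]
  show "dirichlet_poly (dirichlet_mult (P k) (R k))" for k by (intro dirichlet_poly_mult dP dR)
  show "(\<lambda>k. dirichlet_mult (P k) (R k) n) \<longlonglongrightarrow> dirichlet_mult D f n" for n
    by (intro tendsto_dirichlet_mult hardy_approxD(2)[OF P] hardy_approxD(2)[OF R])
  fix e :: real assume e: "e > 0"
  obtain A where A: "A > 0" "\<And>k. norm (poly_norm r (P k)) \<le> A"
    using convergent_imp_Bseq[OF hardy_approx_convergent[OF P pqr(3)]] by (auto elim: BseqE)
  obtain B where B: "B > 0" "\<And>k. norm (poly_norm p (R k)) \<le> B"
    using convergent_imp_Bseq[OF hardy_approx_convergent[OF R pqr(1)]] by (auto elim: BseqE)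
  have eB: "e / (2 * B) > 0" and eA: "e / (2 * A) > 0" using e A B by auto
  obtain N where N: "\<And>j k. j \<ge> N \<Longrightarrow> k \<ge> N \<Longrightarrow> poly_norm r (\<lambda>n. P j n - P k n) < e / (2 * B)"
    using hardy_approxD(3)[OF P eB] by auto
  obtain M where M: "\<And>j k. j \<ge> M \<Longrightarrow> k \<ge> M \<Longrightarrow> poly_norm p (\<lambda>n. R j n - R k n) < e / (2 * A)"
    using hardy_approxD(3)[OF R eA] by auto
  have "poly_norm q (\<lambda>n. dirichlet_mult (P j) (R j) n - dirichlet_mult (P k) (R k) n) < e"
    if j: "j \<ge> max M N" and k: "k \<ge> max M N" for j k
  proof -
    \<comment> \<open>The product rule for differences: Hoelder bounds each part by one small and
      one bounded factor, and \<open>A\<close>, \<open>B\<close> were chosen so that each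
      contributes \<open>e / 2\<close>.\<close>
    let ?X = "dirichlet_mult (\<lambda>n. P j n - P k n) (R j)" and ?Y = "dirichlet_mult (P k) (\<lambda>n. R j n - R k n)"
    have "(\<lambda>n. dirichlet_mult (P j) (R j) n - dirichlet_mult (P k) (R k) n) = (\<lambda>n. ?X n + ?Y n)"
      by (simp add: dirichlet_mult_diff_left dirichlet_mult_diff_right)
    then have "poly_norm q (\<lambda>n. dirichlet_mult (P j) (R j) n - dirichlet_mult (P k) (R k) n) \<le> poly_norm q ?X + poly_norm q ?Y"
      using poly_norm_triangle[of ?X ?Y q] pqr by (simp add: dirichlet_poly_mult dirichlet_poly_diff dP dR)
    moreover have "poly_norm q ?X \<le> poly_norm r (\<lambda>n. P j n - P k n) * poly_norm p (R j)"
      by (intro poly_norm_Holder dirichlet_poly_diff dP dR eq) (use pqr in auto)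
    moreover have "poly_norm r (\<lambda>n. P j n - P k n) * poly_norm p (R j) \<le> poly_norm r (\<lambda>n. P j n - P k n) * B"
      using B(2)[of j] by (intro mult_left_mono) auto
    moreover have "poly_norm r (\<lambda>n. P j n - P k n) * B < e / (2 * B) * B"
      using N[of j k] j k B(1) by (intro mult_strict_right_mono) auto
    moreover have "poly_norm q ?Y \<le> poly_norm r (P k) * poly_norm p (\<lambda>n. R j n - R k n)"
      by (intro poly_norm_Holder dirichlet_poly_diff dP dR eq) (use pqr in auto)
    moreover have "poly_norm r (P k) * poly_norm p (\<lambda>n. R j n - R k n) \<le> A * poly_norm p (\<lambda>n. R j n - R k n)"
      using A(2)[of k] by (intro mult_right_mono) auto
    moreover have "A * poly_norm p (\<lambda>n. R j n - R k n) < A * (e / (2 * A))"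
      using M[of j k] j k A(1) by (intro mult_strict_left_mono) auto
    moreover have "e / (2 * B) * B = e / 2" "A * (e / (2 * A)) = e / 2" using A B by auto
    ultimately show ?thesis by linarith
  qed
  then show "\<exists>N. \<forall>j\<ge>N. \<forall>k\<ge>N. poly_norm q (\<lambda>n. dirichlet_mult (P j) (R j) n - dirichlet_mult (P k) (R k) n) < e"
    by blast
qed

lemma hardy_mult:
  assumes D: "D \<in> hardy r" and f: "f \<in> hardy p"
    and pqr: "p \<ge> 1" "q \<ge> 1" "r \<ge> 1" and eq: "1 / q = 1 / r + 1 / p"
  shows "dirichlet_mult D f \<in> hardy q" "hardy_norm q (dirichlet_mult D f) \<le> hardy_norm r D * hardy_norm p f"
proof -
  obtain P where P: "hardy_approx r P D" using D by (rule hardyE)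
  obtain R where R: "hardy_approx p R f" using f by (rule hardyE)
  note PR = hardy_approx_mult[OF P R pqr eq]
  show "dirichlet_mult D f \<in> hardy q" by (rule hardyI[OF PR])
  have "poly_norm q (dirichlet_mult (P k) (R k)) \<le> poly_norm r (P k) * poly_norm p (R k)" for k
    by (intro poly_norm_Holder hardy_approxD(1)[OF P] hardy_approxD(1)[OF R] eq) (use pqr in auto)
  then show "hardy_norm q (dirichlet_mult D f) \<le> hardy_norm r D * hardy_norm p f"
    by (intro LIMSEQ_le[OF hardy_norm_tendsto[OF PR pqr(2)]
          tendsto_mult[OF hardy_norm_tendsto[OF P pqr(3)] hardy_norm_tendsto[OF R pqr(1)]]]) blast
qed

text \<open>The zero operator is a compact competitor.\<close>

lemma essential_norm_le:
  assumes "\<And>f. f \<in> hardy p \<Longrightarrow> hardy_norm q (T f) \<le> c * hardy_norm p f" "c \<ge> 0" "q \<ge> 1"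
  shows "essential_norm p q T \<le> ereal c"
proof -
  let ?K = "\<lambda>(f :: nat \<Rightarrow> complex) (n :: nat). 0 :: complex"
  have 0: "(\<lambda>n. 0) \<in> hardy q" by (rule hardy_poly[OF dirichlet_poly_0])
  have n0: "hardy_norm q (\<lambda>n. 0) = 0"
    using hardy_norm_cmult[OF 0 assms(3), of 0] by simp
  have "compact_operator p q ?K"
    unfolding compact_operator_def
  proof (intro conjI allI impI)
    fix F :: "nat \<Rightarrow> nat \<Rightarrow> complex"
    show "\<exists>g\<in>hardy q. \<exists>\<phi>::nat \<Rightarrow> nat. strict_mono \<phi> \<and> (\<lambda>k. hardy_norm q (\<lambda>n. 0 - g n)) \<longlonglongrightarrow> 0"
      using 0 n0 by (intro bexI[of _ "\<lambda>n. 0"] exI[of _ id]) (auto simp: strict_mono_def)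
  qed (use 0 in auto)
  then have "essential_norm p q T \<le> op_norm p q (\<lambda>f n. T f n - ?K f n)"
    unfolding essential_norm_def by (intro INF_lower) auto
  also have "\<dots> \<le> ereal c"
    unfolding op_norm_def
  proof (rule SUP_least)
    fix f assume "f \<in> {f \<in> hardy p. hardy_norm p f \<le> 1}"
    then show "ereal (hardy_norm q (\<lambda>n. T f n - ?K f n)) \<le> ereal c"
      using assms(1)[of f] mult_left_mono[of "hardy_norm p f" 1 c] assms(2) by auto
  qed
  finally show ?thesis .
qed

subsection \<open>Perturbation by compact operators\<close>

lemma compact_operator_sum:
  fixes F :: "nat \<Rightarrow> nat \<Rightarrow> complex"
  assumes K: "compact_operator p q K" and p: "p \<ge> 1" and F: "\<And>k. F k \<in> hardy p"
  shows "(\<lambda>n. \<Sum>k<N. F k n) \<in> hardy p \<and> K (\<lambda>n. \<Sum>k<N. F k n) = (\<lambda>n. \<Sum>k<N. K (F k) n)"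
proof (induction N)
  case 0
  \<comment> \<open>Homogeneity with scalar 0 gives K 0 = 0.\<close>
  have "K (\<lambda>n. 0 * F 0 n) = (\<lambda>n. 0 * K (F 0) n)" using K F[of 0] unfolding compact_operator_def by blast
  then show ?case by (simp add: hardy_poly[OF dirichlet_poly_0])
next
  case (Suc N)
  have "K (\<lambda>n. f n + g n) = (\<lambda>n. K f n + K g n)" if "f \<in> hardy p" "g \<in> hardy p" for f g
    using K that unfolding compact_operator_def by blast
  from this[OF conjunct1[OF Suc] F]
  have "K (\<lambda>n. (\<Sum>k<N. F k n) + F N n) = (\<lambda>n. K (\<lambda>n. \<Sum>k<N. F k n) n + K (F N) n)" .
  with Suc show ?case using hardy_add[OF _ F[of N] p] by simp
qed

text \<open>A crude interpolation: the 1-norm is at most the 2-norm, which is \<open>sqrt N\<close>,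
  and the sup norm is at most \<open>N\<close>, so the mean of the p-th power is at most
  \<open>N powr (p - 1) * N powr (1/2)\<close>. It matters only that the exponent is below
  1.\<close>

lemma poly_norm_sum_units:
  fixes N :: nat and \<phi> :: "nat \<Rightarrow> nat"
  assumes inj: "inj \<phi>" and pos: "\<And>k. \<phi> k > 0" and p: "p \<ge> 1" and N: "N > 0"
  shows "bes_norm p (\<lambda>t. \<Sum>k<N. boundary (dirichlet_unit (\<phi> k)) t) \<le> real N powr (1 - 1 / (2 * p))"
proof -
  define U where "U = (\<lambda>n. \<Sum>k<N. dirichlet_unit (\<phi> k) n)"
  have U: "dirichlet_poly U" "boundary U = (\<lambda>t. \<Sum>k<N. boundary (dirichlet_unit (\<phi> k)) t)"
    using dirichlet_poly_sum[of "{..<N}" "\<lambda>k. dirichlet_unit (\<phi> k)"] dirichlet_poly_unit[OF pos]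
    unfolding U_def by auto
  note ap = almost_per_boundary[OF U(1)]
  let ?u = "\<lambda>t. norm (boundary U t)"
  \<comment> \<open>Injectivity keeps the monomials distinct; a repeated one would spoil the value
    \<open>sqrt N\<close> of the 2-norm.\<close>
  have Ueq: "U n = (if n \<in> \<phi> ` {..<N} then 1 else 0)" for n
  proof -
    have "U n = (\<Sum>k<N. if k \<in> {k. \<phi> k = n} then 1 else 0)"
      unfolding U_def dirichlet_unit_def by (intro sum.cong) auto
    also have "\<dots> = of_nat (card ({..<N} \<inter> {k. \<phi> k = n}))" by (subst sum.inter_restrict[symmetric]) auto
    also have "{..<N} \<inter> {k. \<phi> k = n} = (if n \<in> \<phi> ` {..<N} then {inv \<phi> n} else {})"
      using inj by (auto simp: inj_eq)
    finally show ?thesis by simp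
  qed
  have "(poly_norm 2 U)\<^sup>2 = (\<Sum>n\<in>\<phi> ` {..<N}. (norm (U n))\<^sup>2)"
    unfolding parseval[OF U(1)] by (intro sum.cong) (auto simp: Ueq)
  also have "\<dots> = real (card (\<phi> ` {..<N}))" by (simp add: Ueq)
  also have "\<dots> = real N" using inj by (simp add: card_image inj_on_subset)
  finally have "poly_norm 2 U = sqrt (real N)" by (metis poly_norm_nonneg real_sqrt_unique)
  then have m1: "mean (\<lambda>t. ?u t) \<le> real N powr (1 / 2)"
    using bes_norm_mono_exponent[OF ap, of 2] by (simp add: poly_norm_eq bes_norm_1[OF ap] powr_half_sqrt)
  have le: "?u t \<le> real N" for t
  proof -
    have "norm (\<Sum>k<N. boundary (dirichlet_unit (\<phi> k)) t) \<le> (\<Sum>k<N. 1)"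
      by (rule sum_norm_le) (simp add: boundary_unit pos)
    then show ?thesis by (simp add: U(2))
  qed
  have pt: "?u t powr p \<le> real N powr (p - 1) * ?u t" for t
  proof -
    have "?u t powr p = ?u t * ?u t powr (p - 1)"
      using powr_mult_base[of "?u t" "p - 1"] by simp
    also have "\<dots> \<le> ?u t * real N powr (p - 1)"
      using le[of t] p by (intro mult_left_mono powr_mono2) auto
    finally show ?thesis by (simp add: mult.commute)
  qed
  have "mean (\<lambda>t. ?u t powr p) \<le> mean (\<lambda>t. real N powr (p - 1) * ?u t)"
    by (intro mean_mono real_ap_norm_powr real_ap_cmult real_ap_norm ap pt) (use p in auto)
  also have "\<dots> = real N powr (p - 1) * mean (\<lambda>t. ?u t)"
    by (intro mean_cmult_real real_ap_norm ap)
  also have "\<dots> \<le> real N powr (p - 1) * real N powr (1 / 2)"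
    by (intro mult_left_mono m1) auto
  also have "\<dots> = (real N powr (1 - 1 / (2 * p))) powr p"
    using p by (simp add: powr_powr algebra_simps flip: powr_add)
  finally show ?thesis unfolding U(2)[symmetric] by (intro bes_norm_leI ap) (use p in auto)
qed

text \<open>The approximants of \<open>D\<close> are asked to converge only after multiplication by
  each polynomial. In this form the lemma covers (a) as well as (b), where truncations are
  controlled in H^2 and their products with \<open>f\<close> in H^1.\<close>

lemma op_norm_minus_compact_ge:
  assumes K: "compact_operator p q K" and p: "p \<ge> 1" and q: "q \<ge> 1"
    and P: "\<And>f. dirichlet_poly f \<Longrightarrow> hardy_approx q (\<lambda>k. dirichlet_mult (P k) f) (dirichlet_mult D f)"
    and dP: "\<And>k. dirichlet_poly (P k)"
    and f: "dirichlet_poly f" "poly_norm p f \<le> 1"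
  shows "ereal (hardy_norm q (dirichlet_mult D f)) \<le> op_norm p q (\<lambda>f n. dirichlet_mult D f n - K f n)"
proof -
  \<comment> \<open>The shift starts at \<open>Suc k\<close> because index 0 carries no Dirichlet
    monomial.\<close>
  define F where "F k = dirichlet_mult (dirichlet_unit (Suc k)) f" for k
  have dF: "dirichlet_poly (F k)" for k unfolding F_def by (intro dirichlet_poly_mult dirichlet_poly_unit f) auto
  have nF: "poly_norm p (F k) = poly_norm p f" for k unfolding F_def by (intro poly_norm_unit_mult f) auto
  have bF: "boundary (F k) = (\<lambda>t. boundary (dirichlet_unit (Suc k)) t * boundary f t)" for k
    unfolding F_def by (intro boundary_mult dirichlet_poly_unit f) auto
  have hF: "F k \<in> hardy p" for k by (rule hardy_poly[OF dF])
  have Kh: "K g \<in> hardy q" if "g \<in> hardy p" for g using K that unfolding compact_operator_def by auto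
  have Kc: "K (\<lambda>n. c * g n) = (\<lambda>n. c * K g n)" if "g \<in> hardy p" for c g
    using K that unfolding compact_operator_def by blast
  have Kcomp: "\<exists>g\<in>hardy q. \<exists>\<phi>::nat \<Rightarrow> nat. strict_mono \<phi> \<and> (\<lambda>k. hardy_norm q (\<lambda>n. K (F (\<phi> k)) n - g n)) \<longlonglongrightarrow> 0"
    if "\<And>k. F k \<in> hardy p" "\<And>k. hardy_norm p (F k) \<le> B" for F B
  proof -
    have "bounded (range (\<lambda>k. hardy_norm p (F k)))"
      unfolding bounded_iff using that(2) hardy_norm_nonneg[OF that(1) p] by (intro exI[of _ B]) auto
    then show ?thesis using K that(1) unfolding compact_operator_def by blast
  qed
  obtain g \<phi> where g: "g \<in> hardy q" and \<phi>: "strict_mono \<phi>"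
    and lim: "(\<lambda>k. hardy_norm q (\<lambda>n. K (F (\<phi> k)) n - g n)) \<longlonglongrightarrow> 0"
    using Kcomp[of F 1] hF nF f(2) hardy_norm_poly[OF dF p] by auto
  obtain B where B: "B > 0" "\<And>t. norm (boundary f t) \<le> B"
    using almost_per_bounded[OF almost_per_boundary[OF f(1)]] by blast
  \<comment> \<open>Sums of \<open>N\<close> shifts have norm o(N) in H^p, while \<open>K\<close>
    maps them to within \<open>N * e\<close> of \<open>N * g\<close>. Given control of
    \<open>K\<close> on these sums, dividing by \<open>N\<close> leaves \<open>g\<close> of norm at
    most \<open>e\<close>.\<close>
  have g0: "hardy_norm q g \<le> e" if e: "e > 0" for e
  proof -
    obtain N0 where N0: "\<And>k. k \<ge> N0 \<Longrightarrow> hardy_norm q (\<lambda>n. K (F (\<phi> k)) n - g n) < e"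
      using LIMSEQ_D[OF lim e] by (metis abs_less_iff diff_zero real_norm_def)
    \<comment> \<open>Discarding the first \<open>N0\<close> terms puts every
      \<open>K (F (\<theta> k))\<close> within \<open>e\<close> of \<open>g\<close>, so the errors
      can be summed without exceptions.\<close>
    define \<theta> where "\<theta> k = \<phi> (k + N0)" for k
    have inj: "inj (\<lambda>k. Suc (\<theta> k))"
      unfolding \<theta>_def using strict_mono_eq[OF \<phi>] by (auto simp: inj_def)
    define S where "S N = (\<lambda>n. \<Sum>k<N. F (\<theta> k) n)" for N
    have S: "dirichlet_poly (S N)" "boundary (S N) = (\<lambda>t. boundary f t * (\<Sum>k<N. boundary (dirichlet_unit (Suc (\<theta> k))) t))" for N
      using dirichlet_poly_sum[of "{..<N}" "\<lambda>k. F (\<theta> k)"] dF unfolding S_def bF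
      by (auto simp: sum_distrib_left mult.commute)
    have hS: "S N \<in> hardy p" for N by (rule hardy_poly[OF S(1)])
    have nS: "poly_norm p (S N) \<le> B * real N powr (1 - 1 / (2 * p))" if "N > 0" for N
    proof -
      have "poly_norm p (S N) \<le> B * bes_norm p (\<lambda>t. \<Sum>k<N. boundary (dirichlet_unit (Suc (\<theta> k))) t)"
        unfolding poly_norm_eq S
      proof (intro bes_norm_mult_bound almost_per_boundary f B(2))
        show "almost_per (\<lambda>t. \<Sum>k<N. boundary (dirichlet_unit (Suc (\<theta> k))) t)"
          by (intro almost_per_rat_trig rat_trig_sum rat_trig_boundary dirichlet_poly_unit) auto
      qed (use p in auto)
      also have "\<dots> \<le> B * real N powr (1 - 1 / (2 * p))"
        using B that by (intro mult_left_mono poly_norm_sum_units inj p) auto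
      finally show ?thesis .
    qed
    \<comment> \<open>The reciprocal of the growth rate from \<open>poly_norm_sum_units\<close>, so
      that the normalised sums \<open>G N\<close> stay bounded by \<open>B\<close>.\<close>
    define c where "c N = real (Suc N) powr (1 / (2 * p) - 1)" for N
  let ?r = "\<lambda>N. real (Suc N) powr (- (1 / (2 * p)))"
    have c0: "c N > 0" for N by (simp add: c_def)
    define G where "G N = (\<lambda>n. of_real (c N) * S (Suc N) n)" for N
    have hG: "G N \<in> hardy p" for N unfolding G_def by (intro hardy_cmult hS p)
    have "hardy_norm p (G N) \<le> B" for N
    proof -
      have "hardy_norm p (G N) = c N * poly_norm p (S (Suc N))"
        unfolding G_def hardy_norm_cmult[OF hS p] hardy_norm_poly[OF S(1) p] using c0[of N] by simp
      also have "\<dots> \<le> c N * (B * real (Suc N) powr (1 - 1 / (2 * p)))"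
        using c0[of N] by (intro mult_left_mono nS) auto
      also have "\<dots> = B * real (Suc N) powr (1 / (2 * p) - 1 + (1 - 1 / (2 * p)))"
        unfolding c_def powr_add by (simp only: mult_ac)
      also have "\<dots> = B" by simp
      finally show ?thesis .
    qed
    \<comment> \<open>The second use of compactness: along \<open>\<psi>\<close> the norms of
      \<open>K (G N)\<close> stay bounded, which replaces an operator bound for
      \<open>K\<close>.\<close>
    then obtain g' \<psi> where g': "g' \<in> hardy q" and \<psi>: "strict_mono \<psi>"
      and lim': "(\<lambda>k. hardy_norm q (\<lambda>n. K (G (\<psi> k)) n - g' n)) \<longlonglongrightarrow> 0"
      using Kcomp[of G B] hG by auto
  let ?k = "\<lambda>j. hardy_norm q (\<lambda>n. K (G (\<psi> j)) n - g' n)"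
    have KG: "hardy_norm q (K (G N)) = c N * hardy_norm q (K (S (Suc N)))" for N
      unfolding G_def Kc[OF hS] hardy_norm_cmult[OF Kh[OF hS] q] using c0[of N] by simp
    have gN: "real (Suc N) * hardy_norm q g \<le> real (Suc N) * e + hardy_norm q (K (S (Suc N)))" for N
    proof -
      have KS: "K (S N) = (\<lambda>n. \<Sum>k<N. K (F (\<theta> k)) n)" for N
        using compact_operator_sum[OF K p, of "\<lambda>k. F (\<theta> k)" N] hF unfolding S_def by blast
      have ind: "(\<lambda>n. K (S N) n - of_nat N * g n) \<in> hardy q \<and> hardy_norm q (\<lambda>n. K (S N) n - of_nat N * g n) \<le> real N * e" for N
      proof (induction N)
        case 0
        have "hardy_norm q (\<lambda>n. 0 * g n) = 0" unfolding hardy_norm_cmult[OF g q] by simp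
        then show ?case unfolding KS by (simp add: hardy_poly[OF dirichlet_poly_0])
      next
        case (Suc N)
        have eq: "(\<lambda>n. K (S (Suc N)) n - of_nat (Suc N) * g n) =
          (\<lambda>n. (K (S N) n - of_nat N * g n) + (K (F (\<theta> N)) n - g n))"
          unfolding KS by (simp add: algebra_simps)
        have h: "(\<lambda>n. K (F (\<theta> N)) n - g n) \<in> hardy q" by (intro hardy_diff Kh hF g q)
        have "hardy_norm q (\<lambda>n. K (F (\<theta> N)) n - g n) \<le> e" using N0[of "N + N0"] by (simp add: \<theta>_def less_imp_le)
        then show ?case unfolding eq using Suc hardy_add[OF conjunct1[OF Suc] h q]
            hardy_norm_triangle[OF conjunct1[OF Suc] h q] by (simp add: algebra_simps)
      qed
      let ?M = "Suc N"
      have "real ?M * hardy_norm q g = hardy_norm q (\<lambda>n. of_nat ?M * g n)"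
        unfolding hardy_norm_cmult[OF g q] by (simp del: of_nat_Suc)
      also have "\<dots> \<le> hardy_norm q (\<lambda>n. of_nat ?M * g n - K (S ?M) n) + hardy_norm q (K (S ?M))"
        by (intro hardy_norm_triangle_diff hardy_cmult Kh hS g q)
      also have "hardy_norm q (\<lambda>n. of_nat ?M * g n - K (S ?M) n) = hardy_norm q (\<lambda>n. K (S ?M) n - of_nat ?M * g n)"
        by (intro hardy_norm_minus_commute hardy_cmult Kh hS g q)
      finally show ?thesis using ind[of ?M] by linarith
    qed
    have main: "hardy_norm q g \<le> e + hardy_norm q (K (G N)) * ?r N" for N
    proof -
      \<comment> \<open>Dividing the sum by the number of its terms instead of by its growth rate
        leaves exactly the decaying factor \<open>?r N\<close>.\<close>
      have "c N * real (Suc N) = real (Suc N) powr (1 / (2 * p))"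
        unfolding c_def using powr_mult_base[of "real (Suc N)" "1 / (2 * p) - 1"] by (simp add: mult.commute)
      then have ceq: "hardy_norm q (K (G N)) * ?r N = hardy_norm q (K (S (Suc N))) / real (Suc N)"
        unfolding KG powr_minus using c0[of N] by (simp add: field_simps flip: of_nat_Suc)
      show ?thesis unfolding ceq using gN[of N] by (simp add: field_simps del: of_nat_Suc)
    qed
    show ?thesis
    proof (rule tendsto_lowerbound)
      have l1: "(\<lambda>j. ?k j + hardy_norm q g') \<longlonglongrightarrow> 0 + hardy_norm q g'"
        by (intro tendsto_add lim' tendsto_const)
      have l2: "(\<lambda>N. ?r N) \<longlonglongrightarrow> 0"
        by (rule tendsto_neg_powr[OF _ filterlim_compose[OF filterlim_real_sequentially filterlim_Suc]]) (use p in auto)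
      have l3: "(\<lambda>j. ?r (\<psi> j)) \<longlonglongrightarrow> 0"
        by (rule filterlim_compose[OF l2 filterlim_subseq[OF \<psi>]])
      show "(\<lambda>j. e + (?k j + hardy_norm q g') * ?r (\<psi> j)) \<longlonglongrightarrow> e"
        using tendsto_add[OF tendsto_const[of e] tendsto_mult[OF l1 l3]] by simp
      show "\<forall>\<^sub>F j in sequentially. hardy_norm q g \<le> e + (?k j + hardy_norm q g') * ?r (\<psi> j)"
      proof (intro always_eventually allI)
        fix j
        show "hardy_norm q g \<le> e + (?k j + hardy_norm q g') * ?r (\<psi> j)"
          using main[of "\<psi> j"] mult_right_mono[OF hardy_norm_triangle_diff[OF Kh[OF hG[of "\<psi> j"]] g' q], of "?r (\<psi> j)"]
            powr_ge_zero[of "real (Suc (\<psi> j))" "- (1 / (2 * p))"]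
          by linarith
      qed
    qed simp
  qed
  have gz: "hardy_norm q g = 0"
    using field_le_epsilon[of "hardy_norm q g" 0] g0 hardy_norm_nonneg[OF g q] by force
  \<comment> \<open>The shift factor has modulus 1 on the axis. The equality of norms is checked for
    the polynomials \<open>P j\<close> and passes to the limit.\<close>
  have DF: "dirichlet_mult D (F k) \<in> hardy q \<and> hardy_norm q (dirichlet_mult D (F k)) = hardy_norm q (dirichlet_mult D f)" for k
  proof -
    have "poly_norm q (dirichlet_mult (P j) (F k)) = poly_norm q (dirichlet_mult (P j) f)" for j
      unfolding poly_norm_eq boundary_mult[OF dP dF] boundary_mult[OF dP f(1)] bF
      by (rule bes_norm_cong) (simp add: norm_mult boundary_unit)
    then have "(\<lambda>j. poly_norm q (dirichlet_mult (P j) f)) \<longlonglongrightarrow> hardy_norm q (dirichlet_mult D (F k))"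
      using hardy_norm_tendsto[OF P[OF dF[of k]] q] by simp
    from LIMSEQ_unique[OF this hardy_norm_tendsto[OF P[OF f(1)] q]] show ?thesis
      using hardyI[OF P[OF dF[of k]]] by simp
  qed
  let ?O = "op_norm p q (\<lambda>f n. dirichlet_mult D f n - K f n)"
  have "ereal (hardy_norm q (dirichlet_mult D f) - hardy_norm q (\<lambda>n. K (F (\<phi> k)) n - g n)) \<le> ?O" for k
  proof -
    let ?h = "F (\<phi> k)"
    have D: "dirichlet_mult D ?h \<in> hardy q" using DF by blast
    have "hardy_norm q (dirichlet_mult D f) \<le> hardy_norm q (\<lambda>n. dirichlet_mult D ?h n - K ?h n) + hardy_norm q (K ?h)"
      using hardy_norm_triangle_diff[OF D Kh[OF hF] q] DF by simp
    moreover have "hardy_norm q (K ?h) \<le> hardy_norm q (\<lambda>n. K ?h n - g n)"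
      using hardy_norm_triangle_diff[OF Kh[OF hF] g q] gz by simp
    ultimately have "ereal (hardy_norm q (dirichlet_mult D f) - hardy_norm q (\<lambda>n. K ?h n - g n)) \<le> ereal (hardy_norm q (\<lambda>n. dirichlet_mult D ?h n - K ?h n))"
      by simp
    also have "\<dots> \<le> ?O"
      unfolding op_norm_def using nF f(2) hardy_norm_poly[OF dF p] hF
      by (intro SUP_upper2[of ?h]) auto
    finally show ?thesis .
  qed
  moreover have "(\<lambda>k. ereal (hardy_norm q (dirichlet_mult D f) - hardy_norm q (\<lambda>n. K (F (\<phi> k)) n - g n))) \<longlonglongrightarrow> ereal (hardy_norm q (dirichlet_mult D f))"
    using tendsto_diff[OF tendsto_const lim] by (simp add: tendsto_ereal)
  ultimately show ?thesis by (metis (no_types, lifting) LIMSEQ_le_const2)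
qed

text \<open>Whatever compact \<open>K\<close> is subtracted, a finite operator norm of the
  difference is already a multiplier bound for \<open>D\<close> on polynomials. Only the implication
  from such a bound to \<open>x \<le> c\<close> then differs between (a) and (b).\<close>

lemma essential_norm_ge:
  assumes p: "p \<ge> 1" and q: "q \<ge> 1"
    and P: "\<And>f. dirichlet_poly f \<Longrightarrow> hardy_approx q (\<lambda>k. dirichlet_mult (P k) f) (dirichlet_mult D f)"
    and dP: "\<And>k. dirichlet_poly (P k)"
    and lower: "\<And>c. c \<ge> 0 \<Longrightarrow> (\<And>f. dirichlet_poly f \<Longrightarrow> hardy_norm q (dirichlet_mult D f) \<le> c * poly_norm p f) \<Longrightarrow> x \<le> c"
  shows "ereal x \<le> essential_norm p q (dirichlet_mult D)"
  unfolding essential_norm_def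
proof (rule INF_greatest)
  fix K assume "K \<in> {K. compact_operator p q K}"
  then have K: "compact_operator p q K" by simp
  let ?O = "op_norm p q (\<lambda>f n. dirichlet_mult D f n - K f n)"
  note ge = op_norm_minus_compact_ge[OF K p q P dP]
  have h: "dirichlet_mult D f \<in> hardy q" if "dirichlet_poly f" for f by (rule hardyI[OF P[OF that]])
  have z: "poly_norm p (\<lambda>n. 0) = 0" using poly_norm_cmult[OF dirichlet_poly_0 p, of 0] by simp
  \<comment> \<open>Testing with the zero polynomial excludes the value minus infinity and makes a
    finite value an admissible \<open>c\<close>.\<close>
  have "0 \<le> ereal (hardy_norm q (dirichlet_mult D (\<lambda>n. 0)))"
    using hardy_norm_nonneg[OF h[OF dirichlet_poly_0] q] by simp
  also have "\<dots> \<le> ?O" by (rule ge[OF _ dirichlet_poly_0]) (simp_all add: z)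
  finally have O0: "0 \<le> ?O" .
  show "ereal x \<le> ?O"
  proof (cases ?O)
    case (real c)
    have "x \<le> c"
    proof (rule lower)
      show c: "c \<ge> 0" using O0 real by simp
      fix f assume f: "dirichlet_poly f"
      \<comment> \<open>Scaling by a number strictly above the norm avoids division by a vanishing
        norm.\<close>
      have s: "hardy_norm q (dirichlet_mult D f) \<le> c * s" if s: "s > poly_norm p f" for s
      proof -
        have s0: "s > 0" using s poly_norm_nonneg[of p f] by linarith
        have f': "dirichlet_poly (\<lambda>n. of_real (1 / s) * f n)" by (rule dirichlet_poly_cmult[OF f])
        have "poly_norm p (\<lambda>n. of_real (1 / s) * f n) \<le> 1"
          unfolding poly_norm_cmult[OF f p] using s s0 by (simp add: norm_divide)
        then have "ereal (hardy_norm q (dirichlet_mult D (\<lambda>n. of_real (1 / s) * f n))) \<le> ereal c"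
          using ge[OF _ f'] real by simp
        then have "hardy_norm q (\<lambda>n. of_real (1 / s) * dirichlet_mult D f n) \<le> c"
          by (simp only: dirichlet_mult_cmult_right ereal_less_eq)
        then show ?thesis unfolding hardy_norm_cmult[OF h[OF f] q] using s0 by (simp add: norm_divide field_simps)
      qed
      show "hardy_norm q (dirichlet_mult D f) \<le> c * poly_norm p f"
      proof (rule tendsto_lowerbound)
        show "((\<lambda>e. c * (poly_norm p f + e)) \<longlongrightarrow> c * poly_norm p f) (at_right 0)"
          by (auto intro!: tendsto_eq_intros)
        show "\<forall>\<^sub>F e in at_right 0. hardy_norm q (dirichlet_mult D f) \<le> c * (poly_norm p f + e)"
          by (auto simp: eventually_at_filter intro!: always_eventually s)
      qed simp
    qed
    then show ?thesis using real by simp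
  qed (use O0 in auto)
qed

subsection \<open>Multiplication from \<open>H\<^sup>p\<close> to \<open>H\<^sup>q\<close> with \<open>q < p\<close>\<close>

lemma rat_trig_clear_denominators:
  assumes "rat_trig g"
  obtains L a where "L > 0" "dirichlet_poly a" "boundary a = (\<lambda>t. cis (t * ln (real L)) * g t)"
proof -
  have "\<exists>L a. L > 0 \<and> dirichlet_poly a \<and> boundary a = (\<lambda>t. cis (t * ln (real L)) * g t)"
    using assms
  proof induction
    case (monomial m n c)
    have "boundary (\<lambda>k. c * dirichlet_unit m k) t = cis (t * ln (real n)) * (c * cis (t * (ln (real m) - ln (real n))))" for t
    proof -
      have "cis (t * ln (real n)) * cis (t * (ln (real m) - ln (real n))) = cis (t * ln (real m))"
        by (simp add: cis_mult algebra_simps)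
      then show ?thesis unfolding boundary_cmult[OF dirichlet_poly_unit[OF monomial(1)]] boundary_unit[OF monomial(1)]
        by (metis mult.left_commute)
    qed
    then show ?case using monomial dirichlet_poly_cmult[OF dirichlet_poly_unit] by blast
  next
    case (add f g)
    then obtain L a M b where L: "L > 0" "dirichlet_poly a" "boundary a = (\<lambda>t. cis (t * ln (real L)) * f t)"
      and M: "M > 0" "dirichlet_poly b" "boundary b = (\<lambda>t. cis (t * ln (real M)) * g t)" by blast
    \<comment> \<open>Each summand is multiplied by the other's denominator, so that
      \<open>L * M\<close> clears both.\<close>
    let ?a = "dirichlet_mult (dirichlet_unit M) a" and ?b = "dirichlet_mult (dirichlet_unit L) b"
    have d: "dirichlet_poly ?a" "dirichlet_poly ?b"
      by (intro dirichlet_poly_mult dirichlet_poly_unit L M)+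
    have e: "cis (t * ln (real (L * M))) = cis (t * ln (real L)) * cis (t * ln (real M))" for t
      using L M by (simp add: cis_mult ln_mult algebra_simps)
    have "boundary (\<lambda>n. ?a n + ?b n) = (\<lambda>t. cis (t * ln (real (L * M))) * (f t + g t))"
      unfolding boundary_add[OF d] boundary_mult[OF dirichlet_poly_unit[OF M(1)] L(2)]
        boundary_mult[OF dirichlet_poly_unit[OF L(1)] M(2)] boundary_unit[OF L(1)] boundary_unit[OF M(1)] L(3) M(3) e
      by (simp add: algebra_simps)
    then show ?case using dirichlet_poly_add[OF d] L(1) M(1) nat_0_less_mult_iff by blast
  qed
  then show thesis using that by blast
qed

text \<open>The multiplier bound is tested on approximations of \<open>|P|\<^bsup>r/p\<^esup>\<close>, the extremal case of Hoelder's
  inequality; it is analytic after multiplication by a unimodular monomial.\<close>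

lemma poly_norm_le_multiplier_bound:
  assumes P: "dirichlet_poly P" and c: "c \<ge> 0" and q: "1 \<le> q" "q < p" and r: "r = p * q / (p - q)"
    and bound: "\<And>f. dirichlet_poly f \<Longrightarrow> poly_norm q (dirichlet_mult P f) \<le> c * poly_norm p f"
  shows "poly_norm r P \<le> c"
proof (cases "poly_norm r P = 0")
  case False
  define n where "n = poly_norm r P"
  have n: "n > 0" using False poly_norm_nonneg[of r P] unfolding n_def by linarith
  have pos: "p > 0" "q > 0" "r > 0" using q by (auto simp: r)
  have rq: "r / q = p / (p - q)" "r / p = q / (p - q)" using pos by (auto simp: r)
  \<comment> \<open>The first identity makes \<open>norm (f * g0) powr q\<close> equal to
    \<open>norm f powr r\<close> for \<open>g0 = norm f powr (r / p)\<close>; the second leaves the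
    norm itself to the first power after the final division.\<close>
  have expo: "q + q * (r / p) = r" "r / q - r / p = 1"
    unfolding rq using q by (simp add: r field_simps, simp flip: diff_divide_distrib)
  define f where "f = boundary P"
  have ratf: "rat_trig f" and apf: "almost_per f" unfolding f_def using P by (auto intro: rat_trig_boundary almost_per_boundary)
  define g0 where "g0 t = norm (f t) powr (r / p)" for t
  have apg0: "real_ap g0" unfolding g0_def using pos by (intro real_ap_norm_powr apf) auto
  have nr: "mean (\<lambda>t. norm (f t) powr r) = n powr r"
    using bes_norm_powr[OF apf pos(3)] by (simp add: n_def poly_norm_eq f_def)
  have n1: "bes_norm p (\<lambda>t. of_real (g0 t)) = n powr (r / p)"
    using pos by (simp add: bes_norm_def g0_def powr_powr nr)
  have "norm (f t * of_real (g0 t)) powr q = norm (f t) powr r" for t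
  proof (cases "f t = 0")
    case False
    then have "norm (f t * of_real (g0 t)) powr q = norm (f t) powr (q + q * (r / p))"
      by (simp add: norm_mult g0_def powr_mult powr_powr powr_add mult.commute)
    then show ?thesis by (simp only: expo)
  qed simp
  then have n2: "bes_norm q (\<lambda>t. f t * of_real (g0 t)) = n powr (r / q)"
    by (simp add: bes_norm_def nr powr_powr)
  have le: "n powr (r / q) \<le> c * n powr (r / p) + e * (c + bes_norm q f)" if e: "e > 0" for e
  proof -
    \<comment> \<open>The exponent is halved because the approximation is in the variable
      \<open>(norm (f t))\<^sup>2\<close>.\<close>
    have "continuous_on {0..} (\<lambda>x. x powr (r / (2 * p)))" using pos by (auto intro!: continuous_on_powr')
    then obtain g where g: "rat_trig (\<lambda>t. of_real (g t))" "\<And>t. \<bar>((norm (f t))\<^sup>2) powr (r / (2 * p)) - g t\<bar> < e"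
      using rat_trig_approx_norm_sq[OF ratf _ e] by metis
    have "((norm (f t))\<^sup>2) powr (r / (2 * p)) = g0 t" for t
      by (cases "f t = 0") (simp_all add: g0_def powr_powr flip: powr_numeral)
    then have near: "\<bar>g0 t - g t\<bar> \<le> e" for t using g(2)[of t] by simp
  let ?d = "\<lambda>t. (of_real (g0 t) - of_real (g t))"
    have apg: "real_ap g" by (rule almost_per_rat_trig[OF g(1)])
    have apd: "almost_per (\<lambda>t. of_real (g0 t) - of_real (g t))" by (intro almost_per_diff apg apg0)
    have nd: "norm (complex_of_real (g0 t) - of_real (g t)) \<le> e" for t
      using near[of t] by (simp flip: of_real_diff)
    obtain L a where a: "L > 0" "dirichlet_poly a" "boundary a = (\<lambda>t. cis (t * ln (real L)) * of_real (g t))"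
      using rat_trig_clear_denominators[OF g(1)] by metis
    have "bes_norm p (\<lambda>t. of_real (g t)) \<le> bes_norm p (\<lambda>t. of_real (g0 t)) + bes_norm p (\<lambda>t. -1 * ?d t)"
      using bes_norm_triangle[OF apg0 almost_per_cmult[OF apd, of "-1"], of p] q by simp
    also have "bes_norm p (\<lambda>t. -1 * ?d t) \<le> e"
      by (intro bes_norm_le_bound almost_per_cmult apd pos) (use nd in \<open>auto simp: norm_mult norm_minus_commute\<close>)
    finally have gp: "bes_norm p (\<lambda>t. of_real (g t)) \<le> n powr (r / p) + e" by (simp add: n1)
    have "bes_norm q (\<lambda>t. f t * of_real (g t)) = poly_norm q (dirichlet_mult P a)"
      unfolding poly_norm_eq boundary_mult[OF P a(2)] a(3) f_def by (rule bes_norm_cong) (simp add: norm_mult)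
    also have "\<dots> \<le> c * poly_norm p a" by (rule bound[OF a(2)])
    also have "poly_norm p a = bes_norm p (\<lambda>t. of_real (g t))"
      unfolding poly_norm_eq a(3) by (rule bes_norm_cong) (simp add: norm_mult)
    also have "c * \<dots> \<le> c * (n powr (r / p) + e)" by (rule mult_left_mono[OF gp c])
    finally have gq: "bes_norm q (\<lambda>t. f t * of_real (g t)) \<le> c * (n powr (r / p) + e)" .
    have "n powr (r / q) = bes_norm q (\<lambda>t. f t * of_real (g t) + ?d t * f t)"
      unfolding n2[symmetric] by (simp add: algebra_simps)
    also have "\<dots> \<le> bes_norm q (\<lambda>t. f t * of_real (g t)) + bes_norm q (\<lambda>t. ?d t * f t)"
      by (intro bes_norm_triangle almost_per_mult apf apg apd q)
    also have "bes_norm q (\<lambda>t. ?d t * f t) \<le> e * bes_norm q f"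
      by (intro bes_norm_mult_bound apf apd pos nd)
    finally show ?thesis using gq by (simp add: algebra_simps)
  qed
  have "n powr (r / q) \<le> c * n powr (r / p)"
  proof (rule tendsto_lowerbound)
    show "((\<lambda>e. c * n powr (r / p) + e * (c + bes_norm q f)) \<longlongrightarrow> c * n powr (r / p)) (at_right 0)"
      by (auto intro!: tendsto_eq_intros)
    show "\<forall>\<^sub>F e in at_right 0. n powr (r / q) \<le> c * n powr (r / p) + e * (c + bes_norm q f)"
      by (auto simp: eventually_at_filter intro!: always_eventually le)
  qed simp
  then have "n powr (r / q) / n powr (r / p) \<le> c" using n by (simp add: field_simps)
  then show ?thesis using n expo(2) by (simp add: n_def flip: powr_diff)
qed (use c in simp)

lemma multiplier_exponents:
  fixes p q r :: real
  assumes q: "1 \<le> q" "q < p" and r: "r = p * q / (p - q)"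
  shows "p \<ge> 1" "r \<ge> 1" "1 / q = 1 / r + 1 / p"
proof -
  have "q * (p - q) \<le> q * p" using q by (intro mult_left_mono) auto
  then have "q \<le> r" using q unfolding r by (simp add: pos_le_divide_eq mult.commute)
  then show "p \<ge> 1" "r \<ge> 1" using q by auto
  show "1 / q = 1 / r + 1 / p" using q unfolding r by (simp add: field_simps)
qed

text \<open>A polynomial within \<open>e / 2\<close> of \<open>D\<close> has its multiplier norm
  raised by at most \<open>e / 2\<close>, by Hoelder; passing back from its norm to that of
  \<open>D\<close> costs the second \<open>e / 2\<close>.\<close>

lemma hardy_norm_le_multiplier_bound:
  assumes D: "D \<in> hardy r" and c: "c \<ge> 0" and q: "1 \<le> q" "q < p" and r: "r = p * q / (p - q)"
    and bound: "\<And>f. dirichlet_poly f \<Longrightarrow> hardy_norm q (dirichlet_mult D f) \<le> c * poly_norm p f"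
  shows "hardy_norm r D \<le> c"
proof (rule field_le_epsilon)
  fix e :: real assume e: "e > 0"
  note pqr = multiplier_exponents(1,2)[OF q r] and eq = multiplier_exponents(3)[OF q r]
  obtain P where P: "dirichlet_poly P" "hardy_norm r (\<lambda>n. D n - P n) < e / 2"
    using hardy_dense[OF D pqr(2), of "e/2"] e by auto
  have Ph: "P \<in> hardy r" by (rule hardy_poly[OF P(1)])
  have dif: "hardy_norm r (\<lambda>n. P n - D n) < e / 2" using hardy_norm_minus_commute[OF D Ph pqr(2)] P(2) by simp
  have "poly_norm r P \<le> c + e / 2"
  proof (rule poly_norm_le_multiplier_bound[OF P(1) _ q r])
    fix f assume f: "dirichlet_poly f"
    have fh: "f \<in> hardy p" by (rule hardy_poly[OF f])
    note h1 = hardy_mult[OF hardy_diff[OF Ph D pqr(2)] fh pqr(1) q(1) pqr(2) eq]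
    note h2 = hardy_mult[OF D fh pqr(1) q(1) pqr(2) eq]
    have split: "dirichlet_mult P f = (\<lambda>n. dirichlet_mult (\<lambda>n. P n - D n) f n + dirichlet_mult D f n)"
      by (simp add: dirichlet_mult_diff_left)
    have "poly_norm q (dirichlet_mult P f) = hardy_norm q (dirichlet_mult P f)"
      by (intro hardy_norm_poly[symmetric] dirichlet_poly_mult P f q)
    also have "\<dots> = hardy_norm q (\<lambda>n. dirichlet_mult (\<lambda>n. P n - D n) f n + dirichlet_mult D f n)"
      using split by (rule arg_cong)
    also have "\<dots> \<le> hardy_norm q (dirichlet_mult (\<lambda>n. P n - D n) f) + hardy_norm q (dirichlet_mult D f)"
      by (intro hardy_norm_triangle h1 h2 q)
    also have "hardy_norm q (dirichlet_mult (\<lambda>n. P n - D n) f) \<le> hardy_norm r (\<lambda>n. P n - D n) * hardy_norm p f"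
      by (rule h1)
    also have "\<dots> \<le> e / 2 * poly_norm p f"
      unfolding hardy_norm_poly[OF f pqr(1)] using dif by (intro mult_right_mono) auto
    finally show "poly_norm q (dirichlet_mult P f) \<le> (c + e / 2) * poly_norm p f"
      using bound[OF f] by (simp add: algebra_simps)
  qed (use c e in auto)
  then show "hardy_norm r D \<le> c + e"
    using hardy_norm_triangle_diff[OF D Ph pqr(2)] P(2) hardy_norm_poly[OF P(1) pqr(2)] by linarith
qed

theorem essential_norm_mult_less:
  assumes q: "1 \<le> q" "q < p" and r: "r = p * q / (p - q)" and D: "D \<in> hardy r"
  shows "dirichlet_mult D \<in> hardy p \<rightarrow> hardy q" "essential_norm p q (dirichlet_mult D) = ereal (hardy_norm r D)"
proof -
  note pqr = multiplier_exponents(1,2)[OF q r] and eq = multiplier_exponents(3)[OF q r]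
  note h = hardy_mult[OF D _ pqr(1) q(1) pqr(2) eq]
  show "dirichlet_mult D \<in> hardy p \<rightarrow> hardy q" using h(1) by auto
  obtain P where P: "hardy_approx r P D" using D by (rule hardyE)
  show "essential_norm p q (dirichlet_mult D) = ereal (hardy_norm r D)"
  proof (rule antisym)
    show "essential_norm p q (dirichlet_mult D) \<le> ereal (hardy_norm r D)"
      by (intro essential_norm_le h hardy_norm_nonneg D pqr q)
    show "ereal (hardy_norm r D) \<le> essential_norm p q (dirichlet_mult D)"
    proof (rule essential_norm_ge[OF pqr(1) q(1)])
      show "hardy_approx q (\<lambda>k. dirichlet_mult (P k) f) (dirichlet_mult D f)" if "dirichlet_poly f" for f
        by (rule hardy_approx_mult[OF P hardy_approx_const[OF that] pqr(1) q(1) pqr(2) eq])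
      show "dirichlet_poly (P k)" for k by (rule hardy_approxD(1)[OF P])
    qed (rule hardy_norm_le_multiplier_bound[OF D _ q r])
  qed
qed

subsection \<open>Bounded Dirichlet series\<close>

definition truncate :: "nat \<Rightarrow> (nat \<Rightarrow> complex) \<Rightarrow> nat \<Rightarrow> complex" where
  "truncate N a = (\<lambda>n. if n < N then a n else 0)"

lemma dirichlet_poly_truncate: "a 0 = 0 \<Longrightarrow> dirichlet_poly (truncate N a)"
  by (rule dirichlet_polyI[of _ "{..<N}"]) (auto simp: truncate_def split: if_splits)

lemma norm_of_nat_powr: "norm (of_nat n powr s) = real n powr Re s"
  by (rule norm_powr_real_powr[of "of_nat n", simplified])

lemma hardy_infD:
  assumes "D \<in> hardy_inf"
  shows "D 0 = 0" "Re s > 0 \<Longrightarrow> summable (\<lambda>n. D n * of_nat n powr (- s))"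
    "dirichlet_eval D holomorphic_on {s. Re s > 0}"
    "Re s > 0 \<Longrightarrow> norm (dirichlet_eval D s) \<le> hardy_inf_norm D"
proof -
  show "D 0 = 0" "Re s > 0 \<Longrightarrow> summable (\<lambda>n. D n * of_nat n powr (- s))"
    "dirichlet_eval D holomorphic_on {s. Re s > 0}"
    using assms by (auto simp: hardy_inf_def)
  obtain b where b: "\<And>s. Re s > 0 \<Longrightarrow> norm (dirichlet_eval D s) \<le> b"
    using assms by (auto simp: hardy_inf_def bounded_iff)
  show "norm (dirichlet_eval D s) \<le> hardy_inf_norm D" if "Re s > 0"
    unfolding hardy_inf_norm_def using that b
    by (intro cSUP_upper bdd_aboveI[of _ b]) auto
qed

lemma hardy_inf_norm_nonneg: "D \<in> hardy_inf \<Longrightarrow> hardy_inf_norm D \<ge> 0"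
  using order_trans[OF norm_ge_zero hardy_infD(4)[of D 1]] by simp

text \<open>Convergence at s = 1/2 forces coefficients of order at most n^(1/2), hence a majorant of
  order n^(-3/2) at s = 2. The line Re s = 2 is the starting line for all computations with
  absolutely convergent series.\<close>

lemma hardy_inf_summable_2:
  assumes D: "D \<in> hardy_inf"
  shows "summable (\<lambda>n. norm (D n) * real n powr - 2)"
proof -
  have "(\<lambda>n. D n * of_nat n powr (- (1 / 2))) \<longlonglongrightarrow> 0"
    using summable_LIMSEQ_zero[OF hardy_infD(2)[OF D, of "1/2"]] by simp
  then have "Bseq (\<lambda>n. D n * of_nat n powr (- (1 / 2)))"
    by (intro convergent_imp_Bseq) (auto simp: convergent_def)
  then obtain C where C: "C > 0" "\<And>n. norm (D n * of_nat n powr (- (1 / 2))) \<le> C" by (auto elim: BseqE)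
  have le: "norm (D n) * real n powr - 2 \<le> C * real n powr (- (3 / 2))" for n
  proof -
    have "norm (D n) * real n powr - 2 = (norm (D n) * real n powr (- (1/2))) * real n powr (- (3 / 2))"
      by (simp flip: powr_add)
    also have "\<dots> \<le> C * real n powr (- (3 / 2))"
      using C(2)[of n] by (intro mult_right_mono) (auto simp: norm_mult norm_of_nat_powr)
    finally show ?thesis .
  qed
  show ?thesis
  proof (rule summable_comparison_test)
    show "\<exists>N. \<forall>n\<ge>N. norm (norm (D n) * real n powr - 2) \<le> C * real n powr (- (3 / 2))"
      using le by (auto intro!: exI[of _ 0])
    show "summable (\<lambda>n. C * real n powr (- (3 / 2)))"
      using summable_real_powr_iff[of "- (3/2)"] by (intro summable_mult) simp
  qed
qed

text \<open>Averages of a bounded holomorphic function over vertical lines do not depend on the line: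
  a primitive has bounded increments along the horizontal sides.\<close>

lemma avg_vertical_line_shift:
  assumes E: "E holomorphic_on {s. Re s > 0}"
    and M: "\<And>s. 0 < Re s \<Longrightarrow> Re s \<le> 2 \<Longrightarrow> norm (E s) \<le> M"
    and lim: "((\<lambda>T. avg T (\<lambda>t. E (2 - \<i> * of_real t))) \<longlongrightarrow> L) at_top"
    and \<sigma>: "0 < \<sigma>" "\<sigma> \<le> 2"
  shows "((\<lambda>T. avg T (\<lambda>t. E (of_real \<sigma> - \<i> * of_real t))) \<longlongrightarrow> L) at_top"
proof -
  let ?z = "\<lambda>x t. of_real x - \<i> * of_real t"
  let ?S = "{s. Re s > 0}"
  have "convex ?S" "open ?S" by (rule convex_halfspace_Re_gt, rule open_halfspace_Re_gt)
  then obtain G where "\<And>x. x \<in> ?S \<Longrightarrow> (G has_field_derivative E x) (at x within ?S)"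
    using holomorphic_convex_primitive'[OF _ _ E] by blast
  then have G: "(G has_field_derivative E x) (at x)" if "Re x > 0" for x
    using that at_within_open[OF _ \<open>open ?S\<close>] by fastforce
  have ii: "\<i> * (z * (- \<i>)) = z" for z by (simp add: complex_eq_iff)
  have int: "integral {-T..T} (\<lambda>t. E (?z x t)) = \<i> * (G (of_real x - \<i> * of_real T) - G (of_real x + \<i> * of_real T))"
    if x: "x > 0" and T: "T > 0" for x T
  proof (rule integral_unique)
    have "((\<lambda>t. E (?z x t)) has_integral
        \<i> * G (of_real x - \<i> * of_real T) - \<i> * G (of_real x - \<i> * of_real (- T))) {-T..T}"
    proof (rule fundamental_theorem_of_calculus)
      fix t :: real
      have "((\<lambda>z. \<i> * G (of_real x - \<i> * z)) has_field_derivative \<i> * (E (?z x t) * (- \<i>))) (at (of_real t))"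
        using x by (auto intro!: derivative_eq_intros DERIV_chain2[OF G])
      then have "((\<lambda>z. \<i> * G (of_real x - \<i> * z)) has_field_derivative E (?z x t)) (at (of_real t))"
        using ii[of "E (?z x t)"] by simp
      then show "((\<lambda>t. \<i> * G (?z x t)) has_vector_derivative E (?z x t)) (at t within {-T..T})"
        by (rule has_vector_derivative_real_field)
    qed (use T in simp)
    then show "((\<lambda>t. E (?z x t)) has_integral
        \<i> * (G (of_real x - \<i> * of_real T) - G (of_real x + \<i> * of_real T))) {-T..T}"
      by (simp add: right_diff_distrib)
  qed
  let ?W = "{s. Re s > 0} \<inter> {s. Re s \<le> 2}"
  have W: "convex ?W" by (intro convex_Int convex_halfspace_Re_gt convex_halfspace_Re_le)
  \<comment> \<open>The horizontal sides have length below 2 whatever the height, so after division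
    by \<open>2 * T\<close> their contribution vanishes.\<close>
  have inc: "norm (G (2 + \<i> * of_real y) - G (of_real \<sigma> + \<i> * of_real y)) \<le> M * 2" for y
  proof -
    have "norm (G (2 + \<i> * of_real y) - G (of_real \<sigma> + \<i> * of_real y)) \<le> M * norm ((2 + \<i> * of_real y) - (of_real \<sigma> + \<i> * of_real y))"
      by (rule field_differentiable_bound[OF W, of G E]) (use \<sigma> M in \<open>auto intro!: has_field_derivative_at_within[OF G]\<close>)
    also have "(2 + \<i> * of_real y) - (of_real \<sigma> + \<i> * of_real y) = of_real (2 - \<sigma>)" by simp
    also have "M * norm (of_real (2 - \<sigma>) :: complex) \<le> M * 2"
      unfolding norm_of_real using \<sigma> order_trans[OF norm_ge_zero M[of 1]] by (intro mult_left_mono) auto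
    finally show ?thesis .
  qed
  have "((\<lambda>T. avg T (\<lambda>t. E (2 - \<i> * of_real t)) - avg T (\<lambda>t. E (of_real \<sigma> - \<i> * of_real t))) \<longlongrightarrow> 0) at_top"
  proof (rule Lim_null_comparison)
    show "((\<lambda>T::real. (2 * M) * inverse T) \<longlongrightarrow> 0) at_top"
      by (rule tendsto_mult_right_zero, rule tendsto_inverse_0_at_top, rule filterlim_ident)
    show "\<forall>\<^sub>F T in at_top. norm (avg T (\<lambda>t. E (2 - \<i> * of_real t)) - avg T (\<lambda>t. E (of_real \<sigma> - \<i> * of_real t))) \<le> (2 * M) * inverse T"
      using eventually_gt_at_top[of 0]
    proof eventually_elim
      case (elim T)
      let ?u = "G (2 + \<i> * of_real (- T)) - G (of_real \<sigma> + \<i> * of_real (- T))"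
      let ?v = "G (2 + \<i> * of_real T) - G (of_real \<sigma> + \<i> * of_real T)"
      have "integral {-T..T} (\<lambda>t. E (2 - \<i> * of_real t)) - integral {-T..T} (\<lambda>t. E (of_real \<sigma> - \<i> * of_real t)) = \<i> * (?u - ?v)"
        using int[of 2 T] int[of \<sigma> T] elim \<sigma> by (simp add: algebra_simps)
      then have "avg T (\<lambda>t. E (2 - \<i> * of_real t)) - avg T (\<lambda>t. E (of_real \<sigma> - \<i> * of_real t)) = (1 / (2 * T)) *\<^sub>R (\<i> * (?u - ?v))"
        by (simp only: avg_def scaleR_diff_right[symmetric])
      then have "norm (avg T (\<lambda>t. E (2 - \<i> * of_real t)) - avg T (\<lambda>t. E (of_real \<sigma> - \<i> * of_real t))) = 1 / (2 * T) * norm (?u - ?v)"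
        using elim by (simp only: norm_scaleR norm_mult norm_ii) simp
      also have "\<dots> \<le> 1 / (2 * T) * (4 * M)"
        using norm_triangle_ineq4[of ?u ?v] inc[of "-T"] inc[of T] elim by (intro mult_left_mono) auto
      finally show ?case using elim by (simp add: field_simps)
    qed
  qed
  from tendsto_diff[OF lim this] show ?thesis by simp
qed

lemma mean_truncate_monomial_tendsto:
  assumes D0: "D 0 = 0" and mn: "m > 0" "n > 0"
  shows "(\<lambda>N. mean (\<lambda>t. boundary (truncate N D) t * (c * cis (t * (ln (real m) - ln (real n))))))
    \<longlonglongrightarrow> c * (if m dvd n then D (n div m) else 0)"
proof (rule tendsto_eventually)
  show "\<forall>\<^sub>F N in sequentially. mean (\<lambda>t. boundary (truncate N D) t * (c * cis (t * (ln (real m) - ln (real n)))))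
      = c * (if m dvd n then D (n div m) else 0)"
    using eventually_gt_at_top[of "n div m"]
    by eventually_elim (simp only: mean_boundary_monomial[OF dirichlet_poly_truncate[of D, OF D0] mn], simp add: truncate_def)
qed

lemma boundary_truncate:
  assumes "a 0 = 0"
  shows "boundary (truncate N a) t = (\<Sum>n<N. a n * cis (t * ln (real n)))"
proof -
  have "boundary (truncate N a) t = (\<Sum>n\<in>{1..<N}. truncate N a n * cis (t * ln (real n)))"
    by (rule boundary_eq_sum) (use assms in \<open>auto simp: truncate_def Suc_le_eq split: if_splits intro!: gr0I\<close>)
  also have "\<dots> = (\<Sum>n<N. a n * cis (t * ln (real n)))"
    by (rule sum.mono_neutral_cong_left) (use assms in \<open>auto simp: truncate_def Suc_le_eq\<close>)
  finally show ?thesis .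
qed

text \<open>On Re s = 2 the mean can be taken termwise by uniform convergence. The exponential is
  the analytic extension (n/m)^s of the character, and its size on this line cancels the weight of
  the only resonant coefficient.\<close>

lemma hardy_inf_avg_monomial:
  assumes D: "D \<in> hardy_inf" and mn: "m > 0" "n > 0"
  shows "((\<lambda>T. avg T (\<lambda>t. dirichlet_eval D (2 - \<i> * of_real t) *
       (c * exp (- (2 - \<i> * of_real t) * of_real (ln (real m) - ln (real n)))))) \<longlongrightarrow>
    c * (if m dvd n then D (n div m) else 0)) at_top"
proof -
  let ?e = "\<lambda>t. dirichlet_eval D (2 - \<i> * of_real t)"
  define w where "w = ln (real m) - ln (real n)"
  \<comment> \<open>The coefficients of the function on the line Re s = 2, read as a series on the
    axis.\<close>
  define b where "b n = D n * of_real (real n powr - 2)" for n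
  have b0: "b 0 = 0" by (simp add: b_def)
  define h where "h t = (c * of_real (exp (- 2 * w))) * cis (t * w)" for t
  have ub: "uniform_limit UNIV (\<lambda>N t. \<Sum>n<N. D n * of_nat n powr - (2 - \<i> * of_real t)) (\<lambda>t. ?e t) sequentially"
    unfolding dirichlet_eval_def
    by (rule Weierstrass_m_test[OF _ hardy_inf_summable_2[OF D]]) (simp add: norm_mult norm_of_nat_powr)
  have tm: "D n * of_nat n powr - (2 - \<i> * of_real t) = b n * cis (t * ln (real n))" for n t
  proof (cases "n = 0")
    case False
    have "of_nat n powr - (2 - \<i> * of_real t) = of_nat n powr (of_real (- 2)) * of_nat n powr (\<i> * of_real t)"
      by (simp flip: powr_add)
    also have "(of_nat n :: complex) powr (of_real (- 2)) = of_real (real n powr - 2)"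
      by (metis of_nat_0_le_iff of_real_of_nat_eq powr_of_real)
    finally show ?thesis using False by (simp add: b_def of_nat_powr_ii)
  qed (simp add: b_def hardy_infD(1)[OF D])
  have ub': "uniform_limit UNIV (\<lambda>N t. boundary (truncate N b) t) (\<lambda>t. ?e t) sequentially"
    using ub unfolding boundary_truncate[of b, OF b0] tm .
  have bd1: "bounded (range (\<lambda>t. ?e t))"
    unfolding bounded_iff using hardy_infD(4)[OF D] by (intro exI[of _ "hardy_inf_norm D"]) auto
  have bd2: "bounded (range h)"
    unfolding bounded_iff by (intro exI[of _ "norm (c * of_real (exp (- 2 * w)))"]) (auto simp: h_def norm_mult)
  have u: "uniform_limit UNIV (\<lambda>N t. boundary (truncate N b) t * h t) (\<lambda>t. ?e t * h t) sequentially"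
    by (rule uniform_lim_mult[OF ub' uniform_limit_const bd1 bd2])
  have aph: "almost_per h" unfolding h_def w_def by (intro almost_per_rat_trig rat_trig.monomial mn)
  have ap: "almost_per (\<lambda>t. boundary (truncate N b) t * h t)" for N
    by (intro almost_per_mult almost_per_boundary dirichlet_poly_truncate b0 aph)
  \<comment> \<open>With \<open>n = m * k\<close> the exponential equals k^2, the reciprocal of the
    weight in \<open>b k\<close>.\<close>
  have val: "c * of_real (exp (- 2 * w)) * (if m dvd n then b (n div m) else 0) = c * (if m dvd n then D (n div m) else 0)"
  proof (cases "m dvd n")
    case True
    then obtain k where k: "n = m * k" by auto
    then have k0: "k > 0" using mn by auto
    have "exp (- 2 * w) = real k powr 2"
      using mn k0 by (simp add: w_def k ln_mult powr_def mult.commute)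
    then have "exp (- 2 * w) * real k powr - 2 = 1" using k0 by (simp add: powr_minus)
    then have "complex_of_real (exp (- 2 * w)) * of_real (real k powr - 2) = 1" by (metis of_real_1 of_real_mult)
    then show ?thesis using True k mn by (simp add: b_def mult_ac)
  qed simp
  have "((\<lambda>T. avg T (\<lambda>t. ?e t * h t)) \<longlongrightarrow>
     c * of_real (exp (- 2 * w)) * (if m dvd n then b (n div m) else 0)) at_top"
  proof (rule avg_tendsto_uniform_limit[OF _ _ u])
    show "(\<lambda>N. mean (\<lambda>t. boundary (truncate N b) t * h t)) \<longlonglongrightarrow> c * of_real (exp (- 2 * w)) * (if m dvd n then b (n div m) else 0)"
      unfolding h_def w_def by (rule mean_truncate_monomial_tendsto[of b, OF b0 mn])
  qed (auto intro!: always_eventually avg_tendsto_mean almost_per_continuous ap)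
  then have "((\<lambda>T. avg T (\<lambda>t. ?e t * h t)) \<longlongrightarrow>
     c * (if m dvd n then D (n div m) else 0)) at_top"
    unfolding val .
  moreover have "h t = c * exp (- (2 - \<i> * of_real t) * of_real w)" for t
  proof -
    have "exp (- (2 - \<i> * of_real t) * of_real w) = exp (of_real (- 2 * w)) * exp (\<i> * of_real (t * w))"
      by (simp add: algebra_simps flip: exp_add)
    then show ?thesis by (simp only: h_def cis_conv_exp exp_of_real mult.assoc)
  qed
  ultimately show ?thesis by (simp only: w_def)
qed

text \<open>\<open>h\<close> extends to an entire function \<open>H\<close>, and the mean of
  \<open>D\<close> times \<open>H\<close> is the same on every line Re s = \<open>\<sigma>\<close>
  in (0,2]. At 2 it can be computed and equals \<open>\<Lambda>\<close>; near 0 it is estimated,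
  since \<open>D\<close> is bounded by its sup norm on each line and \<open>H\<close> tends to
  \<open>h\<close> uniformly. Boundary values of \<open>D\<close> are never formed.\<close>

lemma bounded_functional:
  assumes D: "D \<in> hardy_inf" and h: "rat_trig h"
  obtains \<Lambda> where "(\<lambda>N. mean (\<lambda>t. boundary (truncate N D) t * h t)) \<longlonglongrightarrow> \<Lambda>"
    "norm \<Lambda> \<le> hardy_inf_norm D * bes_norm 1 h"
proof -
  let ?z = "\<lambda>\<sigma> t. of_real \<sigma> - \<i> * of_real t"
  let ?e = "\<lambda>t. dirichlet_eval D (2 - \<i> * of_real t)"
  let ?b = "\<lambda>N t. boundary (truncate N D) t"
  note D0 = hardy_infD(1)[OF D]
  define B where "B = hardy_inf_norm D"
  have B: "B \<ge> 0" unfolding B_def by (rule hardy_inf_norm_nonneg[OF D])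
  have contD: "continuous_on UNIV (\<lambda>t. ?e t)"
    by (rule continuous_on_compose2[OF holomorphic_on_imp_continuous_on[OF hardy_infD(3)[OF D]]])
      (auto intro!: continuous_intros)
  \<comment> \<open>All data are carried through one induction: the bound \<open>C\<close> on the
    strip is for the line shift, the trigonometric form on each line is for the existence of
    means.\<close>
  have "\<exists>H \<Lambda> C. H holomorphic_on UNIV \<and> (\<forall>s. 0 < Re s \<longrightarrow> Re s \<le> 2 \<longrightarrow> norm (H s) \<le> C) \<and>
     uniform_limit UNIV (\<lambda>\<sigma> t. H (?z \<sigma> t)) h (at_right 0) \<and>
     (\<forall>\<sigma>. rat_trig (\<lambda>t. H (?z \<sigma> t))) \<and>
     ((\<lambda>T. avg T (\<lambda>t. ?e t * H (2 - \<i> * of_real t))) \<longlongrightarrow> \<Lambda>) at_top \<and>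
     (\<lambda>N. mean (\<lambda>t. ?b N t * h t)) \<longlonglongrightarrow> \<Lambda>"
    using h
  proof induction
    case mn: (monomial m n c)
    define w where "w = ln (real m) - ln (real n)"
    have Heq: "c * exp (- (?z \<sigma> t) * of_real w) = (c * of_real (exp (- \<sigma> * w))) * cis (t * w)" for \<sigma> t
    proof -
      have "exp (- (?z \<sigma> t) * of_real w) = exp (of_real (- \<sigma> * w)) * exp (\<i> * of_real (t * w))"
        by (simp add: algebra_simps flip: exp_add)
      then show ?thesis by (simp only: cis_conv_exp exp_of_real mult.assoc)
    qed
    show ?case
    proof (rule exI[of _ "\<lambda>s. c * exp (- s * of_real w)"], rule exI[of _ "c * (if m dvd n then D (n div m) else 0)"],
        rule exI[of _ "norm c * exp (2 * \<bar>w\<bar>)"], intro conjI allI impI)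
      show "(\<lambda>s. c * exp (- s * of_real w)) holomorphic_on UNIV" by (intro holomorphic_intros)
      show "norm (c * exp (- s * of_real w)) \<le> norm c * exp (2 * \<bar>w\<bar>)" if s: "0 < Re s" "Re s \<le> 2" for s
      proof -
        have "- (Re s * w) \<le> \<bar>Re s * w\<bar>" by simp
        also have "\<dots> \<le> 2 * \<bar>w\<bar>" unfolding abs_mult using s by (intro mult_right_mono) auto
        finally show ?thesis by (auto simp: norm_mult norm_exp_eq_Re intro!: mult_left_mono)
      qed
      show "rat_trig (\<lambda>t. c * exp (- (?z \<sigma> t) * of_real w))" for \<sigma>
        unfolding Heq unfolding w_def by (rule rat_trig.monomial[OF mn])
      show "((\<lambda>T. avg T (\<lambda>t. ?e t * (c * exp (- (2 - \<i> * of_real t) * of_real w)))) \<longlongrightarrow>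
          c * (if m dvd n then D (n div m) else 0)) at_top"
        unfolding w_def by (rule hardy_inf_avg_monomial[OF D mn])
      show "(\<lambda>N. mean (\<lambda>t. ?b N t * (c * cis (t * (ln (real m) - ln (real n))))))
          \<longlonglongrightarrow> c * (if m dvd n then D (n div m) else 0)"
        by (rule mean_truncate_monomial_tendsto[of D, OF D0 mn])
      show "uniform_limit UNIV (\<lambda>\<sigma> t. c * exp (- (?z \<sigma> t) * of_real w))
          (\<lambda>t. c * cis (t * (ln (real m) - ln (real n)))) (at_right 0)"
        unfolding Heq unfolding w_def[symmetric]
      proof (rule uniform_limitI)
        fix e :: real assume e: "e > 0"
        have "((\<lambda>\<sigma>. c * of_real (exp (- \<sigma> * w))) \<longlongrightarrow> c * of_real (exp (- 0 * w))) (at_right 0)"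
          by (intro tendsto_intros)
        then have "\<forall>\<^sub>F \<sigma> in at_right 0. dist (c * of_real (exp (- \<sigma> * w))) c < e"
          using tendstoD[OF _ e] by fastforce
        then show "\<forall>\<^sub>F \<sigma> in at_right 0. \<forall>t\<in>UNIV. dist (c * of_real (exp (- \<sigma> * w)) * cis (t * w)) (c * cis (t * w)) < e"
          by eventually_elim (simp add: dist_norm norm_mult flip: left_diff_distrib)
      qed
    qed
  next
    case (add f g)
    then obtain H1 L1 C1 H2 L2 C2 where
      1: "H1 holomorphic_on UNIV" "\<And>s. 0 < Re s \<Longrightarrow> Re s \<le> 2 \<Longrightarrow> norm (H1 s) \<le> C1"
       "uniform_limit UNIV (\<lambda>\<sigma> t. H1 (?z \<sigma> t)) f (at_right 0)"
       "\<And>\<sigma>. rat_trig (\<lambda>t. H1 (?z \<sigma> t))"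
       "((\<lambda>T. avg T (\<lambda>t. ?e t * H1 (2 - \<i> * of_real t))) \<longlongrightarrow> L1) at_top"
       "(\<lambda>N. mean (\<lambda>t. ?b N t * f t)) \<longlonglongrightarrow> L1" and
      2: "H2 holomorphic_on UNIV" "\<And>s. 0 < Re s \<Longrightarrow> Re s \<le> 2 \<Longrightarrow> norm (H2 s) \<le> C2"
       "uniform_limit UNIV (\<lambda>\<sigma> t. H2 (?z \<sigma> t)) g (at_right 0)"
       "\<And>\<sigma>. rat_trig (\<lambda>t. H2 (?z \<sigma> t))"
       "((\<lambda>T. avg T (\<lambda>t. ?e t * H2 (2 - \<i> * of_real t))) \<longlongrightarrow> L2) at_top"
       "(\<lambda>N. mean (\<lambda>t. ?b N t * g t)) \<longlonglongrightarrow> L2"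
      by (elim exE conjE) blast
    have cont: "continuous_on UNIV (\<lambda>t. H1 (2 - \<i> * of_real t))" "continuous_on UNIV (\<lambda>t. H2 (2 - \<i> * of_real t))"
      using rat_trig_continuous[OF 1(4)[of 2]] rat_trig_continuous[OF 2(4)[of 2]] by simp_all
    show ?case
    proof (rule exI[of _ "\<lambda>s. H1 s + H2 s"], rule exI[of _ "L1 + L2"], rule exI[of _ "C1 + C2"], intro conjI allI impI)
      show "(\<lambda>s. H1 s + H2 s) holomorphic_on UNIV" by (intro holomorphic_intros 1 2)
      show "norm (H1 s + H2 s) \<le> C1 + C2" if "0 < Re s" "Re s \<le> 2" for s
        by (intro norm_triangle_le add_mono 1 2 that)
      show "uniform_limit UNIV (\<lambda>\<sigma> t. H1 (?z \<sigma> t) + H2 (?z \<sigma> t)) (\<lambda>t. f t + g t) (at_right 0)"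
        by (intro uniform_limit_add 1 2)
      show "rat_trig (\<lambda>t. H1 (?z \<sigma> t) + H2 (?z \<sigma> t))" for \<sigma>
        by (intro rat_trig.add 1 2)
      show "((\<lambda>T. avg T (\<lambda>t. ?e t * (H1 (2 - \<i> * of_real t) + H2 (2 - \<i> * of_real t)))) \<longlongrightarrow> L1 + L2) at_top"
        unfolding distrib_left avg_add[OF continuous_on_mult[OF contD cont(1)] continuous_on_mult[OF contD cont(2)]]
        by (intro tendsto_add 1 2)
      have "mean (\<lambda>t. ?b N t * (f t + g t)) = mean (\<lambda>t. ?b N t * f t) + mean (\<lambda>t. ?b N t * g t)" for N
        unfolding distrib_left
        by (intro mean_add almost_per_mult almost_per_boundary dirichlet_poly_truncate D0 almost_per_rat_trig add.hyps)
      then show "(\<lambda>N. mean (\<lambda>t. ?b N t * (f t + g t))) \<longlonglongrightarrow> L1 + L2"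
        using tendsto_add[OF 1(6) 2(6)] by simp
    qed
  qed
  then obtain H \<Lambda> C where H: "H holomorphic_on UNIV" "\<And>s. 0 < Re s \<Longrightarrow> Re s \<le> 2 \<Longrightarrow> norm (H s) \<le> C"
    "uniform_limit UNIV (\<lambda>\<sigma> t. H (?z \<sigma> t)) h (at_right 0)"
    "\<And>\<sigma>. rat_trig (\<lambda>t. H (?z \<sigma> t))"
    "((\<lambda>T. avg T (\<lambda>t. ?e t * H (2 - \<i> * of_real t))) \<longlongrightarrow> \<Lambda>) at_top"
    "(\<lambda>N. mean (\<lambda>t. ?b N t * h t)) \<longlonglongrightarrow> \<Lambda>"
    by (elim exE conjE) blast
  have aph: "almost_per h" by (rule almost_per_rat_trig[OF h])
  have apH: "almost_per (\<lambda>t. H (?z \<sigma> t))" for \<sigma> by (rule almost_per_rat_trig[OF H(4)])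
  let ?E = "\<lambda>s. dirichlet_eval D s * H s"
  have holE: "?E holomorphic_on {s. Re s > 0}"
    by (intro holomorphic_intros hardy_infD(3)[OF D] holomorphic_on_subset[OF H(1)]) auto
  have bE: "norm (?E s) \<le> B * C" if "0 < Re s" "Re s \<le> 2" for s
    unfolding norm_mult B_def
    by (intro mult_mono hardy_infD(4)[OF D] H(2) that hardy_inf_norm_nonneg[OF D] norm_ge_zero)
  have le: "norm \<Lambda> \<le> B * mean (\<lambda>t. norm (H (?z \<sigma> t)))" if \<sigma>: "0 < \<sigma>" "\<sigma> \<le> 2" for \<sigma>
  proof (rule tendsto_le)
    show "((\<lambda>T. norm (avg T (\<lambda>t. ?E (?z \<sigma> t)))) \<longlongrightarrow> norm \<Lambda>) at_top"
      by (intro tendsto_norm avg_vertical_line_shift[OF holE bE H(5) \<sigma>]) auto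
    show "((\<lambda>T. B * avg T (\<lambda>t. norm (H (?z \<sigma> t)))) \<longlongrightarrow> B * mean (\<lambda>t. norm (H (?z \<sigma> t)))) at_top"
      by (intro tendsto_intros avg_tendsto_mean_real real_ap_norm apH)
    show "\<forall>\<^sub>F T in at_top. norm (avg T (\<lambda>t. ?E (?z \<sigma> t))) \<le> B * avg T (\<lambda>t. norm (H (?z \<sigma> t)))"
      using eventually_gt_at_top[of 0]
    proof eventually_elim
      case (elim T)
      have cE: "continuous_on UNIV (\<lambda>t. ?E (?z \<sigma> t))"
        by (rule continuous_on_compose2[OF holomorphic_on_imp_continuous_on[OF holE]])
          (use \<sigma> in \<open>auto intro!: continuous_intros\<close>)
      have cH: "continuous_on UNIV (\<lambda>t. norm (H (?z \<sigma> t)))"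
        by (intro continuous_on_norm almost_per_continuous apH)
      have "norm (integral {-T..T} (\<lambda>t. ?E (?z \<sigma> t))) \<le> integral {-T..T} (\<lambda>t. B * norm (H (?z \<sigma> t)))"
      proof (rule integral_norm_bound_integral)
        show "(\<lambda>t. ?E (?z \<sigma> t)) integrable_on {-T..T}" by (rule integrable_on_Icc[OF cE])
        show "(\<lambda>t. B * norm (H (?z \<sigma> t))) integrable_on {-T..T}"
          by (intro integrable_on_Icc continuous_on_mult continuous_on_const cH)
        show "norm (?E (?z \<sigma> t)) \<le> B * norm (H (?z \<sigma> t))" for t
          unfolding norm_mult B_def using \<sigma> by (intro mult_right_mono hardy_infD(4)[OF D]) auto
      qed
      then show ?case using elim unfolding avg_cmult[OF cH, symmetric] by (simp add: avg_def divide_right_mono)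
    qed
  qed simp
  have "norm \<Lambda> \<le> B * bes_norm 1 h"
  proof (rule field_le_epsilon)
    fix e :: real assume e: "e > 0"
    define d where "d = e / (B + 1)"
    have d: "d > 0" "B * d \<le> e" using e B by (auto simp: d_def field_simps)
    have "\<forall>\<^sub>F \<sigma> in at_right 0. \<forall>t. dist (H (?z \<sigma> t)) (h t) < d"
      using uniform_limitD[OF H(3) d(1)] by simp
    moreover have "\<forall>\<^sub>F \<sigma> in at_right (0::real). 0 < \<sigma> \<and> \<sigma> \<le> 2"
      unfolding eventually_at_right_field by (intro exI[of _ 2]) auto
    ultimately have "\<forall>\<^sub>F \<sigma> in at_right 0. 0 < \<sigma> \<and> \<sigma> \<le> 2 \<and> (\<forall>t. dist (H (?z \<sigma> t)) (h t) < d)"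
      by eventually_elim auto
    then obtain \<sigma> where \<sigma>: "0 < \<sigma>" "\<sigma> \<le> 2" "\<And>t. dist (H (?z \<sigma> t)) (h t) < d"
      using eventually_happens'[OF trivial_limit_at_right_real] by blast
    have "norm \<Lambda> \<le> B * mean (\<lambda>t. norm (H (?z \<sigma> t)))" by (rule le[OF \<sigma>(1,2)])
    also have "mean (\<lambda>t. norm (H (?z \<sigma> t))) \<le> mean (\<lambda>t. norm (h t) + d)"
    proof (intro mean_mono real_ap_norm apH real_ap_add real_ap_const aph)
      fix t show "norm (H (?z \<sigma> t)) \<le> norm (h t) + d"
        using \<sigma>(3)[of t] norm_triangle_ineq2[of "H (?z \<sigma> t)" "h t"] by (simp add: dist_norm)
    qed
    also have "mean (\<lambda>t. norm (h t) + d) = bes_norm 1 h + d"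
      by (subst mean_add_real[OF real_ap_norm[OF aph] real_ap_const]) (simp add: mean_const bes_norm_1[OF aph])
    finally show "norm \<Lambda> \<le> B * bes_norm 1 h + e" using B d by (simp add: distrib_left mult_left_mono)
  qed
  with H(6) show thesis unfolding B_def by (rule that)
qed

text \<open>Duality with the conjugate of a truncation: the functional takes the value
  \<open>S\<close>, the square of its 2-norm \<open>x\<close>, and is at most the sup norm of
  \<open>D\<close> times the 1-norm, which is at most \<open>x\<close>. Cancelling one factor
  \<open>x\<close> gives the bound.\<close>

lemma hardy_inf_square_sum:
  assumes D: "D \<in> hardy_inf"
  shows "(\<Sum>n<N. (norm (D n))\<^sup>2) \<le> (hardy_inf_norm D)\<^sup>2"
proof -
  note D0 = hardy_infD(1)[OF D]
  define P where "P = (\<lambda>N. truncate N D)"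
  have dP: "dirichlet_poly (P N)" for N unfolding P_def by (rule dirichlet_poly_truncate[of D, OF D0])
  let ?b = "\<lambda>t. cnj (boundary (P N) t)"
  define S where "S = (\<Sum>n<N. (norm (D n))\<^sup>2)"
  \<comment> \<open>Longer truncations pair with the \<open>N\<close>-th one in the same way, so the
    limit defining the functional is eventually constant.\<close>
  have eq: "(\<Sum>n | P N n \<noteq> 0. P M n * cnj (P N n)) = of_real S" if "M \<ge> N" for M
  proof -
    have "(\<Sum>n | P N n \<noteq> 0. P M n * cnj (P N n)) = (\<Sum>n<N. complex_of_real ((norm (D n))\<^sup>2))"
      by (rule sum.mono_neutral_cong_left)
        (use that in \<open>auto simp: P_def truncate_def complex_norm_square[symmetric] split: if_splits\<close>)
    then show ?thesis by (simp add: S_def)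
  qed
  have rat: "rat_trig (\<lambda>t. ?b t)" by (intro rat_trig_cnj rat_trig_boundary dP)
  obtain \<Lambda> where \<Lambda>: "(\<lambda>M. mean (\<lambda>t. boundary (P M) t * ?b t)) \<longlonglongrightarrow> \<Lambda>"
    "norm \<Lambda> \<le> hardy_inf_norm D * bes_norm 1 (\<lambda>t. ?b t)"
    using bounded_functional[OF D rat] unfolding P_def by blast
  have "(\<lambda>M. mean (\<lambda>t. boundary (P M) t * ?b t)) \<longlonglongrightarrow> of_real S"
    by (rule tendsto_eventually, rule eventually_mono[OF eventually_ge_at_top[of N]])
      (simp add: mean_boundary_cnj[OF dP dP] eq)
  with \<Lambda>(1) have "\<Lambda> = of_real S" by (rule LIMSEQ_unique)
  define x where "x = poly_norm 2 (P N)"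
  have x: "x\<^sup>2 = S" "x \<ge> 0"
  proof -
    have "complex_of_real (x\<^sup>2) = (\<Sum>n | P N n \<noteq> 0. P N n * cnj (P N n))"
      by (simp only: x_def parseval[OF dP] of_real_sum complex_norm_square)
    then show "x\<^sup>2 = S" by (simp only: eq[OF order_refl] of_real_eq_iff)
  qed (simp add: x_def)
  have "bes_norm 1 (\<lambda>t. ?b t) = bes_norm 1 (boundary (P N))"
    by (rule bes_norm_cong) simp
  also have "\<dots> \<le> x"
    unfolding x_def poly_norm_eq by (rule bes_norm_mono_exponent[OF almost_per_boundary[OF dP]]) simp
  finally have "hardy_inf_norm D * bes_norm 1 (\<lambda>t. ?b t) \<le> hardy_inf_norm D * x"
    by (rule mult_left_mono[OF _ hardy_inf_norm_nonneg[OF D]])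
  moreover have "S \<le> norm \<Lambda>" using \<open>\<Lambda> = of_real S\<close> by simp
  ultimately have "x * x \<le> hardy_inf_norm D * x" using \<Lambda>(2) x(1) by (simp add: power2_eq_square)
  then have "x \<le> hardy_inf_norm D"
    using x(2) hardy_inf_norm_nonneg[OF D] by (cases "x = 0") auto
  then show ?thesis using x power_mono[of x "hardy_inf_norm D" 2] by (simp add: S_def)
qed

lemma hardy_inf_approx:
  assumes D: "D \<in> hardy_inf"
  shows "hardy_approx 2 (\<lambda>N. truncate N D) D"
  unfolding hardy_approx_def
proof (intro conjI allI impI)
  note dP = dirichlet_poly_truncate[of D, OF hardy_infD(1)[OF D]]
  show "dirichlet_poly (truncate N D)" for N by (rule dP)
  show "(\<lambda>N. truncate N D n) \<longlonglongrightarrow> D n" for n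
    by (rule tendsto_eventually, rule eventually_mono[OF eventually_gt_at_top[of n]]) (simp add: truncate_def)
  fix e :: real assume e: "e > 0"
  have "summable (\<lambda>n. (norm (D n))\<^sup>2)"
    by (rule summableI_nonneg_bounded[OF _ hardy_inf_square_sum[OF D]]) simp
  then obtain N where N: "\<And>j k. j \<ge> N \<Longrightarrow> (\<Sum>n=j..<k. (norm (D n))\<^sup>2) < e\<^sup>2"
    unfolding summable_Cauchy using e by (force simp: sum_nonneg dest!: spec[of _ "e\<^sup>2"])
  have less: "poly_norm 2 (\<lambda>n. truncate k D n - truncate j D n) < e" if "j \<ge> N" "j \<le> k" for j k
  proof -
    have "(poly_norm 2 (\<lambda>n. truncate k D n - truncate j D n))\<^sup>2 = (\<Sum>n=j..<k. (norm (D n))\<^sup>2)"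
      unfolding parseval[OF dirichlet_poly_diff[OF dP dP]]
      by (rule sum.mono_neutral_cong_left) (use that in \<open>auto simp: truncate_def split: if_splits\<close>)
    also have "\<dots> < e\<^sup>2" by (rule N[OF that(1)])
    finally show ?thesis using e by (simp add: power2_less_imp_less)
  qed
  have "poly_norm 2 (\<lambda>n. truncate j D n - truncate k D n) < e" if "j \<ge> N" "k \<ge> N" for j k
    using less[of j k] less[of k j] that poly_norm_minus_commute[OF dP dP, of 2 j k] by (cases "j \<le> k") auto
  then show "\<exists>N. \<forall>j\<ge>N. \<forall>k\<ge>N. poly_norm 2 (\<lambda>n. truncate j D n - truncate k D n) < e" by blast
qed

text \<open>Hoelder with 1 = 1/2 + 1/2: H^2 convergence of the truncations gives H^1 convergence of
  their products with a polynomial.\<close>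

lemma hardy_inf_mult_approx:
  assumes D: "D \<in> hardy_inf" and f: "dirichlet_poly f"
  shows "hardy_approx 1 (\<lambda>N. dirichlet_mult (truncate N D) f) (dirichlet_mult D f)"
  by (rule hardy_approx_mult[OF hardy_inf_approx[OF D] hardy_approx_const[OF f, of 2]]) auto

text \<open>The 1-norm of \<open>P N\<close> times \<open>f\<close> is nearly attained on a test
  function \<open>g\<close>. Passing from \<open>P N\<close> to the limit of the \<open>P M\<close>
  costs little because the products are Cauchy, and in the limit the pairing is the functional of
  \<open>D\<close>.\<close>

lemma hardy_inf_mult_poly_norm:
  assumes D: "D \<in> hardy_inf" and f: "dirichlet_poly f"
  shows "hardy_norm 1 (dirichlet_mult D f) \<le> hardy_inf_norm D * poly_norm 1 f"
proof -
  define B where "B = hardy_inf_norm D"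
  have B: "B \<ge> 0" unfolding B_def by (rule hardy_inf_norm_nonneg[OF D])
  define P where "P = (\<lambda>N. truncate N D)"
  have dP: "dirichlet_poly (P N)" for N
    unfolding P_def by (rule dirichlet_poly_truncate[of D, OF hardy_infD(1)[OF D]])
  have app: "hardy_approx 1 (\<lambda>N. dirichlet_mult (P N) f) (dirichlet_mult D f)"
    unfolding P_def by (rule hardy_inf_mult_approx[OF D f])
  define F where "F = boundary f"
  let ?R = "\<lambda>e. B * ((1 + e) * bes_norm 1 F) + (1 + e) * e + e"
  let ?b = "\<lambda>M t. boundary (P M) t"
  have ratF: "rat_trig F" unfolding F_def by (rule rat_trig_boundary[OF f])
  have apF: "almost_per F" by (rule almost_per_rat_trig[OF ratF])
  have bd: "boundary (dirichlet_mult (P N) f) = (\<lambda>t. boundary (P N) t * F t)" for N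
    unfolding F_def by (rule boundary_mult[OF dP f])
  have le: "hardy_norm 1 (dirichlet_mult D f) \<le> ?R e" if e: "e > 0" for e
  proof -
    obtain N0 where N0: "\<And>M N. M \<ge> N0 \<Longrightarrow> N \<ge> N0 \<Longrightarrow>
        poly_norm 1 (\<lambda>n. dirichlet_mult (P M) f n - dirichlet_mult (P N) f n) < e"
      using hardy_approxD(3)[OF app e] by auto
    have "poly_norm 1 (dirichlet_mult (P N) f) \<le> ?R e" if N: "N \<ge> N0" for N
    proof -
      have rat: "rat_trig (\<lambda>t. ?b M t * F t)" for M by (intro rat_trig_mult rat_trig_boundary dP ratF)
      note apM = almost_per_rat_trig[OF rat]
      obtain g where g: "rat_trig g" "\<And>t. norm (g t) \<le> 1 + e"
        "bes_norm 1 (\<lambda>t. boundary (P N) t * F t) \<le> norm (mean (\<lambda>t. (boundary (P N) t * F t) * g t)) + e"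
        using bes_norm_1_dual[OF rat e] by metis
      have apg: "almost_per g" by (rule almost_per_rat_trig[OF g(1)])
      \<comment> \<open>Pairing the product with \<open>g\<close> means pairing \<open>D\<close>
        with \<open>F * g\<close>, whose 1-norm is at most \<open>1 + e\<close> times that of
        \<open>F\<close>.\<close>
      obtain \<Lambda> where \<Lambda>: "(\<lambda>M. mean (\<lambda>t. ?b M t * (F t * g t))) \<longlonglongrightarrow> \<Lambda>"
        "norm \<Lambda> \<le> B * bes_norm 1 (\<lambda>t. F t * g t)"
        using bounded_functional[OF D rat_trig_mult[OF ratF g(1)]] unfolding P_def B_def by blast
  let ?l = "\<lambda>M. mean (\<lambda>t. ?b M t * (F t * g t))"
  let ?m = "mean (\<lambda>t. boundary (P N) t * (F t * g t))"
      have Fg: "bes_norm 1 (\<lambda>t. F t * g t) \<le> (1 + e) * bes_norm 1 F"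
        using bes_norm_mult_bound[OF apg apF _ g(2), of 1] by (simp add: mult.commute)
      have dist: "norm (?m - ?l M) \<le> (1 + e) * e"
        if M: "M \<ge> N0" for M
      proof -
        have "?m - ?l M =
          mean (\<lambda>t. boundary (P N) t * (F t * g t) - ?b M t * (F t * g t))"
          by (intro mean_diff[symmetric] almost_per_mult almost_per_boundary dP apF apg)
        also have "\<dots> = mean (\<lambda>t. g t * (boundary (P N) t * F t - ?b M t * F t))"
          by (simp add: algebra_simps)
        also have "norm \<dots> \<le> bes_norm 1 (\<lambda>t. g t * (boundary (P N) t * F t - ?b M t * F t))"
          by (intro norm_mean_le_bes_norm almost_per_mult almost_per_diff almost_per_boundary dP apF apg) simp
        also have "\<dots> \<le> (1 + e) * bes_norm 1 (\<lambda>t. boundary (P N) t * F t - ?b M t * F t)"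
          by (intro bes_norm_mult_bound almost_per_diff apM apg g(2)) simp
        also have "bes_norm 1 (\<lambda>t. boundary (P N) t * F t - ?b M t * F t) \<le> e"
          using N0[OF N M] by (simp add: poly_norm_eq boundary_diff dirichlet_poly_mult dP f bd)
        finally show ?thesis using e by (simp add: mult_left_mono)
      qed
      have "norm (?m - \<Lambda>) \<le> (1 + e) * e"
        by (rule tendsto_upperbound[OF tendsto_norm[OF tendsto_diff[OF tendsto_const \<Lambda>(1)]]])
          (auto simp: eventually_sequentially intro!: exI[of _ N0] dist)
      then have "norm ?m \<le> norm \<Lambda> + (1 + e) * e"
        using norm_triangle_ineq2[of "?m" \<Lambda>] by linarith
      moreover have "norm \<Lambda> \<le> B * ((1 + e) * bes_norm 1 F)"
        using \<Lambda>(2) mult_left_mono[OF Fg B] by linarith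
      ultimately show ?thesis using g(3) by (simp add: poly_norm_eq bd mult.assoc)
    qed
    then show ?thesis
      by (intro tendsto_upperbound[OF hardy_norm_tendsto[OF app]]) (auto simp: eventually_sequentially intro!: exI[of _ N0])
  qed
  have "hardy_norm 1 (dirichlet_mult D f) \<le> B * ((1 + 0) * bes_norm 1 F) + (1 + 0) * 0 + 0"
  proof (rule tendsto_lowerbound)
    show "((\<lambda>e. ?R e) \<longlongrightarrow> B * ((1 + 0) * bes_norm 1 F) + (1 + 0) * 0 + 0) (at_right 0)"
      by (intro tendsto_intros)
    show "\<forall>\<^sub>F e in at_right 0. hardy_norm 1 (dirichlet_mult D f) \<le> ?R e"
      by (auto simp: eventually_at_filter intro!: always_eventually le)
  qed simp
  then show ?thesis by (simp add: B_def F_def poly_norm_eq)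
qed

lemma hardy_inf_mult:
  assumes D: "D \<in> hardy_inf" and f: "f \<in> hardy 1"
  shows "dirichlet_mult D f \<in> hardy 1" "hardy_norm 1 (dirichlet_mult D f) \<le> hardy_inf_norm D * hardy_norm 1 f"
proof -
  define B where "B = hardy_inf_norm D"
  have B: "B \<ge> 0" unfolding B_def by (rule hardy_inf_norm_nonneg[OF D])
  obtain R where R: "hardy_approx 1 R f" using f by (rule hardyE)
  note dR = hardy_approxD(1)[OF R]
  have A: "dirichlet_mult D (R k) \<in> hardy 1" for k by (rule hardyI[OF hardy_inf_mult_approx[OF D dR]])
  have C: "\<exists>N. \<forall>j\<ge>N. \<forall>k\<ge>N. hardy_norm 1 (\<lambda>n. dirichlet_mult D (R j) n - dirichlet_mult D (R k) n) < e" if e: "e > 0" for e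
  proof -
    have d: "e / (B + 1) > 0" using e B by simp
    obtain N where N: "\<And>j k. j \<ge> N \<Longrightarrow> k \<ge> N \<Longrightarrow> poly_norm 1 (\<lambda>n. R j n - R k n) < e / (B + 1)"
      using hardy_approxD(3)[OF R d] by auto
    have "hardy_norm 1 (\<lambda>n. dirichlet_mult D (R j) n - dirichlet_mult D (R k) n) < e" if "j \<ge> N" "k \<ge> N" for j k
    proof -
      have "hardy_norm 1 (dirichlet_mult D (\<lambda>n. R j n - R k n)) \<le> B * poly_norm 1 (\<lambda>n. R j n - R k n)"
        unfolding B_def by (intro hardy_inf_mult_poly_norm D dirichlet_poly_diff dR)
      also have "\<dots> \<le> B * (e / (B + 1))" using N[OF that] B by (intro mult_left_mono) auto
      also have "\<dots> < e" using e B by (simp add: field_simps)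
      finally show ?thesis by (simp only: dirichlet_mult_diff_right)
    qed
    then show ?thesis by blast
  qed
  have lim: "(\<lambda>k. dirichlet_mult D (R k) n) \<longlonglongrightarrow> dirichlet_mult D f n" for n
    by (intro tendsto_dirichlet_mult tendsto_const hardy_approxD(2)[OF R])
  note comp = hardy_complete[of "\<lambda>k. dirichlet_mult D (R k)" 1 "dirichlet_mult D f", OF A order_refl _ lim]
  show "dirichlet_mult D f \<in> hardy 1" by (rule comp(1)) (rule C)
  have "(\<lambda>k. hardy_norm 1 (dirichlet_mult D (R k))) \<longlonglongrightarrow> hardy_norm 1 (dirichlet_mult D f)"
    by (rule comp(2)) (rule C)
  then show "hardy_norm 1 (dirichlet_mult D f) \<le> hardy_inf_norm D * hardy_norm 1 f"
    by (rule LIMSEQ_le[OF _ tendsto_mult[OF tendsto_const hardy_norm_tendsto[OF R order_refl]]])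
      (intro exI allI impI hardy_inf_mult_poly_norm D dR)
qed

subsection \<open>Smooth numbers\<close>

text \<open>The inequality is strict, so that all \<open>0 < n < d\<close> are
  \<open>d\<close>-smooth and 1 is the only 0-smooth number, where the induction on \<open>d\<close>
  starts.\<close>

definition smooth :: "nat \<Rightarrow> nat \<Rightarrow> bool" where
  "smooth d n \<longleftrightarrow> n > 0 \<and> (\<forall>p. prime p \<longrightarrow> p dvd n \<longrightarrow> p < d)"

definition restrict_smooth :: "nat \<Rightarrow> (nat \<Rightarrow> complex) \<Rightarrow> nat \<Rightarrow> complex" where
  "restrict_smooth d a = (\<lambda>n. if smooth d n then a n else 0)"

lemma smooth_mult: "smooth d (m * n) \<longleftrightarrow> smooth d m \<and> smooth d n"
  by (auto simp: smooth_def prime_dvd_mult_iff)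

lemma smooth_if_less: "0 < n \<Longrightarrow> n < d \<Longrightarrow> smooth d n"
  by (auto simp: smooth_def dest: dvd_imp_le)

lemma restrict_smooth_mult:
  "restrict_smooth d (dirichlet_mult a b) = dirichlet_mult (restrict_smooth d a) (restrict_smooth d b)"
proof
  fix n
  show "restrict_smooth d (dirichlet_mult a b) n = dirichlet_mult (restrict_smooth d a) (restrict_smooth d b) n"
  proof (cases "n = 0")
    case False
    \<comment> \<open>A product is smooth exactly when both factors are, which makes the restriction
      multiplicative for Dirichlet convolution.\<close>
    have "restrict_smooth d a k * restrict_smooth d b (n div k) = (if smooth d n then a k * b (n div k) else 0)" if "k dvd n" for k
      using that smooth_mult[of d k "n div k"] by (auto simp: restrict_smooth_def)
    then show ?thesis using False by (simp add: dirichlet_mult_def restrict_smooth_def)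
  qed (simp add: dirichlet_mult_def restrict_smooth_def smooth_def)
qed

text \<open>The finite Euler product over primes below \<open>d\<close>, one prime per induction
  step. Every factor is a convergent geometric series for any positive \<open>\<sigma>\<close>, in
  contrast to the sum over all integers.\<close>

lemma smooth_powr_sum_bounded:
  assumes \<sigma>: "\<sigma> > 0"
  shows "\<exists>S. \<forall>F. finite F \<longrightarrow> F \<subseteq> {n. smooth d n} \<longrightarrow> (\<Sum>n\<in>F. real n powr - \<sigma>) \<le> S"
proof (induction d)
  case 0
  have "n = 1" if "smooth 0 n" for n
    using that prime_factor_nat[of n] by (auto simp: smooth_def)
  then have "F \<subseteq> {1}" if "F \<subseteq> {n. smooth 0 n}" for F using that by blast
  then have "(\<Sum>n\<in>F. real n powr - \<sigma>) \<le> (\<Sum>n\<in>{1::nat}. real n powr - \<sigma>)" if "F \<subseteq> {n. smooth 0 n}" for F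
    using that by (intro sum_mono2) auto
  then show ?case by blast
next
  case (Suc d)
  then obtain S where S: "\<And>F. finite F \<Longrightarrow> F \<subseteq> {n. smooth d n} \<Longrightarrow> (\<Sum>n\<in>F. real n powr - \<sigma>) \<le> S" by blast
  show ?case
  proof (cases "prime d")
    case False
    have "smooth (Suc d) n \<Longrightarrow> smooth d n" for n
      using False unfolding smooth_def by (metis less_Suc_eq)
    then have "{n. smooth (Suc d) n} \<subseteq> {n. smooth d n}" by blast
    with S show ?thesis by (meson order_trans)
  next
    case True
    define x where "x = real d powr - \<sigma>"
    have d: "d > 1" using True by (rule prime_gt_1_nat)
    have x: "0 < x" "x < 1" using d \<sigma> by (simp_all add: x_def powr_less_one)
    have S0: "S \<ge> 0" using S[of "{}"] by simp
    define k where "k n = multiplicity d n" for n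
    define m where "m n = n div d ^ k n" for n
    have dec: "n = d ^ k n * m n" and sm: "smooth d (m n)" if n: "smooth (Suc d) n" for n
    proof -
      have n0: "n > 0" using n by (simp add: smooth_def)
      show *: "n = d ^ k n * m n" by (simp add: k_def m_def multiplicity_dvd)
      have nd: "\<not> d dvd m n"
        unfolding m_def k_def using n0 d by (intro multiplicity_decompose) auto
      have "smooth (Suc d) (m n)" using n * smooth_mult by metis
      then show "smooth d (m n)" using nd unfolding smooth_def by (metis less_Suc_eq)
    qed
    have "(\<Sum>n\<in>F. real n powr - \<sigma>) \<le> S / (1 - x)" if F: "finite F" "F \<subseteq> {n. smooth (Suc d) n}" for F
    proof -
      \<comment> \<open>Writing n = d^k m with \<open>m\<close> smooth for \<open>d\<close> embeds
        \<open>F\<close> into a product set, over which the sum factors into a geometric sum and a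
        sum bounded by \<open>S\<close>.\<close>
      have inj: "inj_on (\<lambda>n. (k n, m n)) F"
      proof (rule inj_onI)
        fix a b assume "a \<in> F" "b \<in> F" and e: "(k a, m a) = (k b, m b)"
        then have "smooth (Suc d) a" "smooth (Suc d) b" using F by auto
        from dec[OF this(1)] dec[OF this(2)] e show "a = b" by (metis prod.inject)
      qed
      have val: "real n powr - \<sigma> = x ^ k n * real (m n) powr - \<sigma>" if "n \<in> F" for n
      proof -
        have "real n = real (d ^ k n) * real (m n)" using dec[of n] that F by (metis mem_Collect_eq of_nat_mult subsetD)
        then have "real n powr - \<sigma> = (real d ^ k n) powr - \<sigma> * real (m n) powr - \<sigma>" by (simp add: powr_mult)
        also have "(real d ^ k n) powr - \<sigma> = x ^ k n"
          unfolding x_def using d by (simp add: powr_powr mult.commute flip: powr_realpow)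
        finally show ?thesis .
      qed
      have "(\<Sum>n\<in>F. real n powr - \<sigma>) = (\<Sum>(i, j)\<in>(\<lambda>n. (k n, m n)) ` F. x ^ i * real j powr - \<sigma>)"
        unfolding sum.reindex[OF inj] by (intro sum.cong refl) (simp add: val)
      also have "\<dots> \<le> (\<Sum>(i, j)\<in>k ` F \<times> m ` F. x ^ i * real j powr - \<sigma>)"
        using F x by (intro sum_mono2) auto
      also have "\<dots> = (\<Sum>i\<in>k ` F. x ^ i) * (\<Sum>j\<in>m ` F. real j powr - \<sigma>)"
        by (simp add: sum_product sum.cartesian_product)
      also have "\<dots> \<le> (1 / (1 - x)) * S"
      proof (intro mult_mono S sum_nonneg)
        have "(\<Sum>i\<in>k ` F. x ^ i) \<le> (\<Sum>i. x ^ i)"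
          using F x by (intro sum_le_suminf summable_geometric) auto
        then show "(\<Sum>i\<in>k ` F. x ^ i) \<le> 1 / (1 - x)" using x by (simp add: suminf_geometric)
      qed (use F x sm in auto)
      finally show ?thesis by simp
    qed
    then show ?thesis by blast
  qed
qed

lemma summable_smooth_powr:
  assumes "\<sigma> > 0"
  shows "summable (\<lambda>n. if smooth d n then real n powr - \<sigma> else 0)"
proof -
  obtain S where S: "\<And>F. finite F \<Longrightarrow> F \<subseteq> {n. smooth d n} \<Longrightarrow> (\<Sum>n\<in>F. real n powr - \<sigma>) \<le> S"
    using smooth_powr_sum_bounded[OF assms] by blast
  show ?thesis
  proof (rule summableI_nonneg_bounded)
    fix N
    have "(\<Sum>n<N. if smooth d n then real n powr - \<sigma> else 0) = (\<Sum>n\<in>{n. n < N \<and> smooth d n}. real n powr - \<sigma>)"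
      by (intro sum.mono_neutral_cong_right) auto
    also have "\<dots> \<le> S" by (rule S) auto
    finally show "(\<Sum>n<N. if smooth d n then real n powr - \<sigma> else 0) \<le> S" .
  qed auto
qed

lemma restrict_smooth_term_le:
  assumes "\<And>n. norm (a n) \<le> C"
  shows "norm (restrict_smooth d a n * of_nat n powr (- s)) \<le> C * (if smooth d n then real n powr - Re s else 0)"
  using assms[of n] by (auto simp: restrict_smooth_def norm_mult norm_of_nat_powr intro!: mult_right_mono)

lemma summable_restrict_smooth:
  assumes "\<And>n. norm (a n) \<le> C" "Re s > 0"
  shows "summable (\<lambda>n. norm (restrict_smooth d a n * of_nat n powr (- s)))"
  by (rule summable_comparison_test[OF _ summable_mult[OF summable_smooth_powr[OF assms(2), of d], of C]])
    (use restrict_smooth_term_le[of a, OF assms(1)] in auto)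

lemma norm_eval_restrict_smooth_le:
  assumes "\<And>n. norm (a n) \<le> C" "Re s > 0"
  shows "norm (dirichlet_eval (restrict_smooth d a) s) \<le> C * (\<Sum>n. if smooth d n then real n powr - Re s else 0)"
proof -
  have "norm (dirichlet_eval (restrict_smooth d a) s) \<le> (\<Sum>n. C * (if smooth d n then real n powr - Re s else 0))"
    unfolding dirichlet_eval_def
    by (rule norm_suminf_le[OF restrict_smooth_term_le[of a, OF assms(1)] summable_mult[OF summable_smooth_powr[OF assms(2)]]])
  also have "\<dots> = C * (\<Sum>n. if smooth d n then real n powr - Re s else 0)"
    by (rule suminf_mult[OF summable_smooth_powr[OF assms(2)]])
  finally show ?thesis .
qed

lemma dirichlet_eval_unit: "dirichlet_eval (restrict_smooth d (dirichlet_unit 1)) s = 1"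
proof -
  have "(\<lambda>n. restrict_smooth d (dirichlet_unit 1) n * of_nat n powr (- s)) sums
      (\<Sum>n\<in>{1}. restrict_smooth d (dirichlet_unit 1) n * of_nat n powr (- s))"
    by (rule sums_finite) (auto simp: restrict_smooth_def dirichlet_unit_def split: if_splits)
  then show ?thesis
    unfolding dirichlet_eval_def by (simp add: sums_iff restrict_smooth_def dirichlet_unit_def smooth_def)
qed

text \<open>The constant \<open>S\<close> does not depend on \<open>k\<close> and disappears under
  k-th roots; equivalently, (x/c)^k could not stay bounded if \<open>x > c\<close>.\<close>

lemma le_if_power_le_mult_power:
  fixes x c S :: real
  assumes "\<And>k. x ^ k \<le> S * c ^ k" "c \<ge> 0"
  shows "x \<le> c"
proof (rule ccontr)
  assume "\<not> x \<le> c"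
  then have xc: "x > c" by simp
  show False
  proof (cases "c = 0")
    case True
    then show False using assms(1)[of 1] xc by simp
  next
    case False
    then have c: "c > 0" using assms(2) by simp
    then have "x / c > 1" using xc by simp
    then obtain k where "S < (x / c) ^ k" using real_arch_pow by blast
    then have "S * c ^ k < x ^ k" using c by (simp add: power_divide field_simps)
    with assms(1)[of k] show False by simp
  qed
qed

lemma dirichlet_eval_holomorphic:
  assumes "a 0 = 0" and "\<And>\<sigma>. \<sigma> > 0 \<Longrightarrow> summable (\<lambda>n. norm (a n) * real n powr - \<sigma>)"
  shows "dirichlet_eval a holomorphic_on {s. Re s > 0}"
proof (rule holomorphic_uniform_sequence)
  show "open {s. Re s > 0}" by (rule open_halfspace_Re_gt)
  show "(\<lambda>s. \<Sum>n<N. a n * of_nat n powr (- s)) holomorphic_on {s. Re s > 0}" for N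
    by (intro holomorphic_intros)
  fix s :: complex assume s: "s \<in> {s. Re s > 0}"
  \<comment> \<open>On the ball of this radius all real parts are at least \<open>r\<close>, so the
    series at \<open>r\<close> is a uniform majorant.\<close>
  define r where "r = Re s / 2"
  have r: "r > 0" using s by (simp add: r_def)
  have Re: "Re z \<ge> r" if "z \<in> cball s r" for z
    using that abs_Re_le_cmod[of "s - z"] by (simp add: dist_norm r_def)
  show "\<exists>d>0. cball s d \<subseteq> {s. Re s > 0} \<and> uniform_limit (cball s d) (\<lambda>N s. \<Sum>n<N. a n * of_nat n powr (- s)) (dirichlet_eval a) sequentially"
  proof (intro exI[of _ r] conjI r)
    show "cball s r \<subseteq> {s. Re s > 0}" using Re r by fastforce
    show "uniform_limit (cball s r) (\<lambda>N s. \<Sum>n<N. a n * of_nat n powr (- s)) (dirichlet_eval a) sequentially"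
      unfolding dirichlet_eval_def[abs_def]
    proof (rule Weierstrass_m_test[OF _ assms(2)[OF r]])
      fix n z assume z: "z \<in> cball s r"
      show "norm (a n * of_nat n powr (- z)) \<le> norm (a n) * real n powr - r"
      proof (cases "n = 0")
        case False
        then show ?thesis unfolding norm_mult norm_of_nat_powr
          using Re[OF z] by (intro mult_left_mono powr_mono) auto
      qed (simp add: assms(1))
    qed
  qed
qed

subsection \<open>Multiplication on \<open>H\<^sup>1\<close>\<close>

text \<open>The powers \<open>D\<^sup>k\<close> have \<open>H\<^sup>1\<close>-norm at most \<open>c\<^sup>k\<close>. Point evaluations at \<open>Re s > 0\<close> are bounded on
  the series supported on \<open>d\<close>-smooth numbers, so taking \<open>k\<close>-th roots gives the bound \<open>c\<close> for the
  restrictions of \<open>D\<close>, uniformly in \<open>d\<close>.\<close>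

lemma eval_restrict_smooth_le:
  assumes D: "D \<in> hardy_inf" and c: "c \<ge> 0"
    and bound: "\<And>f. f \<in> hardy 1 \<Longrightarrow> hardy_norm 1 (dirichlet_mult D f) \<le> c * hardy_norm 1 f"
    and s: "Re s > 0"
  shows "norm (dirichlet_eval (restrict_smooth d D) s) \<le> c"
proof (rule le_if_power_le_mult_power[OF _ c])
  fix k
  \<comment> \<open>The coefficients of the k-th power of \<open>D\<close>, built from the constant
    series 1, whose H^1 norm is at most 1.\<close>
  define E where "E k = (dirichlet_mult D ^^ k) (dirichlet_unit 1)" for k
  have E_Suc: "E (Suc k) = dirichlet_mult D (E k)" for k by (simp add: E_def)
  have E: "E k \<in> hardy 1 \<and> hardy_norm 1 (E k) \<le> c ^ k" for k
  proof (induction k)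
    case 0
    have u: "dirichlet_poly (dirichlet_unit 1)" by (rule dirichlet_poly_unit) simp
    have "poly_norm 1 (dirichlet_unit 1) \<le> 1"
      unfolding poly_norm_eq by (intro bes_norm_le_bound almost_per_boundary u) (auto simp: boundary_unit)
    then show ?case using u by (simp add: E_def hardy_poly hardy_norm_poly)
  next
    case (Suc k)
    have "hardy_norm 1 (E (Suc k)) \<le> c * hardy_norm 1 (E k)" unfolding E_Suc using bound Suc by blast
    also have "\<dots> \<le> c * c ^ k" using Suc c by (intro mult_left_mono) auto
    finally show ?case using hardy_inf_mult(1)[OF D, of "E k"] Suc by (simp add: E_Suc)
  qed
  have coeff: "norm (E k n) \<le> c ^ k" for k n
    using coeff_le_hardy_norm[of "E k" 1 n] E[of k] by linarith
  have Dh: "D \<in> hardy 2" by (rule hardyI[OF hardy_inf_approx[OF D]])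
  have Dc: "norm (D n) \<le> hardy_norm 2 D" for n by (rule coeff_le_hardy_norm[OF Dh]) simp
  have z: "restrict_smooth d a 0 = 0" for a by (simp add: restrict_smooth_def smooth_def)
  have "dirichlet_eval (restrict_smooth d (E k)) s = dirichlet_eval (restrict_smooth d D) s ^ k" for k
  proof (induction k)
    case 0
    show ?case using dirichlet_eval_unit by (simp add: E_def)
  next
    case (Suc k)
    show ?case
      unfolding E_Suc restrict_smooth_mult
        dirichlet_eval_mult[OF z z summable_restrict_smooth[of D, OF Dc s] summable_restrict_smooth[of "E k", OF coeff s]]
      by (simp add: Suc)
  qed
  then have "norm (dirichlet_eval (restrict_smooth d D) s) ^ k = norm (dirichlet_eval (restrict_smooth d (E k)) s)"
    by (simp add: norm_power)
  \<comment> \<open>The sum over smooth numbers depends on \<open>d\<close> and \<open>s\<close> but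
    not on \<open>k\<close>, as the root argument requires.\<close>
  also have "\<dots> \<le> (\<Sum>n. if smooth d n then real n powr - Re s else 0) * c ^ k"
    using norm_eval_restrict_smooth_le[of "E k", OF coeff s] by (simp add: mult.commute)
  finally show "norm (dirichlet_eval (restrict_smooth d D) s) ^ k \<le> (\<Sum>n. if smooth d n then real n powr - Re s else 0) * c ^ k" .
qed

text \<open>The restrictions of \<open>D\<close> to smooth numbers obey the bound \<open>c\<close>
  on the whole half-plane but are seen to converge to \<open>D\<close> only where it converges
  absolutely. The uniform bound yields a locally convergent subsequence, and the identity theorem
  carries the limit to Re s > 0.\<close>

lemma hardy_inf_norm_le_multiplier_bound:
  assumes D: "D \<in> hardy_inf" and c: "c \<ge> 0"
    and bound: "\<And>f. f \<in> hardy 1 \<Longrightarrow> hardy_norm 1 (dirichlet_mult D f) \<le> c * hardy_norm 1 f"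
  shows "hardy_inf_norm D \<le> c"
proof -
  let ?S = "{s. Re s > 0}"
  define h where "h d = dirichlet_eval (restrict_smooth d D)" for d
  have Dh: "D \<in> hardy 2" by (rule hardyI[OF hardy_inf_approx[OF D]])
  define C where "C = hardy_norm 2 D"
  have Dc: "norm (D n) \<le> C" for n unfolding C_def by (rule coeff_le_hardy_norm[OF Dh]) simp
  have hle: "norm (h d s) \<le> c" if "Re s > 0" for d s
    unfolding h_def by (rule eval_restrict_smooth_le[OF D c bound that])
  have hol: "h d holomorphic_on ?S" for d
    unfolding h_def
  proof (rule dirichlet_eval_holomorphic)
    show "summable (\<lambda>n. norm (restrict_smooth d D n) * real n powr - \<sigma>)" if "\<sigma> > 0" for \<sigma>
      using summable_restrict_smooth[of D C "of_real \<sigma>" d, OF Dc] that by (simp add: norm_mult norm_of_nat_powr)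
  qed (simp add: restrict_smooth_def smooth_def)
  have lim: "(\<lambda>d. h d s) \<longlonglongrightarrow> dirichlet_eval D s" if s: "Re s > 2" for s
  proof -
    have sum2: "summable (\<lambda>n. norm (D n) * real n powr - 2)" by (rule hardy_inf_summable_2[OF D])
  let ?t = "\<lambda>d. (\<Sum>n. norm (D (n + d)) * real (n + d) powr - 2)"
    have tl: "norm (h d s - dirichlet_eval D s) \<le> ?t d" for d
    proof -
      define u where "u n = (restrict_smooth d D n - D n) * of_nat n powr (- s)" for n
      have le: "norm (u n) \<le> norm (D n) * real n powr - 2" for n
      proof (cases "n = 0")
        case False
        have "norm (restrict_smooth d D n - D n) \<le> norm (D n)" by (simp add: restrict_smooth_def)
        then show ?thesis unfolding u_def norm_mult norm_of_nat_powr
          using False s by (intro mult_mono powr_mono) auto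
      qed (simp add: u_def)
      \<comment> \<open>Every positive \<open>n < d\<close> is smooth, so the restriction changes
        only the tail from \<open>d\<close> on.\<close>
      have u0: "u n = 0" if "n < d" for n
        using that smooth_if_less[of n d] hardy_infD(1)[OF D] by (cases "n = 0") (auto simp: u_def restrict_smooth_def)
      have su: "summable u" by (rule summable_comparison_test[OF _ sum2]) (use le in auto)
      have "summable (\<lambda>n. restrict_smooth d D n * of_nat n powr (- s))"
        by (rule summable_norm_cancel, rule summable_restrict_smooth[of D, OF Dc]) (use s in simp)
      then have "(\<Sum>n. u n) = h d s - dirichlet_eval D s"
        unfolding u_def left_diff_distrib h_def dirichlet_eval_def
        by (rule suminf_diff[symmetric]) (use hardy_infD(2)[OF D] s in auto)
      moreover have "(\<Sum>n. u n) = (\<Sum>n. u (n + d))"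
        using suminf_split_initial_segment[OF su, of d] u0 by simp
      moreover have "norm (\<Sum>n. u (n + d)) \<le> ?t d"
        by (intro norm_suminf_le le) (rule summable_ignore_initial_segment[OF sum2])
      ultimately show ?thesis by simp
    qed
    have "(\<lambda>d. \<Sum>n. norm (D (n + d)) * real (n + d) powr - 2) \<longlonglongrightarrow> 0"
      by (rule suminf_exist_split2[OF sum2])
    then have "(\<lambda>d. h d s - dirichlet_eval D s) \<longlonglongrightarrow> 0"
      by (rule Lim_null_comparison[rotated]) (intro always_eventually allI tl)
    then show ?thesis by (simp only: LIM_zero_iff)
  qed
  obtain g r where g: "g holomorphic_on ?S" and r: "strict_mono (r :: nat \<Rightarrow> nat)"
    and gl: "\<And>x. x \<in> ?S \<Longrightarrow> (\<lambda>n. h (r n) x) \<longlonglongrightarrow> g x"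
  proof -
    have ob: "open ?S" by (rule open_halfspace_Re_gt)
    have hb: "\<exists>B. \<forall>k\<in>range h. \<forall>z\<in>K. norm (k z) \<le> B" if "compact K" "K \<subseteq> ?S" for K
      using that hle by (intro exI[of _ c]) auto
    show thesis
      by (rule Montel[of ?S "range h" h, OF ob _ hb order_refl]) (use hol that in auto)
  qed
  have eq: "g s = dirichlet_eval D s" if "s \<in> ?S" for s
  proof (rule analytic_continuation_open[of "{s. Re s > 2}" ?S g "dirichlet_eval D"])
    show "{s. Re s > 2} \<noteq> {}" by (rule ex_in_conv[THEN iffD1], rule exI[of _ 3]) simp
    show "g z = dirichlet_eval D z" if z: "z \<in> {s. Re s > 2}" for z
    proof (rule LIMSEQ_unique)
      show "(\<lambda>n. h (r n) z) \<longlonglongrightarrow> g z" using z by (intro gl) auto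
      show "(\<lambda>n. h (r n) z) \<longlonglongrightarrow> dirichlet_eval D z"
        using LIMSEQ_subseq_LIMSEQ[OF lim r] z by (simp add: o_def)
    qed
  qed (use that g hardy_infD(3)[OF D] in \<open>auto simp: open_halfspace_Re_gt convex_connected convex_halfspace_Re_gt\<close>)
  have "norm (dirichlet_eval D s) \<le> c" if "s \<in> ?S" for s
    using tendsto_upperbound[OF tendsto_norm[OF gl[OF that]], of c] hle that eq by auto
  then show ?thesis
    unfolding hardy_inf_norm_def by (intro cSUP_least) (auto intro: exI[of _ 1])
qed

theorem essential_norm_mult_hardy_inf:
  assumes D: "D \<in> hardy_inf"
  shows "dirichlet_mult D \<in> hardy 1 \<rightarrow> hardy 1" "essential_norm 1 1 (dirichlet_mult D) = ereal (hardy_inf_norm D)"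
proof -
  define B where "B = hardy_inf_norm D"
  have B: "B \<ge> 0" unfolding B_def by (rule hardy_inf_norm_nonneg[OF D])
  show "dirichlet_mult D \<in> hardy 1 \<rightarrow> hardy 1" using hardy_inf_mult(1)[OF D] by auto
  show "essential_norm 1 1 (dirichlet_mult D) = ereal (hardy_inf_norm D)"
  proof (rule antisym)
    show "essential_norm 1 1 (dirichlet_mult D) \<le> ereal (hardy_inf_norm D)"
      by (intro essential_norm_le hardy_inf_mult(2)[OF D] hardy_inf_norm_nonneg[OF D]) auto
    show "ereal (hardy_inf_norm D) \<le> essential_norm 1 1 (dirichlet_mult D)"
    proof (rule essential_norm_ge[of 1 1 "\<lambda>N. truncate N D"])
      fix c :: real
      assume c: "c \<ge> 0" and poly: "\<And>f. dirichlet_poly f \<Longrightarrow> hardy_norm 1 (dirichlet_mult D f) \<le> c * poly_norm 1 f"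
      show "hardy_inf_norm D \<le> c"
      proof (rule hardy_inf_norm_le_multiplier_bound[OF D c])
        fix f assume f: "f \<in> hardy 1"
        obtain R where R: "hardy_approx 1 R f" using f by (rule hardyE)
        note dR = hardy_approxD(1)[OF R]
        have Rh: "R k \<in> hardy 1" for k by (rule hardy_poly[OF dR])
        \<comment> \<open>The bound on polynomials extends to H^1 by density. The remainder is
          controlled by the a priori constant \<open>B\<close>, which multiplies a null
          sequence.\<close>
        have le: "hardy_norm 1 (dirichlet_mult D f) \<le> B * hardy_norm 1 (\<lambda>n. f n - R k n) + c * poly_norm 1 (R k)" for k
        proof -
          have "hardy_norm 1 (dirichlet_mult D f) \<le> hardy_norm 1 (\<lambda>n. dirichlet_mult D f n - dirichlet_mult D (R k) n) + hardy_norm 1 (dirichlet_mult D (R k))"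
            by (intro hardy_norm_triangle_diff hardy_inf_mult(1)[OF D] f Rh order_refl)
          also have "(\<lambda>n. dirichlet_mult D f n - dirichlet_mult D (R k) n) = dirichlet_mult D (\<lambda>n. f n - R k n)"
            by (simp only: dirichlet_mult_diff_right)
          also have "hardy_norm 1 \<dots> \<le> B * hardy_norm 1 (\<lambda>n. f n - R k n)"
            unfolding B_def by (intro hardy_inf_mult(2)[OF D] hardy_diff f Rh order_refl)
          finally show ?thesis using poly[OF dR[of k]] by linarith
        qed
        have "(\<lambda>k. B * hardy_norm 1 (\<lambda>n. f n - R k n) + c * poly_norm 1 (R k)) \<longlonglongrightarrow> B * 0 + c * hardy_norm 1 f"
          by (intro tendsto_intros hardy_approx_norm_diff[OF R] hardy_norm_tendsto[OF R]) auto
        then show "hardy_norm 1 (dirichlet_mult D f) \<le> c * hardy_norm 1 f"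
          by (intro LIMSEQ_le_const[of "\<lambda>k. B * hardy_norm 1 (\<lambda>n. f n - R k n) + c * poly_norm 1 (R k)"]) (auto intro: le)
      qed
    qed (auto intro: hardy_inf_mult_approx[OF D] dirichlet_poly_truncate[of D, OF hardy_infD(1)[OF D]])
  qed
qed

theorem theorem1p2:
  shows "(\<forall>p q :: real. \<forall>D. 1 \<le> q \<and> q < p \<and> D \<in> hardy (p * q / (p - q)) \<longrightarrow>
            dirichlet_mult D \<in> hardy p \<rightarrow> hardy q \<and>
            essential_norm p q (dirichlet_mult D) = ereal (hardy_norm (p * q / (p - q)) D)) \<and>
         (\<forall>D \<in> hardy_inf.
            dirichlet_mult D \<in> hardy 1 \<rightarrow> hardy 1 \<and>
            essential_norm 1 1 (dirichlet_mult D) = ereal (hardy_inf_norm D))"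
  using essential_norm_mult_less[OF _ _ refl] essential_norm_mult_hardy_inf by blast

end
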